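(* Let $w\in(0,1)$. For site percolation on the triangular lattice (or for any model in which logarithmic scaling holds, that is, for which there are exponents $\nu,\beta>0$ with $\xi(p)\approx|p-p_c|^{-\nu}$ and $P_\infty(p)\approx(p-p_c)^{\beta}$ as $p\downarrow p_c$), let $\lambda=w/\nu$ and let $\Psi_N$ be the number of sites in $S_N$ that belong to the infinite cluster of the inhomogeneous model $\tilde{\mathbb P}_w$ with density $p(z)=p_c+\alpha(r(z)^w)$. Then, as $N\to\infty$, $$\tilde{\mathbb E}_w(\Psi_N)\approx N^{2-\lambda\beta}.$$
   Context: Percolation model. We consider an independent (bond or site) percolation model on a planar lattice which has reflection symmetry about the vertical axis and is invariant under a rotation by some angle in $(0,\pi)$, and for which Kesten's results on critical and near-critical 2D percolation hold (in particular the Russo–Seymour–Welsh bounds: at $p=p_c$ crossing probabilities of parallelograms are bounded away from $0$ and $1$ by constants depending only on the aspect ratio, for both the model and its dual; and the near-critical relation $P_\infty(p)\asymp\mathbb P_{p_c}(0\leadsto\partial S_{L(p)})$ for $p>p_c$, where $f\asymp g$ means that $f/g$ is bounded away from $0$ and $\infty$ and $L(p)$ is the finite-size correlation length, i.e. the smallest scale $n$ at which the long-way occupied crossing of a $3n\times n$ parallelogram has probability larger than $1-c\delta$, for a suitable fixed constant $c$ and fixed $\delta\in(0,1)$). Bond or site percolation on the square or triangular lattice are the models to keep in mind. Bonds or sites (as appropriate) are independently occupied with probability $p$ and vacant with probability $1-p$; $\mathbb P_p$ is the corresponding homogeneous measure. For site percolation on the triangular lattice, the exponents $\nu$ and $\beta$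 in the logarithmic scaling relations are known to exist. Geometry. $r(z)=\|z\|$ is the infinity norm of $z$ with respect to the coordinates along the $x$-axis and the axis obtained from it by the symmetry rotation. $S_N$ is the set of points at distance at most $N$ from the origin (a rhombus), $\partial S_N$ the set of points at distance exactly $N$. Connections. $A\leadsto B$ is the event that some site of $A$ is connected to some site of $B$ by an occupied path ($B$ may be "infinity"). $P_\infty(p)=\mathbb P_p(0\leadsto\infty)$, and $p_c\in(0,1)$ is the threshold: $P_\infty(p)>0$ iff $p>p_c$. Correlation length. For $p>p_c$, let $\tau^*_{0^*,z^*}(p)$ be the probability that the dual sites $0^*$ (the dual origin) and $z^*$ are connected by a path in the dual model, and let $\tau^*_n(p)$ be the maximum of $\tau^*_{0^*,z^*}(p)$ over $z^*$ with $\|z^*\|$ within a lattice spacing of $n$. The correlation length $\xi(p)$ is defined by $\lim_{n\to\infty}[\tau^*_n(p)]^{1/n}=e^{-1/\xi(p)}$, with $\xi(1)=0$. It is continuous and monotone on $(p_c,1]$ and diverges as $p\downarrow p_c$. Let $\alpha:[0,\infty)\to(0,1-p_c]$ be the inverse function defined by $\xi(p_c+\alpha(r))=r$. Inhomogeneous model. For $w\in(0,1)$, $\tilde{\mathbb P}_w$ is the measure under which sites (or bonds) are independently occupied, with probability $p(z)=p_c+\varepsilon(r(z))$ at location $z$, where $\varepsilon(r)=\alpha(r^w)$. $\tilde{\mathbb E}_w$ denotes expectation under $\tilde{\mathbb P}_w$. (Under logarithmic scaling, $\varepsilon(r)\approx r^{-\lambda}$ with $\lambda=w/\nu$.) A site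 belongs to the infinite cluster if it is connected to infinity. Asymptotics. $f\approx g$ means $\log f/\log g\to1$ (logarithmic equivalence), in the limit indicated. *)

theory Defs
  imports "HOL-Probability.Probability"
begin

section \<open>Planar lattices and percolation models\<close>

datatype percolation_kind = Site | Bond

text \<open>
  A lattice is a graph drawn in the complex plane with straight bonds; a bond is the two-element
  set of its end points. The origin is a site, the vertical axis is the imaginary axis, and
  \<open>rot_angle\<close> is the angle of the symmetry rotation. Of the components of a model, \<open>dual_origin\<close>
  is the dual site \<open>0\<^sup>*\<close>.
\<close>

record percolation_model =
  sites :: "complex set"
  bonds :: "complex set set"
  rot_angle :: real
  kind :: percolation_kind
  dual_origin :: "complex set"

text \<open>Coordinates along the x-axis and along the axis obtained from it by the symmetry rotation:
  \<open>z = coord1 z + coord2 z * cis rot_angle\<close>.\<close>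

definition coord2 :: "percolation_model \<Rightarrow> complex \<Rightarrow> real" where
  "coord2 M z = Im z / sin (rot_angle M)"

definition coord1 :: "percolation_model \<Rightarrow> complex \<Rightarrow> real" where
  "coord1 M z = Re z - coord2 M z * cos (rot_angle M)"

definition lnorm :: "percolation_model \<Rightarrow> complex \<Rightarrow> real" where
  "lnorm M z = max \<bar>coord1 M z\<bar> \<bar>coord2 M z\<bar>"

definition rhombus :: "percolation_model \<Rightarrow> real \<Rightarrow> complex set" where
  "rhombus M N = {z. lnorm M z \<le> N}"

definition rhombus_boundary :: "percolation_model \<Rightarrow> real \<Rightarrow> complex set" where
  "rhombus_boundary M N = {z. lnorm M z = N}"

definition invariant_under :: "percolation_model \<Rightarrow> (complex \<Rightarrow> complex) \<Rightarrow> bool" where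
  "invariant_under M T \<longleftrightarrow> T ` sites M = sites M \<and> (`) T ` bonds M = bonds M"

definition faces :: "percolation_model \<Rightarrow> complex set set" where
  "faces M = components (- (\<Union>e\<in>bonds M. convex hull e))"

text \<open>
  The dual model. For bond percolation, the dual sites are the faces, and each bond is crossed by
  the dual bond that joins the faces on its two sides. For site percolation, the dual is the
  matching lattice: the same sites (here as singletons), two of them being adjacent if they lie on
  the boundary of a common face; on the triangular lattice this is the lattice itself.
\<close>

definition dual_sites :: "percolation_model \<Rightarrow> complex set set" where
  "dual_sites M = (case kind M of Site \<Rightarrow> (\<lambda>v. {v}) ` sites M | Bond \<Rightarrow> faces M)"

text \<open>
  The unit of length is the lattice spacing: the lattice has period 1 along the x-axis, hence,
  by rotation, also along the second axis.
\<close>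

definition planar_lattice :: "percolation_model \<Rightarrow> bool" where
  "planar_lattice M \<longleftrightarrow>
     0 \<in> sites M \<and>
     (\<forall>R. finite (sites M \<inter> cball 0 R)) \<and>
     (\<forall>e\<in>bonds M. e \<subseteq> sites M \<and> card e = 2) \<and>
     (\<forall>v\<in>sites M. finite {e \<in> bonds M. v \<in> e}) \<and>
     (\<forall>e\<in>bonds M. \<forall>f\<in>bonds M. e \<noteq> f \<longrightarrow> convex hull e \<inter> convex hull f = e \<inter> f) \<and>
     (\<forall>u\<in>sites M. \<forall>v\<in>sites M. (u, v) \<in> {(x, y). {x, y} \<in> bonds M}\<^sup>*) \<and>
     0 < rot_angle M \<and> rot_angle M < pi \<and>
     invariant_under M (\<lambda>z. - cnj z) \<and>
     invariant_under M (\<lambda>z. cis (rot_angle M) * z) \<and>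
     invariant_under M (\<lambda>z. 1 + z) \<and>
     dual_origin M \<in> dual_sites M \<and>
     (case kind M of Site \<Rightarrow> dual_origin M = {0} | Bond \<Rightarrow> 0 \<in> frontier (dual_origin M))"

text \<open>The point at which a finite set of points is located: a site \<open>{v}\<close> at \<open>v\<close>, a bond at its
  midpoint.\<close>

definition centroid :: "complex set \<Rightarrow> complex" where
  "centroid A = (\<Sum>x\<in>A. x) / of_nat (card A)"

text \<open>A face is located at the centroid of its corners.\<close>

definition dual_position :: "percolation_model \<Rightarrow> complex set \<Rightarrow> complex" where
  "dual_position M d =
     (case kind M of Site \<Rightarrow> centroid d | Bond \<Rightarrow> centroid (sites M \<inter> frontier d))"


section \<open>The percolation measures\<close>

text \<open>A configuration \<open>\<omega>\<close> maps each element (a singleton \<open>{v}\<close> for site percolation, a bond for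
  bond percolation) to \<open>True\<close> if it is occupied and to \<open>False\<close> if it is vacant.\<close>

definition elements :: "percolation_model \<Rightarrow> complex set set" where
  "elements M = (case kind M of Site \<Rightarrow> (\<lambda>v. {v}) ` sites M | Bond \<Rightarrow> bonds M)"

definition percolation ::
    "percolation_model \<Rightarrow> (complex \<Rightarrow> real) \<Rightarrow> (complex set \<Rightarrow> bool) measure" where
  "percolation M p = (\<Pi>\<^sub>M e\<in>elements M. measure_pmf (bernoulli_pmf (p (centroid e))))"

definition hom_prob ::
    "percolation_model \<Rightarrow> real \<Rightarrow> ((complex set \<Rightarrow> bool) \<Rightarrow> bool) \<Rightarrow> real" where
  "hom_prob M p Q = \<P>(\<omega> in percolation M (\<lambda>_. p). Q \<omega>)"


section \<open>Connections\<close>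

text \<open>\<open>u\<close> and \<open>v\<close> are joined by an occupied path all of whose sites lie in the region \<open>R\<close>.
  For site percolation both end points of the path have to be occupied.\<close>

definition joined_in ::
    "percolation_model \<Rightarrow> (complex set \<Rightarrow> bool) \<Rightarrow> complex set \<Rightarrow> complex \<Rightarrow> complex \<Rightarrow> bool" where
  "joined_in M \<omega> R u v \<longleftrightarrow>
     u \<in> sites M \<and> u \<in> R \<and> (kind M = Site \<longrightarrow> \<omega> {u}) \<and>
     (u, v) \<in> {(x, y). {x, y} \<in> bonds M \<and> y \<in> R \<and>
                       (case kind M of Site \<Rightarrow> \<omega> {y} | Bond \<Rightarrow> \<omega> {x, y})}\<^sup>*"

definition dual_joined_in ::
    "percolation_model \<Rightarrow> (complex set \<Rightarrow> bool) \<Rightarrow> complex set \<Rightarrow> complex set \<Rightarrow> complex set \<Rightarrow> bool"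
  where
  "dual_joined_in M \<omega> R d d' \<longleftrightarrow>
     d \<in> dual_sites M \<and> dual_position M d \<in> R \<and> (kind M = Site \<longrightarrow> \<not> \<omega> d) \<and>
     (d, d') \<in> {(x, y). y \<in> dual_sites M \<and> dual_position M y \<in> R \<and>
        (case kind M of
           Site \<Rightarrow> \<not> \<omega> y \<and> (\<exists>f\<in>faces M. x \<union> y \<subseteq> frontier f)
         | Bond \<Rightarrow> \<exists>e\<in>bonds M. convex hull e \<subseteq> frontier x \<inter> frontier y \<and> \<not> \<omega> e)}\<^sup>*"

definition connects ::
    "percolation_model \<Rightarrow> (complex set \<Rightarrow> bool) \<Rightarrow> complex set \<Rightarrow> complex set \<Rightarrow> bool" where
  "connects M \<omega> A B \<longleftrightarrow> (\<exists>u\<in>A. \<exists>v\<in>B. joined_in M \<omega> UNIV u v)"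

definition connects_to_infinity ::
    "percolation_model \<Rightarrow> (complex set \<Rightarrow> bool) \<Rightarrow> complex \<Rightarrow> bool" where
  "connects_to_infinity M \<omega> z \<longleftrightarrow> infinite {v. joined_in M \<omega> UNIV z v}"

definition P_infinity :: "percolation_model \<Rightarrow> real \<Rightarrow> real" where
  "P_infinity M p = hom_prob M p (\<lambda>\<omega>. connects_to_infinity M \<omega> 0)"

definition is_threshold :: "percolation_model \<Rightarrow> real \<Rightarrow> bool" where
  "is_threshold M pc \<longleftrightarrow>
     0 < pc \<and> pc < 1 \<and> (\<forall>p. 0 \<le> p \<and> p \<le> 1 \<longrightarrow> (P_infinity M p > 0 \<longleftrightarrow> p > pc))"


section \<open>Crossings and the near-critical relations\<close>

text \<open>
  Crossings of the parallelogram \<open>{z. 0 \<le> coord1 z \<le> a \<and> 0 \<le> coord2 z \<le> b}\<close> in the direction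
  of the x-axis. A path in the strip \<open>0 \<le> coord2 z \<le> b\<close> from the left of the parallelogram (its
  left side included) to the right of it contains a crossing. Asking for such a path
  accommodates lattices whose sites do not all lie on the lines on which the coordinates are
  integers, so that a crossing may jump over the sides without having a site on them.
\<close>

definition strip :: "percolation_model \<Rightarrow> real \<Rightarrow> complex set" where
  "strip M b = {z. 0 \<le> coord2 M z \<and> coord2 M z \<le> b}"

definition crossing :: "percolation_model \<Rightarrow> real \<Rightarrow> real \<Rightarrow> (complex set \<Rightarrow> bool) \<Rightarrow> bool" where
  "crossing M a b \<omega> \<longleftrightarrow>
     (\<exists>u v. coord1 M u \<le> 0 \<and> a \<le> coord1 M v \<and> joined_in M \<omega> (strip M b) u v)"

definition dual_crossing :: "percolation_model \<Rightarrow> real \<Rightarrow> real \<Rightarrow> (complex set \<Rightarrow> bool) \<Rightarrow> bool" where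
  "dual_crossing M a b \<omega> \<longleftrightarrow>
     (\<exists>d d'. coord1 M (dual_position M d) \<le> 0 \<and> a \<le> coord1 M (dual_position M d') \<and>
             dual_joined_in M \<omega> (strip M b) d d')"

text \<open>Russo--Seymour--Welsh bounds at the threshold; \<open>\<rho>\<close> is the aspect ratio.\<close>

definition rsw_bounds :: "percolation_model \<Rightarrow> real \<Rightarrow> bool" where
  "rsw_bounds M pc \<longleftrightarrow>
     (\<forall>\<rho>>0. \<exists>c>0. \<forall>\<^sub>F n in sequentially.
        hom_prob M pc (crossing M (\<rho> * real n) (real n)) \<in> {c..1 - c} \<and>
        hom_prob M pc (dual_crossing M (\<rho> * real n) (real n)) \<in> {c..1 - c})"

text \<open>The finite-size correlation length \<open>L(p)\<close>, with \<open>\<eta>\<close> in the role of \<open>c \<delta>\<close>.\<close>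

definition finite_size_length :: "percolation_model \<Rightarrow> real \<Rightarrow> real \<Rightarrow> nat" where
  "finite_size_length M \<eta> p =
     (LEAST n. 1 \<le> n \<and> hom_prob M p (crossing M (3 * real n) (real n)) > 1 - \<eta>)"

definition bounded_ratio_on :: "real set \<Rightarrow> (real \<Rightarrow> real) \<Rightarrow> (real \<Rightarrow> real) \<Rightarrow> bool" where
  "bounded_ratio_on A f g \<longleftrightarrow> (\<exists>c>0. \<exists>C. \<forall>x\<in>A. c \<le> f x / g x \<and> f x / g x \<le> C)"

definition near_critical_relation :: "percolation_model \<Rightarrow> real \<Rightarrow> real \<Rightarrow> bool" where
  "near_critical_relation M pc \<eta> \<longleftrightarrow>
     bounded_ratio_on {pc<..1} (P_infinity M)
       (\<lambda>p. hom_prob M pc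
              (\<lambda>\<omega>. connects M \<omega> {0} (rhombus_boundary M (real (finite_size_length M \<eta> p)))))"


section \<open>The correlation length\<close>

text \<open>The supremum is a maximum, since only finitely many dual sites have norm within the lattice
  spacing 1 of \<open>n\<close>.\<close>

definition tau_star :: "percolation_model \<Rightarrow> real \<Rightarrow> nat \<Rightarrow> real" where
  "tau_star M p n =
     (SUP d\<in>{d \<in> dual_sites M. \<bar>lnorm M (dual_position M d) - real n\<bar> \<le> 1}.
        hom_prob M p (\<lambda>\<omega>. dual_joined_in M \<omega> UNIV (dual_origin M) d))"

text \<open>Positivity below 1 has to be required explicitly, because \<open>- 1 / 0 = 0\<close>: otherwise
  \<open>\<xi> p = 0\<close> would describe the limit 1, that is, an infinite correlation length.\<close>

definition is_correlation_length :: "percolation_model \<Rightarrow> real \<Rightarrow> (real \<Rightarrow> real) \<Rightarrow> bool" where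
  "is_correlation_length M pc \<xi> \<longleftrightarrow>
     \<xi> 1 = 0 \<and>
     (\<forall>p. pc < p \<and> p < 1 \<longrightarrow>
        \<xi> p > 0 \<and> (\<lambda>n. root n (tau_star M p n)) \<longlonglongrightarrow> exp (- 1 / \<xi> p))"


section \<open>The inhomogeneous model\<close>

definition inhom_percolation ::
    "percolation_model \<Rightarrow> real \<Rightarrow> (real \<Rightarrow> real) \<Rightarrow> real \<Rightarrow> (complex set \<Rightarrow> bool) measure" where
  "inhom_percolation M pc \<alpha> w = percolation M (\<lambda>z. pc + \<alpha> (lnorm M z powr w))"

definition cluster_count :: "percolation_model \<Rightarrow> nat \<Rightarrow> (complex set \<Rightarrow> bool) \<Rightarrow> nat" where
  "cluster_count M N \<omega> =
     card {z \<in> sites M \<inter> rhombus M (real N). connects_to_infinity M \<omega> z}"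


section \<open>Logarithmic equivalence\<close>

definition log_equiv :: "'a filter \<Rightarrow> ('a \<Rightarrow> real) \<Rightarrow> ('a \<Rightarrow> real) \<Rightarrow> bool" where
  "log_equiv F f g \<longleftrightarrow> ((\<lambda>x. ln (f x) / ln (g x)) \<longlongrightarrow> 1) F"

definition log_scaling :: "percolation_model \<Rightarrow> real \<Rightarrow> (real \<Rightarrow> real) \<Rightarrow> real \<Rightarrow> real \<Rightarrow> bool" where
  "log_scaling M pc \<xi> \<nu> \<beta> \<longleftrightarrow>
     log_equiv (at_right pc) \<xi> (\<lambda>p. \<bar>p - pc\<bar> powr (- \<nu>)) \<and>
     log_equiv (at_right pc) (P_infinity M) (\<lambda>p. (p - pc) powr \<beta>)"


section \<open>Site percolation on the triangular lattice\<close>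

text \<open>Site percolation on the triangular lattice is one of the models covered.\<close>

definition triangular_sites :: "complex set" where
  "triangular_sites = {of_int a + of_int b * cis (pi / 3) | a b. True}"

definition triangular_site_percolation :: percolation_model where
  "triangular_site_percolation =
     \<lparr>sites = triangular_sites,
      bonds = {{u, v} | u v. u \<in> triangular_sites \<and> v \<in> triangular_sites \<and> dist u v = 1},
      rot_angle = pi / 3, kind = Site, dual_origin = {0}\<rparr>"

definition tri_pt :: "real \<Rightarrow> real \<Rightarrow> complex" where
  "tri_pt x y = of_real x + of_real y * cis (pi / 3)"

lemma tri_pt_Re: "Re (tri_pt x y) = x + y / 2"
  and tri_pt_Im: "Im (tri_pt x y) = y * (sqrt 3 / 2)"
  by (simp_all add: tri_pt_def cos_60 sin_60)

lemma tri_pt_eq_iff: "tri_pt x y = tri_pt x' y' \<longleftrightarrow> x = x' \<and> y = y'"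
  by (auto simp: complex_eq_iff tri_pt_Re tri_pt_Im)

lemma tri_pt_add: "tri_pt x y + tri_pt x' y' = tri_pt (x + x') (y + y')"
  by (simp add: tri_pt_def algebra_simps)

lemma tri_pt_scaleR: "c *\<^sub>R tri_pt x y = tri_pt (c * x) (c * y)"
  by (simp add: tri_pt_def algebra_simps scaleR_conv_of_real)

lemma tri_sites_iff: "z \<in> triangular_sites \<longleftrightarrow> (\<exists>a b. z = tri_pt (of_int a) (of_int b))"
  by (simp add: triangular_sites_def tri_pt_def)

lemma tri_pt_norm: "(norm (tri_pt x y))\<^sup>2 = x\<^sup>2 + x * y + y\<^sup>2"
  unfolding cmod_power2 tri_pt_Re tri_pt_Im
  by (simp add: power2_eq_square algebra_simps)

lemma tri_int_form:
  fixes i j :: int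
  assumes "i\<^sup>2 + i * j + j\<^sup>2 = 1"
  shows "(i, j) \<in> {(1, 0), (0, 1), (-1, 1), (-1, 0), (0, -1), (1, -1)}"
proof -
  have 1: "(2 * i + j)\<^sup>2 + 3 * j\<^sup>2 = 4" and 2: "(2 * j + i)\<^sup>2 + 3 * i\<^sup>2 = 4"
    using assms by (simp_all add: power2_eq_square algebra_simps)
  have "j\<^sup>2 < 2\<^sup>2" using 1 zero_le_power2[of "2 * i + j"] unfolding power2_eq_square by linarith
  hence "\<bar>j\<bar> < 2" using power2_less_imp_less[of "\<bar>j\<bar>" 2] by simp
  have "i\<^sup>2 < 2\<^sup>2" using 2 zero_le_power2[of "2 * j + i"] unfolding power2_eq_square by linarith
  hence "\<bar>i\<bar> < 2" using power2_less_imp_less[of "\<bar>i\<bar>" 2] by simp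
  have "i \<in> {-1, 0, 1}" "j \<in> {-1, 0, 1}" using \<open>\<bar>i\<bar> < 2\<close> \<open>\<bar>j\<bar> < 2\<close> by auto
  with assms show ?thesis by auto
qed

lemma tri_dist: "dist (tri_pt x y) (tri_pt x' y') = 1 \<longleftrightarrow>
    (x - x')\<^sup>2 + (x - x') * (y - y') + (y - y')\<^sup>2 = 1"
proof -
  have eq: "tri_pt x y - tri_pt x' y' = tri_pt (x - x') (y - y')"
    by (simp add: tri_pt_def algebra_simps)
  have "dist (tri_pt x y) (tri_pt x' y') = 1 \<longleftrightarrow> (norm (tri_pt (x - x') (y - y')))\<^sup>2 = 1"
    unfolding dist_norm eq by (simp add: power2_eq_1_iff) (smt (verit) norm_ge_zero)
  thus ?thesis by (simp add: tri_pt_norm)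
qed

lemma tri_bondE:
  assumes "e \<in> bonds triangular_site_percolation"
  obtains a b i j :: int where
    "e = {tri_pt (of_int a) (of_int b), tri_pt (of_int (a + i)) (of_int (b + j))}"
    "(i, j) \<in> {(1, 0), (0, 1), (-1, 1)}"
proof -
  obtain a b a' b' :: int
    where e: "e = {tri_pt (of_int a) (of_int b), tri_pt (of_int a') (of_int b')}"
      and d: "dist (tri_pt (of_int a) (of_int b)) (tri_pt (of_int a') (of_int b')) = 1"
    using assms by (auto simp: triangular_site_percolation_def tri_sites_iff)
  have "real_of_int ((a - a')\<^sup>2 + (a - a') * (b - b') + (b - b')\<^sup>2) = real_of_int 1"
    using d by (simp add: tri_dist)
  hence "(a - a')\<^sup>2 + (a - a') * (b - b') + (b - b')\<^sup>2 = 1"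
    by (simp only: of_int_eq_iff)
  from tri_int_form[OF this]
  consider "(a' - a, b' - b) \<in> {(1, 0), (0, 1), (-1, 1)}"
    | "(a - a', b - b') \<in> {(1, 0), (0, 1), (-1, 1)}"
    by force
  thus ?thesis
  proof cases
    case 1
    show ?thesis by (rule that[of a b "a' - a" "b' - b"]) (use e 1 in auto)
  next
    case 2
    show ?thesis by (rule that[of a' b' "a - a'" "b - b'"]) (use e 2 in auto)
  qed
qed

lemma tri_bond_iff:
  "{tri_pt (of_int a) (of_int b), tri_pt (of_int a') (of_int b')} \<in> bonds triangular_site_percolation
     \<longleftrightarrow> dist (tri_pt (of_int a) (of_int b)) (tri_pt (of_int a') (of_int b')) = 1"
  by (auto simp: triangular_site_percolation_def tri_sites_iff doubleton_eq_iff dist_commute)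

definition tri_bond_at :: "real \<Rightarrow> real \<Rightarrow> complex set" where
  "tri_bond_at x y =
     (if y \<in> \<int> then {tri_pt \<lfloor>x\<rfloor> y, tri_pt (\<lfloor>x\<rfloor> + 1) y}
      else if x \<in> \<int> then {tri_pt x \<lfloor>y\<rfloor>, tri_pt x (\<lfloor>y\<rfloor> + 1)}
      else {tri_pt (x + y - \<lfloor>y\<rfloor>) \<lfloor>y\<rfloor>, tri_pt (x + y - \<lfloor>y\<rfloor> - 1) (\<lfloor>y\<rfloor> + 1)})"

lemma frac_not_int: "0 < t \<Longrightarrow> t < 1 \<Longrightarrow> of_int b + t \<notin> (\<int> :: real set)"
proof
  assume t: "0 < t" "t < 1" and "of_int b + t \<in> (\<int> :: real set)"
  then obtain n where "of_int b + t = real_of_int n" by (auto elim: Ints_cases)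
  with t have "b < n" "n < b + 1" by linarith+
  thus False by simp
qed

lemma tri_bond_interior:
  assumes "e \<in> bonds triangular_site_percolation" "p \<in> convex hull e" "p \<notin> e"
  shows "\<exists>x y. p = tri_pt x y \<and> e = tri_bond_at x y \<and> p \<notin> triangular_sites"
proof -
  from tri_bondE[OF assms(1)] obtain a b i j :: int where
    e: "e = {tri_pt (of_int a) (of_int b), tri_pt (of_int (a + i)) (of_int (b + j))}"
    and ij: "(i, j) \<in> {(1, 0), (0, 1), (-1, 1)}" by metis
  from assms(2) obtain t where t: "0 \<le> t" "t \<le> 1" and
    "p = (1 - t) *\<^sub>R tri_pt (of_int a) (of_int b) + t *\<^sub>R tri_pt (of_int (a + i)) (of_int (b + j))"
    unfolding e segment_convex_hull[symmetric] closed_segment_def by blast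
  hence p: "p = tri_pt (of_int a + t * of_int i) (of_int b + t * of_int j)"
    by (simp add: tri_pt_scaleR tri_pt_add algebra_simps)
  have "t \<noteq> 0" "t \<noteq> 1" using assms(3) p e by auto
  with t have t: "0 < t" "t < 1" by auto
  have fl: "\<lfloor>t\<rfloor> = 0" using t by linarith
  note ni = frac_not_int[OF t]
  have ni': "of_int a - t \<notin> (\<int> :: real set)"
    using frac_not_int[of "1 - t" "a - 1"] t by simp
  show ?thesis
  proof (intro exI conjI)
    show "p = tri_pt (of_int a + t * of_int i) (of_int b + t * of_int j)" by (rule p)
    show "e = tri_bond_at (of_int a + t * of_int i) (of_int b + t * of_int j)"
      using ij ni ni' by (auto simp: e tri_bond_at_def fl)
    show "p \<notin> triangular_sites"
    proof
      assume "p \<in> triangular_sites"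
      hence "of_int a + t * of_int i \<in> (\<int> :: real set)" "of_int b + t * of_int j \<in> (\<int> :: real set)"
        unfolding p tri_sites_iff tri_pt_eq_iff by (metis Ints_of_int)+
      with ij ni show False by auto
    qed
  qed
qed

lemma tri_bonds_sub: "e \<in> bonds triangular_site_percolation \<Longrightarrow> e \<subseteq> triangular_sites"
  by (auto simp: triangular_site_percolation_def)

lemma tri_noncrossing:
  assumes e: "e \<in> bonds triangular_site_percolation" and f: "f \<in> bonds triangular_site_percolation"
    and "e \<noteq> f"
  shows "convex hull e \<inter> convex hull f = e \<inter> f"
proof
  show "e \<inter> f \<subseteq> convex hull e \<inter> convex hull f"
    using hull_subset[of e convex] hull_subset[of f convex] by blast
  have *: "p \<in> e'" if "p \<in> convex hull e'" "p \<in> convex hull f'" "e' \<noteq> f'"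
    "e' \<in> bonds triangular_site_percolation" "f' \<in> bonds triangular_site_percolation" for p e' f'
  proof (rule ccontr)
    assume "p \<notin> e'"
    from tri_bond_interior[OF that(4,1) this] obtain x y
      where 1: "p = tri_pt x y" "e' = tri_bond_at x y" "p \<notin> triangular_sites" by blast
    hence "p \<notin> f'" using tri_bonds_sub that(5) by blast
    from tri_bond_interior[OF that(5,2) this] 1 that(3) show False
      by (auto simp: tri_pt_eq_iff)
  qed
  show "convex hull e \<inter> convex hull f \<subseteq> e \<inter> f"
    using *[of _ e f] *[of _ f e] assms by auto
qed

lemma tri_finite: "finite (triangular_sites \<inter> cball 0 R)"
proof -
  let ?K = "{-\<lceil>2 * \<bar>R\<bar>\<rceil>..\<lceil>2 * \<bar>R\<bar>\<rceil>}"
  have "triangular_sites \<inter> cball 0 R \<subseteq>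
      (\<lambda>(a, b). tri_pt (of_int a) (of_int b)) ` (?K \<times> ?K)"
  proof
    fix z assume z: "z \<in> triangular_sites \<inter> cball 0 R"
    then obtain a b where ab: "z = tri_pt (of_int a) (of_int b)" by (auto simp: tri_sites_iff)
    have "(norm z)\<^sup>2 \<le> R\<^sup>2" using z by (simp add: power_mono)
    hence le: "(real_of_int a)\<^sup>2 + of_int a * of_int b + (of_int b)\<^sup>2 \<le> R\<^sup>2"
      by (simp add: ab tri_pt_norm)
    have four: "(2::real)\<^sup>2 = 4" by simp
    have "3 * (real_of_int a)\<^sup>2 \<le> 3 * (real_of_int a)\<^sup>2 + (real_of_int a + 2 * of_int b)\<^sup>2"
      by simp
    also have "\<dots> \<le> 4 * R\<^sup>2" using le by (simp add: power2_eq_square algebra_simps)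
    finally have "(real_of_int a)\<^sup>2 \<le> (2 * R)\<^sup>2"
      using zero_le_power2[of "real_of_int a"] unfolding power_mult_distrib four by linarith
    have "3 * (real_of_int b)\<^sup>2 \<le> 3 * (real_of_int b)\<^sup>2 + (real_of_int b + 2 * of_int a)\<^sup>2"
      by simp
    also have "\<dots> \<le> 4 * R\<^sup>2" using le by (simp add: power2_eq_square algebra_simps)
    finally have "(real_of_int b)\<^sup>2 \<le> (2 * R)\<^sup>2"
      using zero_le_power2[of "real_of_int b"] unfolding power_mult_distrib four by linarith
    with \<open>(real_of_int a)\<^sup>2 \<le> (2 * R)\<^sup>2\<close>
    have "\<bar>real_of_int a\<bar> \<le> \<bar>2 * R\<bar>" "\<bar>real_of_int b\<bar> \<le> \<bar>2 * R\<bar>"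
      by (simp_all only: abs_le_square_iff)
    hence "a \<in> ?K" "b \<in> ?K" by (auto simp: abs_mult le_ceiling_iff) linarith+
    thus "z \<in> (\<lambda>(a, b). tri_pt (of_int a) (of_int b)) ` (?K \<times> ?K)"
      by (force simp: ab)
  qed
  thus ?thesis by (rule finite_subset) simp
qed

lemma tri_degree: "finite {e \<in> bonds triangular_site_percolation. v \<in> e}"
proof -
  have "{e \<in> bonds triangular_site_percolation. v \<in> e}
      \<subseteq> (\<lambda>u. {v, u}) ` (triangular_sites \<inter> cball 0 (norm v + 1))"
  proof clarify
    fix e assume "e \<in> bonds triangular_site_percolation" "v \<in> e"
    then obtain u where u: "e = {v, u}" "u \<in> triangular_sites" "dist v u = 1"
      unfolding triangular_site_percolation_def
      by simp (metis dist_commute insert_commute insertE singletonD)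
    have "norm u \<le> norm v + 1"
      using u(3) norm_triangle_ineq2[of u v] by (simp add: dist_norm norm_minus_commute)
    with u show "e \<in> (\<lambda>u. {v, u}) ` (triangular_sites \<inter> cball 0 (norm v + 1))" by auto
  qed
  thus ?thesis by (rule finite_subset) (simp add: tri_finite)
qed

lemma tri_connected:
  assumes "u \<in> triangular_sites" "v \<in> triangular_sites"
  shows "(u, v) \<in> {(x, y). {x, y} \<in> bonds triangular_site_percolation}\<^sup>*"
proof -
  let ?R = "{(x, y). {x, y} \<in> bonds triangular_site_percolation}"
  have sym: "sym (?R\<^sup>*)" by (intro sym_rtrancl) (auto simp: sym_def insert_commute)
  have step: "(tri_pt (of_int a) (of_int b), tri_pt (of_int a') (of_int b')) \<in> ?R"
    if "\<bar>a - a'\<bar> + \<bar>b - b'\<bar> = 1" for a b a' b' :: int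
  proof -
    have "(a - a', b - b') \<in> {(1, 0), (0, 1), (-1, 0), (0, -1)}" using that by auto
    hence "(a - a')\<^sup>2 + (a - a') * (b - b') + (b - b')\<^sup>2 = 1" by auto
    hence "real_of_int ((a - a')\<^sup>2 + (a - a') * (b - b') + (b - b')\<^sup>2) = real_of_int 1"
      by (simp only:)
    thus ?thesis by (simp add: tri_bond_iff tri_dist)
  qed
  have row: "(tri_pt 0 0, tri_pt (of_int a) (of_int 0)) \<in> ?R\<^sup>*" for a :: int
  proof (induction a rule: int_induct[where k = 0])
    case base show ?case by simp
  next
    case (step1 i) from rtrancl_into_rtrancl[OF step1(2) step[of i "i + 1" 0 0]] show ?case by simp
  next
    case (step2 i) from rtrancl_into_rtrancl[OF step2(2) step[of i "i - 1" 0 0]] show ?case by simp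
  qed
  have all: "(tri_pt 0 0, tri_pt (of_int a) (of_int b)) \<in> ?R\<^sup>*" for a b :: int
  proof (induction b rule: int_induct[where k = 0])
    case base show ?case by (rule row)
  next
    case (step1 i) from rtrancl_into_rtrancl[OF step1(2) step[of a a i "i + 1"]] show ?case by simp
  next
    case (step2 i) from rtrancl_into_rtrancl[OF step2(2) step[of a a i "i - 1"]] show ?case by simp
  qed
  show ?thesis using assms all sym
    by (auto simp: tri_sites_iff dest: symD intro: rtrancl_trans)
qed

lemma tri_invariant:
  assumes sub: "\<And>z. z \<in> triangular_sites \<Longrightarrow> T z \<in> triangular_sites"
    and sub': "\<And>z. z \<in> triangular_sites \<Longrightarrow> S z \<in> triangular_sites"
    and inv: "\<And>z. T (S z) = z"
    and dist: "\<And>u v. dist (T u) (T v) = dist u v"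
  shows "invariant_under triangular_site_percolation T"
proof -
  have S: "dist (S u) (S v) = dist u v" for u v using dist[of "S u" "S v"] by (simp add: inv)
  have 1: "T ` triangular_sites = triangular_sites"
    using sub sub' inv by (metis image_eqI image_subsetI subsetI subset_antisym)
  have 2: "(`) T ` bonds triangular_site_percolation \<subseteq> bonds triangular_site_percolation"
    unfolding triangular_site_percolation_def using sub dist
    by auto (metis image_empty image_insert)
  have "e \<in> (`) T ` bonds triangular_site_percolation"
    if e: "e \<in> bonds triangular_site_percolation" for e
  proof -
    obtain u v where "e = {u, v}" "u \<in> triangular_sites" "v \<in> triangular_sites" "dist u v = 1"
      using e by (auto simp: triangular_site_percolation_def)
    hence "e = T ` {S u, S v}" "{S u, S v} \<in> bonds triangular_site_percolation"
      using sub'[of u] sub'[of v] S[of u v]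
      by (simp_all add: inv triangular_site_percolation_def) metis
    thus ?thesis by blast
  qed
  hence "(`) T ` bonds triangular_site_percolation = bonds triangular_site_percolation"
    using 2 by blast
  moreover have "sites triangular_site_percolation = triangular_sites"
    by (simp add: triangular_site_percolation_def)
  ultimately show ?thesis
    using 1 unfolding invariant_under_def by simp
qed

lemma planar_lattice_triangular_site_percolation: "planar_lattice triangular_site_percolation"
proof -
  let ?M = triangular_site_percolation
  have sel: "sites ?M = triangular_sites" "rot_angle ?M = pi / 3" "kind ?M = Site"
      "dual_origin ?M = {0}"
    by (simp_all add: triangular_site_percolation_def)
  have z: "0 \<in> triangular_sites"
    unfolding tri_sites_iff by (rule exI[of _ 0], rule exI[of _ 0]) (simp add: tri_pt_def)
  have card: "card e = 2" if "e \<in> bonds ?M" for e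
    by (rule tri_bondE[OF that]) (auto simp: card_insert_if tri_pt_eq_iff)
  have refl: "- cnj (tri_pt x y) = tri_pt (- x - y) y" for x y
    by (simp add: complex_eq_iff tri_pt_Re tri_pt_Im)
  have rot: "cis (pi / 3) * tri_pt x y = tri_pt (- y) (x + y)" for x y
    by (simp add: complex_eq_iff tri_pt_def cos_60 sin_60 field_simps)
  have rot': "cis (- (pi / 3)) * tri_pt x y = tri_pt (x + y) (- x)" for x y
    by (simp add: complex_eq_iff tri_pt_def cos_60 sin_60 field_simps)
  have shift: "1 + tri_pt x y = tri_pt (x + 1) y" "tri_pt x y - 1 = tri_pt (x - 1) y" for x y
    by (simp_all add: tri_pt_def)
  have int: "x \<in> \<int> \<Longrightarrow> y \<in> \<int> \<Longrightarrow> tri_pt x y \<in> triangular_sites" for x y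
    by (auto simp: tri_sites_iff elim!: Ints_cases)
  have el: "\<exists>x y. z = tri_pt x y \<and> x \<in> \<int> \<and> y \<in> \<int>" if "z \<in> triangular_sites" for z
    using that unfolding tri_sites_iff by (metis Ints_of_int)
  have I1: "invariant_under ?M (\<lambda>z. - cnj z)"
  proof (rule tri_invariant[where S = "\<lambda>z. - cnj z"])
    show "- cnj z \<in> triangular_sites" if "z \<in> triangular_sites" for z
      using el[OF that] by (auto simp: refl int)
    thus "- cnj z \<in> triangular_sites" if "z \<in> triangular_sites" for z using that by blast
    show "dist (- cnj u) (- cnj v) = dist u v" for u v
      by (metis complex_cnj_diff complex_mod_cnj dist_minus dist_norm)
  qed simp
  have I2: "invariant_under ?M (\<lambda>z. cis (pi / 3) * z)"
  proof (rule tri_invariant[where S = "\<lambda>z. cis (- (pi / 3)) * z"])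
    show "cis (pi / 3) * z \<in> triangular_sites" if "z \<in> triangular_sites" for z
      using el[OF that] by (auto simp: rot int)
    show "cis (- (pi / 3)) * z \<in> triangular_sites" if "z \<in> triangular_sites" for z
      using el[OF that] by (auto simp: rot' int)
    show "cis (pi / 3) * (cis (- (pi / 3)) * z) = z" for z
      unfolding mult.assoc[symmetric] cis_mult by simp
    show "dist (cis (pi / 3) * u) (cis (pi / 3) * v) = dist u v" for u v
      unfolding dist_norm right_diff_distrib[symmetric] norm_mult by simp
  qed
  have I3: "invariant_under ?M (\<lambda>z. 1 + z)"
  proof (rule tri_invariant[where S = "\<lambda>z. z - 1"])
    show "1 + z \<in> triangular_sites" if "z \<in> triangular_sites" for z
      using el[OF that] by (auto simp: shift int)
    show "z - 1 \<in> triangular_sites" if "z \<in> triangular_sites" for z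
      using el[OF that] by (auto simp: shift int)
  qed auto
  show ?thesis
    unfolding planar_lattice_def sel
  proof (intro conjI ballI allI impI)
    show "case Site of Site \<Rightarrow> {0} = {0 :: complex} | Bond \<Rightarrow> 0 \<in> frontier {0}" by simp
  qed (use z card tri_bonds_sub tri_degree tri_noncrossing tri_connected tri_finite I1 I2 I3
    in \<open>simp_all add: dual_sites_def sel\<close>)
qed

end

theory Submission
  imports Defs "HOL-Real_Asymp.Real_Asymp"
begin

text \<open>
  A finite cluster is surrounded by a dual path of at least its own extent. By the Harris inequality,
  dual connections at density \<open>p\<close> over distance \<open>n\<close> have probability at most a constant times
  \<open>exp (- n / \<xi> p)\<close>. At distance \<open>r\<close> from the origin the local correlation length is \<open>r powr w\<close>,
  which is much smaller than \<open>r\<close>; hence a cluster that extends over a distance of order \<open>r\<close> is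
  infinite, up to an event whose probability is smaller than any power of \<open>r\<close>. Since reaching
  that far is a local event, its probability can be compared with that in homogeneous models with
  the extreme densities in the region concerned. This gives \<open>P\<^sub>\<infinity>\<close> at a correlation length of
  order \<open>r powr w\<close>, which logarithmic scaling turns into \<open>r powr (- \<lambda> \<beta> + o(1))\<close>, and summation
  over the sites yields the claim. That the resulting exponent is positive follows from the
  Russo--Seymour--Welsh bounds, by which \<open>P\<^sub>\<infinity>\<close> at correlation length \<open>n powr w\<close> is at least of
  order \<open>1 / n\<^sup>2\<close> for each \<open>w < 1\<close>.
\<close>


section \<open>Finitary increasing events under product Bernoulli measures\<close>

text \<open>The lattice is an arbitrary periodic, connected drawing without crossings, so neither
  the boundedness of its faces nor a closed dual circuit around a cluster is given. Circuits are
  avoided: all that is needed is a chain of faces along the boundary of the filled cluster, between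
  two ends that are far apart. This is a statement about connected sets in the plane, which
  Janiszewski's theorem supplies. No constant may depend on the density, since it approaches
  \<open>pc\<close> with the distance. Densities are therefore kept below some
  \<open>p1 < 1\<close>, where changing finitely many elements has a uniform cost. Errors are
  bounded by \<open>C / (N + 1) ^ 3\<close>. The power 3 is enough because the one-arm bound forces
  the decay exponent \<open>w / \<nu> * \<beta>\<close> below 2, so that cubic errors are
  negligible. Near the origin the density is larger than at distance \<open>N\<close>, so no upper
  bound in terms of \<open>N\<close> holds for all sites of the rhombus. The sites between
  \<open>N div 2\<close> and \<open>N\<close> are estimated instead, and a recursion sums over the
  scales.\<close>

definition forces :: "'i set \<Rightarrow> (('i \<Rightarrow> bool) \<Rightarrow> bool) \<Rightarrow> bool" where
  "forces W Q \<longleftrightarrow> (\<forall>\<omega>. (\<forall>e\<in>W. \<omega> e) \<longrightarrow> Q \<omega>)"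

text \<open>Increasing events that are open: every occurrence is certified by finitely many occupied
  elements of \<open>I\<close>. This one notion yields measurability, monotonicity, insensitivity to
  coordinates outside \<open>I\<close> and approximation by finite sets, which is what the Harris
  inequality and the comparison of densities rest on.\<close>

definition finitary :: "'i set \<Rightarrow> (('i \<Rightarrow> bool) \<Rightarrow> bool) \<Rightarrow> bool" where
  "finitary I Q \<longleftrightarrow> (\<forall>\<omega>. Q \<omega> \<longrightarrow> (\<exists>W. finite W \<and> W \<subseteq> I \<and> (\<forall>e\<in>W. \<omega> e) \<and> forces W Q))"

lemma forcesD: "forces W Q \<Longrightarrow> (\<And>e. e \<in> W \<Longrightarrow> \<omega> e) \<Longrightarrow> Q \<omega>"
  by (simp add: forces_def)

lemma finitary_witness:
  assumes "finitary I Q" "Q \<omega>"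
  obtains W where "finite W" "W \<subseteq> I" "\<forall>e\<in>W. \<omega> e" "forces W Q"
proof -
  have "\<exists>W. finite W \<and> W \<subseteq> I \<and> (\<forall>e\<in>W. \<omega> e) \<and> forces W Q"
    using assms unfolding finitary_def by simp
  thus ?thesis using that by (elim exE conjE) simp
qed

lemma finitaryI:
  assumes "\<And>\<omega>. Q \<omega> \<Longrightarrow> \<exists>W. finite W \<and> W \<subseteq> I \<and> (\<forall>e\<in>W. \<omega> e) \<and> forces W Q"
  shows "finitary I Q"
  unfolding finitary_def by (intro allI impI assms)

lemma finitary_atom: "e \<in> I \<Longrightarrow> finitary I (\<lambda>\<omega>. \<omega> e)"
  by (rule finitaryI) (auto simp: forces_def intro!: exI[of _ "{e}"])

lemma finitary_const: "finitary I (\<lambda>\<omega>. b)"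
  by (rule finitaryI) (auto simp: forces_def intro!: exI[of _ "{}"])

lemma finitary_ex:
  assumes "\<And>x. finitary I (Q x)"
  shows "finitary I (\<lambda>\<omega>. \<exists>x. Q x \<omega>)"
proof (rule finitaryI)
  fix \<omega> assume "\<exists>x. Q x \<omega>"
  then obtain x where x: "Q x \<omega>" ..
  have "\<exists>W. finite W \<and> W \<subseteq> I \<and> (\<forall>e\<in>W. \<omega> e) \<and> forces W (Q x)"
    using assms[of x] x by (simp add: finitary_def)
  moreover have "forces W (Q x) \<Longrightarrow> forces W (\<lambda>\<omega>. \<exists>x. Q x \<omega>)" for W
    by (auto simp: forces_def)
  ultimately show "\<exists>W. finite W \<and> W \<subseteq> I \<and> (\<forall>e\<in>W. \<omega> e) \<and> forces W (\<lambda>\<omega>. \<exists>x. Q x \<omega>)"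
    by meson
qed

lemma finitary_conj:
  assumes "finitary I Q" "finitary I R"
  shows "finitary I (\<lambda>\<omega>. Q \<omega> \<and> R \<omega>)"
proof (rule finitaryI)
  fix \<omega> assume QR: "Q \<omega> \<and> R \<omega>"
  have "\<exists>V. finite V \<and> V \<subseteq> I \<and> (\<forall>e\<in>V. \<omega> e) \<and> forces V Q"
    "\<exists>W. finite W \<and> W \<subseteq> I \<and> (\<forall>e\<in>W. \<omega> e) \<and> forces W R"
    using assms QR by (simp_all add: finitary_def)
  then obtain V W where VW: "finite V" "V \<subseteq> I" "\<forall>e\<in>V. \<omega> e" "forces V Q"
    "finite W" "W \<subseteq> I" "\<forall>e\<in>W. \<omega> e" "forces W R"
    by (elim exE conjE)
  have "forces (V \<union> W) (\<lambda>\<omega>. Q \<omega> \<and> R \<omega>)"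
    using VW(4,8) by (simp add: forces_def)
  with VW show "\<exists>W. finite W \<and> W \<subseteq> I \<and> (\<forall>e\<in>W. \<omega> e) \<and> forces W (\<lambda>\<omega>. Q \<omega> \<and> R \<omega>)"
    by (intro exI[of _ "V \<union> W"]) auto
qed

text \<open>A path has finitely many steps, so reachability is a union over \<open>n\<close> of
  \<open>n\<close>-step events, each of them built from conjunctions and existential
  quantifiers.\<close>

lemma finitary_rtrancl:
  assumes "\<And>x y. finitary I (\<lambda>\<omega>. (x, y) \<in> R \<omega>)"
  shows "finitary I (\<lambda>\<omega>. (x, y) \<in> (R \<omega>)\<^sup>*)"
proof -
  have "finitary I (\<lambda>\<omega>. (x, y) \<in> (R \<omega>) ^^ n)" for n x y
  proof (induction n arbitrary: y)
    case 0 show ?case by (simp add: finitary_const)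
  next
    case (Suc n)
    show ?case using assms Suc by (simp add: relcomp_unfold finitary_ex finitary_conj)
  qed
  thus ?thesis unfolding rtrancl_power by (rule finitary_ex)
qed

text \<open>Declaring everything outside \<open>B\<close> vacant keeps the event increasing, with
  the same certificates. This is how events are localized later on.\<close>

lemma finitary_restrict:
  assumes "finitary I Q"
  shows "finitary I (\<lambda>\<omega>. Q (\<lambda>e. \<omega> e \<and> e \<in> B))"
proof (rule finitaryI)
  fix \<omega> assume "Q (\<lambda>e. \<omega> e \<and> e \<in> B)"
  then have "\<exists>W. finite W \<and> W \<subseteq> I \<and> (\<forall>e\<in>W. \<omega> e \<and> e \<in> B) \<and> forces W Q"
    using assms by (simp add: finitary_def)
  moreover have "forces W (\<lambda>\<omega>. Q (\<lambda>e. \<omega> e \<and> e \<in> B))" if "forces W Q" "\<forall>e\<in>W. \<omega> e \<and> e \<in> B" for W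
    using that by (simp add: forces_def)
  ultimately show "\<exists>W. finite W \<and> W \<subseteq> I \<and> (\<forall>e\<in>W. \<omega> e) \<and> forces W (\<lambda>\<omega>. Q (\<lambda>e. \<omega> e \<and> e \<in> B))"
    by meson
qed

lemma finitary_mono:
  assumes "finitary I Q" "\<And>e. e \<in> I \<Longrightarrow> \<omega> e \<Longrightarrow> \<omega>' e" "Q \<omega>"
  shows "Q \<omega>'"
proof -
  obtain W where "finite W" "W \<subseteq> I" "\<forall>e\<in>W. \<omega> e" "forces W Q"
    by (rule finitary_witness[OF assms(1,3)])
  thus ?thesis using assms(2) by (intro forcesD[of W Q]) auto
qed

lemma finitary_cong:
  assumes "finitary I Q" "\<And>e. e \<in> I \<Longrightarrow> \<omega> e = \<omega>' e"
  shows "Q \<omega> = Q \<omega>'"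
  using finitary_mono[OF assms(1), of \<omega> \<omega>'] finitary_mono[OF assms(1), of \<omega>' \<omega>] assms(2) by auto

section \<open>Product Bernoulli measures\<close>

definition bern :: "'i set \<Rightarrow> ('i \<Rightarrow> real) \<Rightarrow> ('i \<Rightarrow> bool) measure" where
  "bern I q = (\<Pi>\<^sub>M e\<in>I. measure_pmf (bernoulli_pmf (q e)))"

definition bern_prob :: "'i set \<Rightarrow> ('i \<Rightarrow> real) \<Rightarrow> (('i \<Rightarrow> bool) \<Rightarrow> bool) \<Rightarrow> real" where
  "bern_prob I q Q = measure (bern I q) {\<omega>\<in>space (bern I q). Q \<omega>}"

lemma product_prob_space_bern: "product_prob_space (\<lambda>e. measure_pmf (bernoulli_pmf (q e)))"
  unfolding product_prob_space_def product_prob_space_axioms_def product_sigma_finite_def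
  by (simp add: measure_pmf.prob_space_axioms measure_pmf.sigma_finite_measure_axioms)

lemma prob_space_bern: "prob_space (bern I q)"
  unfolding bern_def by (rule prob_space_PiM) (rule measure_pmf.prob_space_axioms)

lemma space_bern: "space (bern I q) = (\<Pi>\<^sub>E e\<in>I. UNIV)"
  unfolding bern_def by (simp add: space_PiM)

lemma measurable_bern_component: "e \<in> I \<Longrightarrow> Measurable.pred (bern I q) (\<lambda>\<omega>. \<omega> e)"
  unfolding bern_def by measurable

text \<open>A countable \<open>I\<close> has countably many finite subsets, and the event is the
  union of the cylinders \<open>\<forall>e\<in>W. \<omega> e\<close> over those \<open>W\<close>
  that force it.\<close>

lemma measurable_finitary:
  assumes "countable I" "finitary I Q"
  shows "Measurable.pred (bern I q) Q"
proof -
  let ?\<W> = "{W. finite W \<and> W \<subseteq> I \<and> forces W Q}"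
  have W: "Q \<omega> \<longleftrightarrow> (\<exists>W\<in>?\<W>. \<forall>e\<in>W. \<omega> e)" for \<omega>
  proof
    assume "Q \<omega>"
    thus "\<exists>W\<in>?\<W>. \<forall>e\<in>W. \<omega> e" using assms(2) by (auto simp: finitary_def)
  qed (auto dest: forcesD)
  have "countable ?\<W>"
    by (rule countable_subset[OF _ countable_Collect_finite_subset[OF assms(1)]]) auto
  moreover have "Measurable.pred (bern I q) (\<lambda>\<omega>. \<forall>e\<in>W. \<omega> e)" if "W \<in> ?\<W>" for W
    using that by (intro pred_intros_finite measurable_bern_component) auto
  ultimately have "(\<Union>W\<in>?\<W>. {\<omega>\<in>space (bern I q). \<forall>e\<in>W. \<omega> e}) \<in> sets (bern I q)"
    by (intro sets.countable_UN') (auto simp: pred_def)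
  also have "(\<Union>W\<in>?\<W>. {\<omega>\<in>space (bern I q). \<forall>e\<in>W. \<omega> e}) = {\<omega>\<in>space (bern I q). Q \<omega>}"
    using W by blast
  finally show ?thesis by (simp add: pred_def)
qed

section \<open>Averages over the random subset of a finite set\<close>

definition subset_weight :: "('i \<Rightarrow> real) \<Rightarrow> 'i set \<Rightarrow> 'i set \<Rightarrow> real" where
  "subset_weight q J A = (\<Prod>e\<in>A. q e) * (\<Prod>e\<in>J - A. 1 - q e)"

text \<open>The expectation of \<open>f\<close> at the set of occupied elements of \<open>J\<close>,
  written as a finite sum so that inequalities can be proved by adding one element at a
  time.\<close>

definition subset_avg :: "('i \<Rightarrow> real) \<Rightarrow> 'i set \<Rightarrow> ('i set \<Rightarrow> real) \<Rightarrow> real" where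
  "subset_avg q J f = (\<Sum>A\<in>Pow J. subset_weight q J A * f A)"

lemma subset_avg_empty: "subset_avg q {} f = f {}"
  by (simp add: subset_avg_def subset_weight_def)

lemma subset_avg_insert:
  assumes "finite J" "i \<notin> J"
  shows "subset_avg q (insert i J) f =
    q i * subset_avg q J (\<lambda>A. f (insert i A)) + (1 - q i) * subset_avg q J f"
proof -
  have inj: "inj_on (insert i) (Pow J)" using assms by (auto simp: inj_on_def)
  have disj: "Pow J \<inter> insert i ` Pow J = {}" using assms by auto
  have w1: "subset_weight q (insert i J) A = (1 - q i) * subset_weight q J A" if "A \<subseteq> J" for A
  proof -
    have "insert i J - A = insert i (J - A)" using that assms by auto
    thus ?thesis using assms by (simp add: subset_weight_def)
  qed
  have w2: "subset_weight q (insert i J) (insert i A) = q i * subset_weight q J A" if "A \<subseteq> J" for A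
  proof -
    have "insert i J - insert i A = J - A" "i \<notin> A" "finite A" using that assms finite_subset by auto
    thus ?thesis by (simp add: subset_weight_def)
  qed
  have "subset_avg q (insert i J) f =
      (\<Sum>A\<in>Pow J. subset_weight q (insert i J) A * f A) +
      (\<Sum>A\<in>Pow J. subset_weight q (insert i J) (insert i A) * f (insert i A))"
    unfolding subset_avg_def Pow_insert using assms
    by (subst sum.union_disjoint[OF _ _ disj]) (auto simp: sum.reindex[OF inj])
  also have "\<dots> = (\<Sum>A\<in>Pow J. (1 - q i) * (subset_weight q J A * f A)) +
      (\<Sum>A\<in>Pow J. q i * (subset_weight q J A * f (insert i A)))"
    by (intro arg_cong2[of _ _ _ _ "(+)"] sum.cong) (auto simp: w1 w2)
  finally show ?thesis by (simp add: subset_avg_def sum_distrib_left)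
qed

lemma subset_avg_mono:
  assumes "finite J" "\<And>e. e \<in> J \<Longrightarrow> 0 \<le> q e \<and> q e \<le> 1" "\<And>A. A \<subseteq> J \<Longrightarrow> f A \<le> g A"
  shows "subset_avg q J f \<le> subset_avg q J g"
  unfolding subset_avg_def subset_weight_def using assms
  by (intro sum_mono mult_left_mono mult_nonneg_nonneg prod_nonneg) auto

text \<open>Conditioning on the new element \<open>i\<close> makes the average linear in
  \<open>q i\<close>. The slope is nonnegative because \<open>f\<close> is increasing, so raising
  \<open>q i\<close> helps; the induction hypothesis takes care of the other elements.\<close>

lemma subset_avg_mono_density:
  fixes f :: "'i set \<Rightarrow> real"
  assumes "finite J" "\<And>e. e \<in> J \<Longrightarrow> 0 \<le> q e \<and> q e \<le> q' e \<and> q' e \<le> 1"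
    and "\<And>A B. A \<subseteq> B \<Longrightarrow> f A \<le> f B"
  shows "subset_avg q J f \<le> subset_avg q' J f"
  using assms
proof (induction J arbitrary: f rule: finite_induct)
  case empty thus ?case by (simp add: subset_avg_empty)
next
  case (insert i J)
  let ?f = "\<lambda>A. f (insert i A)"
  have mono: "?f A \<le> ?f B" if "A \<subseteq> B" for A B by (rule insert.prems(2)) (use that in auto)
  have 1: "subset_avg q J ?f \<le> subset_avg q' J ?f" "subset_avg q J f \<le> subset_avg q' J f"
    using insert.IH[of ?f] insert.IH[of f] insert.prems mono by auto
  have le: "f A \<le> ?f A" for A by (rule insert.prems(2)) auto
  have 2: "subset_avg q' J f \<le> subset_avg q' J ?f"
    using insert.hyps insert.prems(1) le by (intro subset_avg_mono) (auto, meson order_trans)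
  have q: "0 \<le> q i" "q i \<le> q' i" "q' i \<le> 1" using insert.prems by auto
  have "q i * subset_avg q J ?f + (1 - q i) * subset_avg q J f
      \<le> q i * subset_avg q' J ?f + (1 - q i) * subset_avg q' J f"
    using 1 q by (intro add_mono mult_left_mono) auto
  also have "\<dots> = subset_avg q' J f + q i * (subset_avg q' J ?f - subset_avg q' J f)"
    by (simp add: algebra_simps)
  also have "\<dots> \<le> subset_avg q' J f + q' i * (subset_avg q' J ?f - subset_avg q' J f)"
    using 2 q by (intro add_left_mono mult_right_mono) auto
  finally show ?case using insert.hyps by (simp add: subset_avg_insert algebra_simps)
qed

text \<open>The product of two convex combinations falls short of the combination of the products by
  \<open>q i * (1 - q i)\<close> times the product of the two increments, and these are nonnegative
  for increasing functions. The induction hypothesis applies to both conditional averages.\<close>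

lemma subset_avg_Harris:
  fixes f g :: "'i set \<Rightarrow> real"
  assumes "finite J" "\<And>e. e \<in> J \<Longrightarrow> 0 \<le> q e \<and> q e \<le> 1"
    and "\<And>A B. A \<subseteq> B \<Longrightarrow> f A \<le> f B" "\<And>A B. A \<subseteq> B \<Longrightarrow> g A \<le> g B"
  shows "subset_avg q J f * subset_avg q J g \<le> subset_avg q J (\<lambda>A. f A * g A)"
  using assms
proof (induction J arbitrary: f g rule: finite_induct)
  case empty thus ?case by (simp add: subset_avg_empty)
next
  case (insert i J)
  let ?f = "\<lambda>A. f (insert i A)" and ?g = "\<lambda>A. g (insert i A)"
  have mono: "?f A \<le> ?f B" "?g A \<le> ?g B" if "A \<subseteq> B" for A B
    by (rule insert.prems(2) insert.prems(3), use that in auto)+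
  have IH: "subset_avg q J ?f * subset_avg q J ?g \<le> subset_avg q J (\<lambda>A. ?f A * ?g A)"
    "subset_avg q J f * subset_avg q J g \<le> subset_avg q J (\<lambda>A. f A * g A)"
    using insert.IH[of ?f ?g] insert.IH[of f g] insert.prems mono by auto
  have "f A \<le> ?f A" "g A \<le> ?g A" for A by (rule insert.prems(2) insert.prems(3), auto)+
  hence "subset_avg q J f \<le> subset_avg q J ?f" "subset_avg q J g \<le> subset_avg q J ?g"
    using insert.hyps insert.prems(1) by (auto intro!: subset_avg_mono)
  hence le: "0 \<le> q i * (1 - q i) * ((subset_avg q J ?f - subset_avg q J f) *
      (subset_avg q J ?g - subset_avg q J g))"
    using insert.prems by (intro mult_nonneg_nonneg) auto
  have "(q i * subset_avg q J ?f + (1 - q i) * subset_avg q J f) *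
      (q i * subset_avg q J ?g + (1 - q i) * subset_avg q J g)
    \<le> q i * (subset_avg q J ?f * subset_avg q J ?g) +
      (1 - q i) * (subset_avg q J f * subset_avg q J g)"
    using le by (simp add: algebra_simps)
  also have "\<dots> \<le> q i * subset_avg q J (\<lambda>A. ?f A * ?g A) +
      (1 - q i) * subset_avg q J (\<lambda>A. f A * g A)"
    using IH insert.prems by (intro add_mono mult_left_mono) auto
  finally show ?case using insert.hyps by (simp add: subset_avg_insert)
qed

lemma bern_prob_subset_eq:
  assumes "finite J" "J \<subseteq> I" "A \<subseteq> J" "\<And>e. e \<in> J \<Longrightarrow> 0 \<le> q e \<and> q e \<le> 1"
  shows "bern_prob I q (\<lambda>\<omega>. {e\<in>J. \<omega> e} = A) = subset_weight q J A"
proof -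
  interpret product_prob_space "\<lambda>e. measure_pmf (bernoulli_pmf (q e))" I
    by (rule product_prob_space_bern)
  let ?N = "\<lambda>e. measure_pmf (bernoulli_pmf (q e))"
  \<comment> \<open>The set \<open>{e \<in> A}\<close> consists of one Boolean, the truth value of
    \<open>e \<in> A\<close>, so the event is a cylinder over \<open>J\<close>.\<close>
  have "{\<omega>\<in>space (bern I q). {e\<in>J. \<omega> e} = A} = prod_emb I ?N J (\<Pi>\<^sub>E e\<in>J. {e \<in> A})"
    using assms(2,3) by (auto simp: prod_emb_def space_bern Pi_iff)
  hence "bern_prob I q (\<lambda>\<omega>. {e\<in>J. \<omega> e} = A) = (\<Prod>e\<in>J. measure (?N e) {e \<in> A})"
    unfolding bern_prob_def bern_def using assms by (simp add: measure_PiM_emb)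
  also have "\<dots> = (\<Prod>e\<in>J. if e \<in> A then q e else 1 - q e)"
    using assms(4) by (intro prod.cong) (auto simp: measure_pmf_single)
  also have "\<dots> = subset_weight q J A"
    unfolding subset_weight_def using assms(1,3)
    by (simp add: prod.If_cases Int_absorb1 Diff_eq)
  finally show ?thesis .
qed

lemma bern_prob_finite:
  assumes "countable I" "finite J" "J \<subseteq> I" "\<And>e. e \<in> J \<Longrightarrow> 0 \<le> q e \<and> q e \<le> 1"
  shows "bern_prob I q (\<lambda>\<omega>. Q (\<lambda>e. \<omega> e \<and> e \<in> J)) = subset_avg q J (\<lambda>A. of_bool (Q (\<lambda>e. e \<in> A)))"
proof -
  interpret prob_space "bern I q" by (rule prob_space_bern)
  let ?E = "\<lambda>A. {\<omega>\<in>space (bern I q). {e\<in>J. \<omega> e} = A}"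
  have meas: "?E A \<in> sets (bern I q)" if "A \<subseteq> J" for A
  proof -
    have "({e\<in>J. \<omega> e} = A) = (\<forall>e\<in>J. \<omega> e = (e \<in> A))" for \<omega> using that by auto
    moreover have "Measurable.pred (bern I q) (\<lambda>\<omega>. \<forall>e\<in>J. \<omega> e = (e \<in> A))"
      using assms(2,3) measurable_bern_component[of _ I q]
      by (intro pred_intros_finite pred_intros_logic) auto
    ultimately show ?thesis by (simp add: pred_def)
  qed
  have eq: "(\<lambda>e. \<omega> e \<and> e \<in> J) = (\<lambda>e. e \<in> {e\<in>J. \<omega> e})" for \<omega> by auto
  have "{\<omega>\<in>space (bern I q). Q (\<lambda>e. \<omega> e \<and> e \<in> J)} = (\<Union>A\<in>{A\<in>Pow J. Q (\<lambda>e. e \<in> A)}. ?E A)"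
    unfolding eq by auto
  hence "bern_prob I q (\<lambda>\<omega>. Q (\<lambda>e. \<omega> e \<and> e \<in> J)) = measure (bern I q) (\<Union>A\<in>{A\<in>Pow J. Q (\<lambda>e. e \<in> A)}. ?E A)"
    by (simp add: bern_prob_def)
  also have "\<dots> = (\<Sum>A\<in>{A\<in>Pow J. Q (\<lambda>e. e \<in> A)}. measure (bern I q) (?E A))"
    using assms(2) meas by (intro finite_measure_finite_Union) (auto simp: disjoint_family_on_def)
  also have "\<dots> = (\<Sum>A\<in>{A\<in>Pow J. Q (\<lambda>e. e \<in> A)}. subset_weight q J A)"
    using bern_prob_subset_eq[OF assms(2,3) _ assms(4)] by (intro sum.cong) (auto simp: bern_prob_def)
  also have "\<dots> = subset_avg q J (\<lambda>A. of_bool (Q (\<lambda>e. e \<in> A)))"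
    unfolding subset_avg_def using assms(2)
    by (intro sum.mono_neutral_cong_left) auto
  finally show ?thesis .
qed

lemma bern_prob_mono:
  assumes "Measurable.pred (bern I q) R" "\<And>\<omega>. \<omega> \<in> space (bern I q) \<Longrightarrow> Q \<omega> \<Longrightarrow> R \<omega>"
  shows "bern_prob I q Q \<le> bern_prob I q R"
proof -
  interpret prob_space "bern I q" by (rule prob_space_bern)
  show ?thesis unfolding bern_prob_def using assms by (intro finite_measure_mono) (auto simp: pred_def)
qed

lemma bern_prob_nonneg: "0 \<le> bern_prob I q Q" by (simp add: bern_prob_def)

lemma bern_prob_le_1: "bern_prob I q Q \<le> 1"
  unfolding bern_prob_def by (rule prob_space.prob_le_1[OF prob_space_bern])

section \<open>Passage from finite to countable index sets\<close>

lemma bern_prob_finitary_lim: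
  assumes "countable I" "finitary I Q" "\<And>e. e \<in> I \<Longrightarrow> 0 \<le> q e \<and> q e \<le> 1"
    and "incseq J" "\<And>n. finite (J n)" "(\<Union>n. J n) = I"
  shows "(\<lambda>n. subset_avg q (J n) (\<lambda>A. of_bool (Q (\<lambda>e. e \<in> A)))) \<longlonglongrightarrow> bern_prob I q Q"
proof -
  interpret prob_space "bern I q" by (rule prob_space_bern)
  let ?Q = "\<lambda>n \<omega>. Q (\<lambda>e. \<omega> e \<and> e \<in> J n)"
  let ?A = "\<lambda>n. {\<omega>\<in>space (bern I q). ?Q n \<omega>}"
  have JI: "J n \<subseteq> I" for n using assms(6) by auto
  have "?A m \<subseteq> ?A n" if "m \<le> n" for m n
    using finitary_mono[OF assms(2), of "\<lambda>e. _ e \<and> e \<in> J m" "\<lambda>e. _ e \<and> e \<in> J n"]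
      incseqD[OF assms(4) that] by auto
  hence inc: "incseq ?A" by (simp add: incseq_def)
  \<comment> \<open>A finite certificate lies in some \<open>J n\<close>, so each configuration of
    the event is recognized at a finite stage; continuity from below then gives the limit.\<close>
  have un: "(\<Union>n. ?A n) = {\<omega>\<in>space (bern I q). Q \<omega>}"
  proof (intro equalityI subsetI)
    fix \<omega> assume "\<omega> \<in> (\<Union>n. ?A n)"
    thus "\<omega> \<in> {\<omega>\<in>space (bern I q). Q \<omega>}"
      using finitary_mono[OF assms(2), of "\<lambda>e. \<omega> e \<and> e \<in> J _" \<omega>] by auto
  next
    fix \<omega> assume w: "\<omega> \<in> {\<omega>\<in>space (bern I q). Q \<omega>}"
    hence "Q \<omega>" by simp
    obtain W where W: "finite W" "W \<subseteq> I" "\<forall>e\<in>W. \<omega> e" "forces W Q"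
      by (rule finitary_witness[OF assms(2) \<open>Q \<omega>\<close>])
    have "\<exists>n. W \<subseteq> J n"
      using W(1,2)
    proof (induction W rule: finite_induct)
      case (insert e W)
      then obtain n where "W \<subseteq> J n" by auto
      moreover obtain m where "e \<in> J m" using insert.prems assms(6) by auto
      ultimately have "insert e W \<subseteq> J (max m n)"
        using incseqD[OF assms(4), of m "max m n"] incseqD[OF assms(4), of n "max m n"] by auto
      thus ?case ..
    qed simp
    then obtain n where "W \<subseteq> J n" ..
    with W have "?Q n \<omega>" by (intro forcesD[OF W(4)]) auto
    with w show "\<omega> \<in> (\<Union>n. ?A n)" by auto
  qed
  have "range ?A \<subseteq> sets (bern I q)"
    using measurable_finitary[OF assms(1) finitary_restrict[OF assms(2)], where q=q] by (auto simp: pred_def)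
  from finite_Lim_measure_incseq[OF this inc]
  have "(\<lambda>n. bern_prob I q (?Q n)) \<longlonglongrightarrow> bern_prob I q Q" unfolding un bern_prob_def .
  moreover have "bern_prob I q (?Q n) = subset_avg q (J n) (\<lambda>A. of_bool (Q (\<lambda>e. e \<in> A)))" for n
    using JI[of n] assms(3) by (intro bern_prob_finite assms) auto
  ultimately show ?thesis by simp
qed

lemma finite_exhaustion:
  assumes "countable I"
  obtains J :: "nat \<Rightarrow> 'i set" where "incseq J" "\<And>n. finite (J n)" "(\<Union>n. J n) = I"
proof
  let ?J = "\<lambda>n. {e\<in>I. to_nat_on I e < n}"
  show "incseq ?J" by (auto simp: incseq_def)
  show "finite (?J n)" for n
    using countableI_bij1 inj_on_to_nat_on[OF assms]
    by (intro inj_on_finite[of "to_nat_on I" _ "{..<n}"]) (auto simp: inj_on_def)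
  show "(\<Union>n. ?J n) = I" by auto
qed

lemma of_bool_finitary_mono:
  "finitary I Q \<Longrightarrow> A \<subseteq> B \<Longrightarrow> (of_bool (Q (\<lambda>e. e \<in> A)) :: real) \<le> of_bool (Q (\<lambda>e. e \<in> B))"
  using finitary_mono[of I Q "\<lambda>e. e \<in> A" "\<lambda>e. e \<in> B"] by auto

lemma Harris:
  assumes "countable I" "finitary I Q" "finitary I R" "\<And>e. e \<in> I \<Longrightarrow> 0 \<le> q e \<and> q e \<le> 1"
  shows "bern_prob I q Q * bern_prob I q R \<le> bern_prob I q (\<lambda>\<omega>. Q \<omega> \<and> R \<omega>)"
proof -
  obtain J where J: "incseq J" "\<And>n. finite (J n)" "(\<Union>n. J n) = I"
    using finite_exhaustion[OF assms(1)] by blast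
  note lim = bern_prob_finitary_lim[OF assms(1) _ assms(4) J]
  show ?thesis
  proof (rule LIMSEQ_le[OF tendsto_mult[OF lim[OF assms(2)] lim[OF assms(3)]]
        lim[OF finitary_conj[OF assms(2,3)]]])
    have "subset_avg q (J n) (\<lambda>A. of_bool (Q (\<lambda>e. e \<in> A))) * subset_avg q (J n) (\<lambda>A. of_bool (R (\<lambda>e. e \<in> A)))
      \<le> subset_avg q (J n) (\<lambda>A. of_bool (Q (\<lambda>e. e \<in> A)) * of_bool (R (\<lambda>e. e \<in> A)))" for n
      using J assms of_bool_finitary_mono[OF assms(2)] of_bool_finitary_mono[OF assms(3)]
      by (intro subset_avg_Harris) auto
    thus "\<exists>N. \<forall>n\<ge>N. subset_avg q (J n) (\<lambda>A. of_bool (Q (\<lambda>e. e \<in> A))) * subset_avg q (J n) (\<lambda>A. of_bool (R (\<lambda>e. e \<in> A)))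
      \<le> subset_avg q (J n) (\<lambda>A. of_bool (Q (\<lambda>e. e \<in> A) \<and> R (\<lambda>e. e \<in> A)))"
      by (auto simp: of_bool_conj)
  qed
qed

text \<open>The densities are compared on \<open>B\<close> only, because the event on the left
  ignores what is occupied elsewhere. In the applications \<open>B\<close> is a neighbourhood on
  which the inhomogeneous density lies on one side of a constant.\<close>

lemma bern_prob_mono_density:
  assumes "countable I" "finitary I Q"
    and "\<And>e. e \<in> I \<Longrightarrow> 0 \<le> q e \<and> q e \<le> 1" "\<And>e. e \<in> I \<Longrightarrow> 0 \<le> q' e \<and> q' e \<le> 1"
    and "\<And>e. e \<in> I \<inter> B \<Longrightarrow> q e \<le> q' e"
  shows "bern_prob I q (\<lambda>\<omega>. Q (\<lambda>e. \<omega> e \<and> e \<in> B)) \<le> bern_prob I q' Q"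
proof -
  obtain J where J: "incseq J" "\<And>n. finite (J n)" "(\<Union>n. J n) = I"
    using finite_exhaustion[OF assms(1)] by blast
  \<comment> \<open>It equals \<open>q\<close> on \<open>B\<close>, so the restricted event keeps
    its probability, and it is at most \<open>q'\<close> everywhere, so ordinary monotonicity
    applies.\<close>
  let ?r = "\<lambda>e. if e \<in> B then q e else q' e"
  let ?QB = "\<lambda>\<omega>. Q (\<lambda>e. \<omega> e \<and> e \<in> B)"
  have fin: "finitary I ?QB" by (rule finitary_restrict[OF assms(2)])
  have JI: "J n \<subseteq> I" for n using J(3) by auto
  have q01: "0 \<le> q e \<and> q e \<le> 1" and r01: "0 \<le> ?r e \<and> ?r e \<le> 1" if "e \<in> J n" for e n
    using JI[of n] that assms(3,4) by auto
  have "bern_prob I q (\<lambda>\<omega>. ?QB (\<lambda>e. \<omega> e \<and> e \<in> J n)) = subset_avg q (J n \<inter> B) (\<lambda>A. of_bool (Q (\<lambda>e. e \<in> A)))" for n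
    using bern_prob_finite[of I "J n \<inter> B" q Q] assms JI[of n] J(2)[of n] by (auto simp: conj_assoc)
  moreover have "bern_prob I ?r (\<lambda>\<omega>. ?QB (\<lambda>e. \<omega> e \<and> e \<in> J n)) = subset_avg ?r (J n \<inter> B) (\<lambda>A. of_bool (Q (\<lambda>e. e \<in> A)))" for n
    using bern_prob_finite[of I "J n \<inter> B" ?r Q] assms JI[of n] J(2)[of n] by (auto simp: conj_assoc)
  moreover have "subset_avg q (J n \<inter> B) f = subset_avg ?r (J n \<inter> B) f" for n f
    unfolding subset_avg_def subset_weight_def
    by (intro sum.cong refl arg_cong2[of _ _ _ _ "(*)"] prod.cong) auto
  moreover have "bern_prob I q (\<lambda>\<omega>. ?QB (\<lambda>e. \<omega> e \<and> e \<in> J n)) = subset_avg q (J n) (\<lambda>A. of_bool (?QB (\<lambda>e. e \<in> A)))"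
    "bern_prob I ?r (\<lambda>\<omega>. ?QB (\<lambda>e. \<omega> e \<and> e \<in> J n)) = subset_avg ?r (J n) (\<lambda>A. of_bool (?QB (\<lambda>e. e \<in> A)))" for n
    by (rule bern_prob_finite[where Q = ?QB, OF assms(1) J(2) JI q01] bern_prob_finite[where Q = ?QB, OF assms(1) J(2) JI r01], assumption)+
  ultimately have "subset_avg q (J n) (\<lambda>A. of_bool (?QB (\<lambda>e. e \<in> A))) =
      subset_avg ?r (J n) (\<lambda>A. of_bool (?QB (\<lambda>e. e \<in> A)))" for n by simp
  also have "\<dots> n \<le> subset_avg q' (J n) (\<lambda>A. of_bool (?QB (\<lambda>e. e \<in> A)))" for n
    using J(2) JI[of n] assms(3-5) of_bool_finitary_mono[OF fin]
    by (intro subset_avg_mono_density) auto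
  finally have "subset_avg q (J n) (\<lambda>A. of_bool (?QB (\<lambda>e. e \<in> A))) \<le>
      subset_avg q' (J n) (\<lambda>A. of_bool (?QB (\<lambda>e. e \<in> A)))" for n .
  hence "bern_prob I q ?QB \<le> bern_prob I q' ?QB"
    by (intro LIMSEQ_le[OF bern_prob_finitary_lim[OF assms(1) fin _ J] bern_prob_finitary_lim[OF assms(1) fin _ J]]
        assms) auto
  also have "\<dots> \<le> bern_prob I q' Q"
    using finitary_mono[OF assms(2), of "\<lambda>e. _ e \<and> e \<in> B"]
    by (intro bern_prob_mono measurable_finitary assms) blast
  finally show ?thesis .
qed

text \<open>The certificate \<open>W\<close> does not depend on the density, so this gives lower
  bounds that are uniform over a range of densities.\<close>

lemma bern_prob_forces:
  assumes "countable I" "finitary I Q" "finite W" "W \<subseteq> I" "forces W Q"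
    and "\<And>e. e \<in> I \<Longrightarrow> 0 \<le> q e \<and> q e \<le> 1"
  shows "(\<Prod>e\<in>W. q e) \<le> bern_prob I q Q"
proof -
  have "(\<Prod>e\<in>W. q e) = subset_weight q W W" by (simp add: subset_weight_def)
  also have "\<dots> = bern_prob I q (\<lambda>\<omega>. {e\<in>W. \<omega> e} = W)"
    using assms by (intro bern_prob_subset_eq[symmetric]) auto
  also have "\<dots> \<le> bern_prob I q Q"
    using forcesD[OF assms(5)] by (intro bern_prob_mono measurable_finitary assms) blast
  finally show ?thesis .
qed

section \<open>Symmetries of the product measure\<close>

lemma map_Not_bernoulli:
  assumes "0 \<le> p" "p \<le> 1"
  shows "map_pmf Not (bernoulli_pmf p) = bernoulli_pmf (1 - p)"
proof (rule pmf_eqI)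
  fix b
  have "pmf (map_pmf Not (bernoulli_pmf p)) (Not (\<not> b)) = pmf (bernoulli_pmf p) (\<not> b)"
    by (rule pmf_map_inj') (auto simp: inj_def)
  thus "pmf (map_pmf Not (bernoulli_pmf p)) b = pmf (bernoulli_pmf (1 - p)) b"
    using assms by (cases b) auto
qed

text \<open>Dual connections are decreasing in the occupied elements. Exchanging occupied and vacant
  makes them increasing and brings them under the results on finitary events.\<close>

lemma bern_prob_flip:
  assumes "countable I" "finitary I Q" "\<And>e. e \<in> I \<Longrightarrow> 0 \<le> q e \<and> q e \<le> 1"
  shows "bern_prob I q (\<lambda>\<omega>. Q (\<lambda>e. \<not> \<omega> e)) = bern_prob I (\<lambda>e. 1 - q e) Q"
proof -
  let ?N = "\<lambda>q e. measure_pmf (bernoulli_pmf (q e))" and ?q = "\<lambda>e. 1 - q e"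
  interpret N: product_prob_space "?N q" I by (rule product_prob_space_bern)
  interpret N': product_prob_space "?N ?q" I by (rule product_prob_space_bern)
  \<comment> \<open>Restricted to \<open>I\<close>, because the points of the product space take the
    default value outside \<open>I\<close>; a finitary event does not see the difference.\<close>
  let ?T = "\<lambda>\<omega>. \<lambda>e\<in>I. \<not> \<omega> e"
  have T: "?T \<in> measurable (bern I q) (bern I ?q)"
    unfolding bern_def by (intro measurable_restrict) measurable
  have "distr (bern I q) (bern I ?q) ?T = PiM I (?N ?q)"
  proof (rule N'.PiM_eq)
    show "sets (distr (bern I q) (bern I ?q) ?T) = sets (PiM I (?N ?q))"
      by (simp add: bern_def)
    fix J F assume J: "finite J" "J \<subseteq> I" "\<And>j. j \<in> J \<Longrightarrow> F j \<in> sets (?N ?q j)"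
    have "emeasure (distr (bern I q) (bern I ?q) ?T) (prod_emb I (?N ?q) J (\<Pi>\<^sub>E j\<in>J. F j))
        = emeasure (bern I q) (?T -` (prod_emb I (?N ?q) J (\<Pi>\<^sub>E j\<in>J. F j)) \<inter> space (bern I q))"
      using J by (intro emeasure_distr T) (simp add: bern_def sets_PiM_I)
    also have "?T -` (prod_emb I (?N ?q) J (\<Pi>\<^sub>E j\<in>J. F j)) \<inter> space (bern I q) =
        prod_emb I (?N q) J (\<Pi>\<^sub>E j\<in>J. {b. (\<not> b) \<in> F j})"
      using J(2) by (auto simp: prod_emb_def space_bern PiE_iff Int_absorb1)
    also have "emeasure (bern I q) \<dots> = (\<Prod>j\<in>J. emeasure (?N q j) {b. (\<not> b) \<in> F j})"
      unfolding bern_def using J by (intro N.emeasure_PiM_emb) auto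
    also have "\<dots> = (\<Prod>j\<in>J. emeasure (?N ?q j) (F j))"
    proof (rule prod.cong[OF refl])
      fix j assume "j \<in> J"
      hence "bernoulli_pmf (1 - q j) = map_pmf Not (bernoulli_pmf (q j))"
        using J(2) assms(3)[of j] by (intro map_Not_bernoulli[symmetric]) auto
      thus "emeasure (?N q j) {b. (\<not> b) \<in> F j} = emeasure (?N ?q j) (F j)"
        by (simp add: vimage_def)
    qed
    finally show "emeasure (distr (bern I q) (bern I ?q) ?T) (prod_emb I (?N ?q) J (\<Pi>\<^sub>E j\<in>J. F j)) =
        (\<Prod>j\<in>J. emeasure (?N ?q j) (F j))" .
  qed
  hence eq: "bern I ?q = distr (bern I q) (bern I ?q) ?T" by (simp add: bern_def)
  have "bern_prob I ?q Q = measure (bern I q) (?T -` {\<omega>\<in>space (bern I ?q). Q \<omega>} \<inter> space (bern I q))"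
    unfolding bern_prob_def using measurable_finitary[OF assms(1,2), of ?q]
    by (subst (1) eq, subst measure_distr[OF T]) (auto simp: pred_def)
  also have "?T -` {\<omega>\<in>space (bern I ?q). Q \<omega>} \<inter> space (bern I q) = {\<omega>\<in>space (bern I q). Q (\<lambda>e. \<not> \<omega> e)}"
    using finitary_cong[OF assms(2), of "?T _" "\<lambda>e. \<not> _ e"] by (auto simp: space_bern)
  finally show ?thesis by (simp add: bern_prob_def)
qed

lemma bern_prob_reindex:
  assumes "countable I" "finitary I Q" "bij_betw f I I" "\<And>e. e \<in> I \<Longrightarrow> q (f e) = q e"
  shows "bern_prob I q (\<lambda>\<omega>. Q (\<lambda>e. \<omega> (f e))) = bern_prob I q Q"
proof -
  let ?N = "\<lambda>q e. measure_pmf (bernoulli_pmf (q e))"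
  let ?T = "\<lambda>\<omega>. \<lambda>e\<in>I. \<omega> (f e)"
  have f: "inj_on f I" "f \<in> I \<rightarrow> I" using assms(3) by (auto simp: bij_betw_def)
  have eq: "PiM I (\<lambda>e. ?N q (f e)) = bern I q"
    unfolding bern_def using assms(4) by (intro PiM_cong) auto
  have "distr (bern I q) (PiM I (\<lambda>e. ?N q (f e))) ?T = PiM I (\<lambda>e. ?N q (f e))"
    unfolding bern_def using f
    by (intro distr_PiM_reindex) (auto simp: measure_pmf.prob_space_axioms)
  hence eq2: "bern I q = distr (bern I q) (bern I q) ?T" unfolding eq by simp
  have T: "?T \<in> measurable (bern I q) (bern I q)"
    unfolding bern_def by (intro measurable_restrict) (use f in \<open>auto intro!: measurable_bern_component[unfolded bern_def]\<close>)
  have "bern_prob I q Q = measure (bern I q) (?T -` {\<omega>\<in>space (bern I q). Q \<omega>} \<inter> space (bern I q))"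
    unfolding bern_prob_def using measurable_finitary[OF assms(1,2), of q]
    by (subst (1) eq2, subst measure_distr[OF T]) (auto simp: pred_def)
  also have "?T -` {\<omega>\<in>space (bern I q). Q \<omega>} \<inter> space (bern I q) = {\<omega>\<in>space (bern I q). Q (\<lambda>e. \<omega> (f e))}"
    using finitary_cong[OF assms(2), of "?T _" "\<lambda>e. _ (f e)"] by (auto simp: space_bern)
  finally show ?thesis by (simp add: bern_prob_def)
qed


section \<open>Geometry of the lattice\<close>

locale lattice =
  fixes M :: percolation_model
  assumes planar: "planar_lattice M"
begin

definition lat :: "int \<Rightarrow> int \<Rightarrow> complex" where
  "lat a b = of_int a + of_int b * cis (rot_angle M)"

definition trans :: "complex set" where "trans = {lat a b | a b. True}"

lemma sin_pos: "0 < sin (rot_angle M)"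
  using planar by (auto simp: planar_lattice_def intro: sin_gt_zero)

lemma coord_add: "coord1 M (x + y) = coord1 M x + coord1 M y" "coord2 M (x + y) = coord2 M x + coord2 M y"
  by (simp_all add: coord1_def coord2_def add_divide_distrib algebra_simps)

lemma coord_minus: "coord1 M (- x) = - coord1 M x" "coord2 M (- x) = - coord2 M x"
  by (simp_all add: coord1_def coord2_def)

lemma coord_diff: "coord1 M (x - y) = coord1 M x - coord1 M y" "coord2 M (x - y) = coord2 M x - coord2 M y"
  using coord_add[of x "- y"] coord_minus[of y] by simp_all

lemma coord_scaleR: "coord1 M (r *\<^sub>R x) = r * coord1 M x" "coord2 M (r *\<^sub>R x) = r * coord2 M x"
  by (simp_all add: coord1_def coord2_def algebra_simps)

lemma coord_0 [simp]: "coord1 M 0 = 0" "coord2 M 0 = 0"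
  by (simp_all add: coord1_def coord2_def)

lemma coord_of_real: "coord1 M (of_real x + of_real y * cis (rot_angle M)) = x"
    "coord2 M (of_real x + of_real y * cis (rot_angle M)) = y"
  using sin_pos by (simp_all add: coord1_def coord2_def)

lemma coord_lat [simp]: "coord1 M (lat a b) = of_int a" "coord2 M (lat a b) = of_int b"
  using coord_of_real[of "of_int a" "of_int b"] by (simp_all add: lat_def)

lemma decompose: "z = of_real (coord1 M z) + of_real (coord2 M z) * cis (rot_angle M)"
  using sin_pos by (simp add: complex_eq_iff coord1_def coord2_def)

lemma lnorm_nonneg [simp]: "0 \<le> lnorm M z"
  by (simp add: lnorm_def)

lemma lnorm_0 [simp]: "lnorm M 0 = 0" by (simp add: lnorm_def)

lemma lnorm_minus: "lnorm M (- z) = lnorm M z"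
  by (simp add: lnorm_def coord_minus)

lemma lnorm_commute: "lnorm M (x - y) = lnorm M (y - x)"
  using lnorm_minus[of "x - y"] by simp

lemma lnorm_triangle: "lnorm M (x + y) \<le> lnorm M x + lnorm M y"
  by (auto simp: lnorm_def coord_add)

lemma lnorm_triangle': "lnorm M (x - z) \<le> lnorm M (x - y) + lnorm M (y - z)"
  using lnorm_triangle[of "x - y" "y - z"] by simp

lemma lnorm_scaleR: "lnorm M (r *\<^sub>R z) = \<bar>r\<bar> * lnorm M z"
  by (simp add: lnorm_def coord_scaleR abs_mult max_mult_distrib_left)

lemma coord_le_lnorm: "\<bar>coord1 M z\<bar> \<le> lnorm M z" "\<bar>coord2 M z\<bar> \<le> lnorm M z"
  by (simp_all add: lnorm_def)

lemma norm_le_lnorm: "norm z \<le> 2 * lnorm M z"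
proof -
  have "norm z \<le> norm (of_real (coord1 M z) :: complex) + norm (of_real (coord2 M z) * cis (rot_angle M))"
    by (subst (1) decompose[of z]) (rule norm_triangle_ineq)
  also have "\<dots> = \<bar>coord1 M z\<bar> + \<bar>coord2 M z\<bar>" by (simp add: norm_mult)
  also have "\<dots> \<le> 2 * lnorm M z" using coord_le_lnorm[of z] by simp
  finally show ?thesis .
qed

lemma lnorm_le_norm: "\<exists>K>0. \<forall>z. lnorm M z \<le> K * norm z"
proof (intro exI[of _ "1 + 1 / sin (rot_angle M)"] conjI allI)
  show "0 < 1 + 1 / sin (rot_angle M)" using sin_pos by (simp add: add_pos_pos)
  fix z
  have 1: "\<bar>coord2 M z\<bar> \<le> norm z / sin (rot_angle M)"
    using sin_pos abs_Im_le_cmod[of z] by (simp add: coord2_def divide_right_mono)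
  have "\<bar>coord1 M z\<bar> \<le> \<bar>Re z\<bar> + \<bar>coord2 M z * cos (rot_angle M)\<bar>"
    unfolding coord1_def by (rule abs_triangle_ineq4)
  also have "\<dots> \<le> norm z + \<bar>coord2 M z\<bar> * 1"
    unfolding abs_mult by (intro add_mono mult_left_mono abs_Re_le_cmod) auto
  finally show "lnorm M z \<le> (1 + 1 / sin (rot_angle M)) * norm z"
    using 1 norm_ge_zero[of z] by (simp add: lnorm_def distrib_right) (use norm_ge_zero[of z] in linarith)
qed

lemma continuous_coord: "continuous_on S (coord1 M)" "continuous_on S (coord2 M)"
  unfolding coord1_def[abs_def] coord2_def[abs_def] using sin_pos
  by (auto intro!: continuous_intros)

lemma finite_sites_lnorm: "finite {v\<in>sites M. lnorm M (v - z) \<le> R}"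
proof (rule finite_subset)
  show "finite (sites M \<inter> cball 0 (2 * R + norm z))" using planar by (simp add: planar_lattice_def)
  have "norm v \<le> 2 * R + norm z" if "lnorm M (v - z) \<le> R" for v
    using norm_le_lnorm[of "v - z"] norm_triangle_ineq2[of v z] that by linarith
  thus "{v\<in>sites M. lnorm M (v - z) \<le> R} \<subseteq> sites M \<inter> cball 0 (2 * R + norm z)"
    by (auto simp: dist_norm)
qed

lemma countable_sites: "countable (sites M)"
proof -
  have "\<exists>n. lnorm M v \<le> real n" for v by (rule real_arch_simple)
  hence "sites M = (\<Union>n::nat. {v\<in>sites M. lnorm M (v - 0) \<le> real n})"
    by auto
  also have "countable \<dots>" by (intro countable_UN[OF countableI_type] countable_finite finite_sites_lnorm)
  finally show ?thesis .
qed

lemma zero_site: "0 \<in> sites M" using planar by (simp add: planar_lattice_def)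

lemma bondE:
  assumes "e \<in> bonds M"
  obtains u v where "e = {u, v}" "u \<noteq> v" "u \<in> sites M" "v \<in> sites M"
proof -
  have "card e = 2" "e \<subseteq> sites M" using planar assms by (auto simp: planar_lattice_def)
  thus ?thesis using that by (auto simp: card_2_iff)
qed

lemma bond_sites: "{u, v} \<in> bonds M \<Longrightarrow> u \<in> sites M \<and> v \<in> sites M \<and> u \<noteq> v"
  by (auto elim!: bondE simp: doubleton_eq_iff)

lemma finite_bonds_at: "v \<in> sites M \<Longrightarrow> finite {e\<in>bonds M. v \<in> e}"
  using planar by (simp add: planar_lattice_def)

lemma countable_bonds: "countable (bonds M)"
proof (rule countable_subset)
  show "bonds M \<subseteq> (\<Union>v\<in>sites M. {e\<in>bonds M. v \<in> e})"
  proof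
    fix e assume e: "e \<in> bonds M"
    then obtain u v where "e = {u, v}" "u \<in> sites M" by (rule bondE)
    with e show "e \<in> (\<Union>v\<in>sites M. {e\<in>bonds M. v \<in> e})" by auto
  qed
  show "countable (\<Union>v\<in>sites M. {e\<in>bonds M. v \<in> e})"
    by (intro countable_UN countable_sites countable_finite finite_bonds_at)
qed

lemma countable_elements: "countable (elements M)"
  unfolding elements_def by (cases "kind M") (auto intro: countable_sites countable_bonds)

lemma noncrossing: "e \<in> bonds M \<Longrightarrow> f \<in> bonds M \<Longrightarrow> e \<noteq> f \<Longrightarrow> convex hull e \<inter> convex hull f = e \<inter> f"
  using planar by (simp add: planar_lattice_def)

lemma sites_connected: "u \<in> sites M \<Longrightarrow> v \<in> sites M \<Longrightarrow> (u, v) \<in> {(x, y). {x, y} \<in> bonds M}\<^sup>*"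
  using planar by (simp add: planar_lattice_def)

section \<open>Translation invariance\<close>

definition periodic :: "(complex \<Rightarrow> complex) \<Rightarrow> bool" where
  "periodic T \<longleftrightarrow> bij T \<and> invariant_under M T"

lemma periodic_comp: "periodic S \<Longrightarrow> periodic T \<Longrightarrow> periodic (S \<circ> T)"
proof -
  assume ST: "periodic S" "periodic T"
  have "(`) (S \<circ> T) = (`) S \<circ> (`) T" by (simp add: fun_eq_iff image_comp)
  hence "(`) (S \<circ> T) ` bonds M = (`) S ` (`) T ` bonds M" by (simp only: image_comp)
  moreover have "(S \<circ> T) ` sites M = S ` T ` sites M" by (simp only: image_comp)
  ultimately show ?thesis
    using ST unfolding periodic_def invariant_under_def by (metis bij_comp)
qed

lemma periodic_inv: "periodic T \<Longrightarrow> periodic (inv T)"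
proof -
  assume T: "periodic T"
  hence b: "bij T" and s: "T ` sites M = sites M" and e: "(`) T ` bonds M = bonds M"
    by (auto simp: periodic_def invariant_under_def)
  have i: "inv T ` T ` A = A" for A using b by (simp add: bij_is_inj image_inv_f_f)
  have "inv T ` sites M = sites M" using i[of "sites M"] s by simp
  moreover have "(`) (inv T) ` bonds M = bonds M"
  proof -
    have "(`) (inv T) ` (`) T ` bonds M = (\<lambda>A. inv T ` T ` A) ` bonds M" by (simp only: image_image)
    hence "(`) (inv T) ` (`) T ` bonds M = bonds M" by (simp only: i image_ident)
    thus ?thesis by (simp add: e)
  qed
  ultimately show ?thesis using b by (simp add: periodic_def invariant_under_def bij_imp_bij_inv)
qed

lemma periodic_one: "periodic ((+) 1)"
  using planar by (simp add: planar_lattice_def periodic_def bij_plus_right)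

lemma periodic_rot: "periodic ((*) (cis (rot_angle M)))"
  using planar by (auto simp: planar_lattice_def periodic_def intro!: o_bij[of "(*) (cis (- rot_angle M))"]
      simp: fun_eq_iff mult.assoc[symmetric] cis_mult)

text \<open>Translation along the second axis is translation by 1 conjugated with the symmetry
  rotation. Integer multiples follow by induction in both directions.\<close>

lemma periodic_lat: "periodic ((+) (lat a b))"
proof -
  have step: "periodic ((+) (of_int n * s))" if s: "periodic ((+) s)" for n :: int and s :: complex
  proof (induction n rule: int_induct[where k = 0])
    case base show ?case using bij_id by (simp add: periodic_def invariant_under_def id_def)
  next
    case (step1 i)
    from periodic_comp[OF this(2) s] show ?case by (simp add: comp_def algebra_simps)
  next
    case (step2 i)
    have "inv ((+) s) = (+) (- s)" by (rule inv_equality) auto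
    with periodic_comp[OF step2(2) periodic_inv[OF s]] show ?case by (simp add: comp_def algebra_simps)
  qed
  have "inv ((*) (cis (rot_angle M))) = (*) (cis (- rot_angle M))"
    by (rule inv_equality) (simp_all add: mult.assoc[symmetric] cis_mult)
  hence "(*) (cis (rot_angle M)) \<circ> (+) 1 \<circ> inv ((*) (cis (rot_angle M))) = (+) (cis (rot_angle M))"
    by (simp add: fun_eq_iff algebra_simps mult.assoc[symmetric] cis_mult)
  with periodic_comp[OF periodic_comp[OF periodic_rot periodic_one] periodic_inv[OF periodic_rot]]
  have rot: "periodic ((+) (cis (rot_angle M)))" by simp
  have "(+) (of_int a * 1) \<circ> (+) (of_int b * cis (rot_angle M)) = (+) (lat a b)"
    by (simp add: fun_eq_iff lat_def)
  with periodic_comp[OF step[OF periodic_one] step[OF rot], of a b] show ?thesis by simp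
qed

lemma trans_sites: "t \<in> trans \<Longrightarrow> (+) t ` sites M = sites M"
  using periodic_lat unfolding trans_def periodic_def invariant_under_def by blast

lemma trans_bonds: "t \<in> trans \<Longrightarrow> (`) ((+) t) ` bonds M = bonds M"
  using periodic_lat unfolding trans_def periodic_def invariant_under_def by blast

lemma lat_trans [simp]: "lat a b \<in> trans" by (auto simp: trans_def)

lemma lat_0 [simp]: "lat 0 0 = 0" by (simp add: lat_def)

lemma lat_add: "lat a b + lat c d = lat (a + c) (b + d)" by (simp add: lat_def algebra_simps)

lemma lat_minus: "- lat a b = lat (- a) (- b)" by (simp add: lat_def algebra_simps)

lemma trans_add: "s \<in> trans \<Longrightarrow> t \<in> trans \<Longrightarrow> s + t \<in> trans"
  unfolding trans_def by clarify (auto simp: lat_add)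

lemma trans_minus: "t \<in> trans \<Longrightarrow> - t \<in> trans"
  unfolding trans_def by clarify (auto simp: lat_minus)

lemma trans_0: "0 \<in> trans" using lat_trans[of 0 0] by simp

lemma trans_diff: "s \<in> trans \<Longrightarrow> t \<in> trans \<Longrightarrow> s - t \<in> trans"
  using trans_add[of s "- t"] trans_minus[of t] by simp

lemma trans_mult: "t \<in> trans \<Longrightarrow> of_nat k * t \<in> trans"
  by (induction k) (auto simp: trans_0 algebra_simps intro: trans_add)

lemma trans_site: "t \<in> trans \<Longrightarrow> t \<in> sites M"
  using trans_sites[of t] zero_site by force

lemma site_add: "t \<in> trans \<Longrightarrow> v \<in> sites M \<Longrightarrow> t + v \<in> sites M"
  using trans_sites[of t] by blast

lemma site_add_iff: "t \<in> trans \<Longrightarrow> t + v \<in> sites M \<longleftrightarrow> v \<in> sites M"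
  using site_add[of t v] site_add[of "- t" "t + v"] trans_minus[of t] by auto

lemma bond_add: "t \<in> trans \<Longrightarrow> e \<in> bonds M \<Longrightarrow> (+) t ` e \<in> bonds M"
  using trans_bonds[of t] by blast

lemma near_trans: "\<exists>a b. 0 \<le> coord1 M (z - lat a b) \<and> coord1 M (z - lat a b) \<le> 1 \<and>
    0 \<le> coord2 M (z - lat a b) \<and> coord2 M (z - lat a b) \<le> 1"
  by (rule exI[of _ "\<lfloor>coord1 M z\<rfloor>"], rule exI[of _ "\<lfloor>coord2 M z\<rfloor>"])
    (auto simp: coord_diff, linarith+)

text \<open>A finite set that contains a translate of every site (\<open>site_cell\<close>). Maxima
  over it thus become bounds that are uniform over the whole lattice.\<close>

definition cell :: "complex set" where "cell = {v\<in>sites M. lnorm M v \<le> 1}"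

lemma finite_cell: "finite cell"
  using finite_sites_lnorm[of 0 1] by (simp add: cell_def)

lemma site_cell:
  assumes "v \<in> sites M"
  obtains t u where "t \<in> trans" "u \<in> cell" "v = t + u"
proof -
  obtain a b where ab: "0 \<le> coord1 M (v - lat a b)" "coord1 M (v - lat a b) \<le> 1"
    "0 \<le> coord2 M (v - lat a b)" "coord2 M (v - lat a b) \<le> 1" using near_trans by blast
  have "v - lat a b \<in> sites M"
    using site_add_iff[of "lat a b" "v - lat a b"] assms by simp
  hence "v - lat a b \<in> cell" using ab by (simp add: cell_def lnorm_def)
  thus ?thesis using that[of "lat a b" "v - lat a b"] by simp
qed

lemma bond_cell:
  assumes "e \<in> bonds M"
  obtains t f where "t \<in> trans" "f \<in> bonds M" "f \<inter> cell \<noteq> {}" "e = (+) t ` f"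
proof -
  obtain u v where e: "e = {u, v}" "u \<in> sites M" using assms by (rule bondE)
  obtain t u' where t: "t \<in> trans" "u' \<in> cell" "u = t + u'" using e(2) by (rule site_cell)
  let ?f = "(+) (- t) ` e"
  have "?f \<in> bonds M" using bond_add[of "- t" e] trans_minus[OF t(1)] assms by simp
  moreover have "u' \<in> ?f" using t e by auto
  moreover have "e = (+) t ` ?f" by (simp add: image_image)
  ultimately show ?thesis using that t by blast
qed

lemma finite_bonds_cell: "finite {f\<in>bonds M. f \<inter> cell \<noteq> {}}"
proof (rule finite_subset)
  show "{f\<in>bonds M. f \<inter> cell \<noteq> {}} \<subseteq> (\<Union>v\<in>cell. {e\<in>bonds M. v \<in> e})" by auto
  show "finite (\<Union>v\<in>cell. {e\<in>bonds M. v \<in> e})"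
    using finite_cell finite_bonds_at by (auto simp: cell_def)
qed

text \<open>Up to translation there are only the finitely many bonds that meet
  \<open>cell\<close>.\<close>

lemma bond_length: "\<exists>L>0. \<forall>u v. {u, v} \<in> bonds M \<longrightarrow> lnorm M (u - v) \<le> L"
proof -
  let ?F = "{f\<in>bonds M. f \<inter> cell \<noteq> {}}"
  have "finite (\<Union>?F)" using finite_bonds_cell by (auto elim!: bondE)
  hence fin: "finite ((\<lambda>(u, v). lnorm M (u - v)) ` (\<Union>?F \<times> \<Union>?F))" by blast
  define L where "L = Max ((\<lambda>(u, v). lnorm M (u - v)) ` (\<Union>?F \<times> \<Union>?F))"
  have L: "lnorm M (u - v) \<le> L" if "u \<in> \<Union>?F" "v \<in> \<Union>?F" for u v
    unfolding L_def using that by (intro Max_ge[OF fin]) (rule image_eqI[of _ _ "(u, v)"], auto)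
  show ?thesis
  proof (intro exI[of _ "max L 1"] conjI allI impI)
    fix u v assume "{u, v} \<in> bonds M"
    then obtain t f where t: "f \<in> ?F" "{u, v} = (+) t ` f" by (rule bond_cell) auto
    hence "u \<in> (+) t ` f" "v \<in> (+) t ` f" by auto
    then obtain u' v' where "u' \<in> f" "v' \<in> f" "u = t + u'" "v = t + v'" by auto
    thus "lnorm M (u - v) \<le> max L 1" using L[of u' v', OF UnionI UnionI, OF t(1) _ t(1)] by simp
  qed simp
qed

definition bond_bound :: real where
  "bond_bound = (SOME L. L > 0 \<and> (\<forall>u v. {u, v} \<in> bonds M \<longrightarrow> lnorm M (u - v) \<le> L))"

lemma bond_bound: "bond_bound > 0" "{u, v} \<in> bonds M \<Longrightarrow> lnorm M (u - v) \<le> bond_bound"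
  using someI_ex[OF bond_length] by (auto simp: bond_bound_def)

lemma lnorm_convex_hull:
  assumes "x \<in> convex hull {u, v}"
  shows "lnorm M (x - z) \<le> max (lnorm M (u - z)) (lnorm M (v - z))"
proof -
  obtain s where s: "0 \<le> s" "s \<le> 1" "x = (1 - s) *\<^sub>R u + s *\<^sub>R v"
    using assms unfolding segment_convex_hull[symmetric] closed_segment_def by auto
  have "x - z = (1 - s) *\<^sub>R (u - z) + s *\<^sub>R (v - z)" by (simp add: s algebra_simps)
  also have "lnorm M \<dots> \<le> lnorm M ((1 - s) *\<^sub>R (u - z)) + lnorm M (s *\<^sub>R (v - z))"
    by (rule lnorm_triangle)
  also have "\<dots> = (1 - s) * lnorm M (u - z) + s * lnorm M (v - z)"
    using s by (simp add: lnorm_scaleR)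
  also have "\<dots> \<le> (1 - s) * max (lnorm M (u - z)) (lnorm M (v - z)) + s * max (lnorm M (u - z)) (lnorm M (v - z))"
    using s by (intro add_mono mult_left_mono) auto
  finally show ?thesis by (simp add: algebra_simps)
qed

lemma bond_near:
  assumes "{u, v} \<in> bonds M" "x \<in> convex hull {u, v}"
  shows "lnorm M (x - u) \<le> bond_bound" "lnorm M (x - v) \<le> bond_bound"
  using lnorm_convex_hull[OF assms(2), of u] lnorm_convex_hull[OF assms(2), of v]
    bond_bound bond_bound(2)[OF assms(1)] lnorm_commute[of u v] by auto

lemma finite_bonds_near: "finite {e\<in>bonds M. \<exists>x\<in>convex hull e. lnorm M (x - z) \<le> R}"
proof (rule finite_subset)
  let ?V = "{v\<in>sites M. lnorm M (v - z) \<le> R + bond_bound}"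
  show "finite (\<Union>v\<in>?V. {e\<in>bonds M. v \<in> e})"
    using finite_bonds_at finite_sites_lnorm by auto
  show "{e\<in>bonds M. \<exists>x\<in>convex hull e. lnorm M (x - z) \<le> R} \<subseteq> (\<Union>v\<in>?V. {e\<in>bonds M. v \<in> e})"
  proof safe
    fix e x assume e: "e \<in> bonds M" "x \<in> convex hull e" "lnorm M (x - z) \<le> R"
    obtain u v where uv: "e = {u, v}" "u \<in> sites M" using e(1) by (rule bondE)
    have "lnorm M (u - z) \<le> R + bond_bound"
      using lnorm_triangle'[of u z x] bond_near(1)[of u v x] e uv lnorm_commute[of u x] by auto
    thus "e \<in> (\<Union>v\<in>?V. {e\<in>bonds M. v \<in> e})" using uv e by auto
  qed
qed

lemma card_int_interval: "x \<le> y \<Longrightarrow> real (card {a::int. x \<le> of_int a \<and> of_int a \<le> y}) \<le> y - x + 1"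
proof -
  assume "x \<le> y"
  have "{a::int. x \<le> of_int a \<and> of_int a \<le> y} = {\<lceil>x\<rceil>..\<lfloor>y\<rfloor>}" by (auto simp: le_floor_iff ceiling_le_iff)
  thus ?thesis using \<open>x \<le> y\<close> by (simp, linarith)
qed

lemma card_sites_lnorm: "\<exists>C>0. \<forall>z R. 0 \<le> R \<longrightarrow> real (card {v\<in>sites M. lnorm M (v - z) \<le> R}) \<le> C * (R + 1)\<^sup>2"
proof (intro exI[of _ "9 * real (card cell) + 1"] conjI allI impI)
  fix z R assume R: "(0::real) \<le> R"
  let ?I = "\<lambda>x. {a::int. x - (R + 1) \<le> of_int a \<and> of_int a \<le> x + (R + 1)}"
  let ?S = "{v\<in>sites M. lnorm M (v - z) \<le> R}"
  have fI: "finite (?I x)" for x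
    by (rule finite_subset[of _ "{\<lceil>x - (R + 1)\<rceil>..\<lfloor>x + (R + 1)\<rfloor>}"]) (auto simp: le_floor_iff ceiling_le_iff)
  have "?S \<subseteq> (\<lambda>(u, a, b). lat a b + u) ` (cell \<times> ?I (coord1 M z) \<times> ?I (coord2 M z))"
  proof
    fix v assume v: "v \<in> ?S"
    then obtain t u where t: "t \<in> trans" "u \<in> cell" "v = t + u" using site_cell by blast
    then obtain a b where ab: "t = lat a b" by (auto simp: trans_def)
    have "\<bar>coord1 M u\<bar> \<le> 1" "\<bar>coord2 M u\<bar> \<le> 1" using t(2) coord_le_lnorm[of u] by (auto simp: cell_def)
    moreover have "\<bar>coord1 M v - coord1 M z\<bar> \<le> R" "\<bar>coord2 M v - coord2 M z\<bar> \<le> R"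
      using v coord_le_lnorm[of "v - z"] by (auto simp: coord_diff)
    ultimately have "a \<in> ?I (coord1 M z)" "b \<in> ?I (coord2 M z)"
      by (auto simp: t(3) ab coord_add)
    thus "v \<in> (\<lambda>(u, a, b). lat a b + u) ` (cell \<times> ?I (coord1 M z) \<times> ?I (coord2 M z))"
      using t ab by force
  qed
  hence card: "card ?S \<le> card (cell \<times> ?I (coord1 M z) \<times> ?I (coord2 M z))"
    using fI finite_cell by (intro surj_card_le) auto
  have "real (card ?S) \<le> real (card cell) * (real (card (?I (coord1 M z))) * real (card (?I (coord2 M z))))"
    using of_nat_mono[OF card, where 'a = real] by (simp only: card_cartesian_product of_nat_mult)
  also have "\<dots> \<le> real (card cell) * ((2 * R + 3) * (2 * R + 3))"
    using card_int_interval[of "coord1 M z - (R + 1)" "coord1 M z + (R + 1)"]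
      card_int_interval[of "coord2 M z - (R + 1)" "coord2 M z + (R + 1)"] R
    by (intro mult_left_mono mult_mono) auto
  also have "\<dots> \<le> real (card cell) * ((3 * (R + 1)) * (3 * (R + 1)))"
    using R by (intro mult_left_mono mult_mono) auto
  also have "\<dots> \<le> (9 * real (card cell) + 1) * (R + 1)\<^sup>2"
    using zero_le_power2[of "R + 1"] by (simp add: power2_eq_square algebra_simps)
  finally show "real (card ?S) \<le> (9 * real (card cell) + 1) * (R + 1)\<^sup>2" .
qed (simp add: add_nonneg_pos)

end


section \<open>Faces, and the duality of cuts and face chains\<close>

context lattice begin

definition graph :: "complex set" where "graph = (\<Union>e\<in>bonds M. convex hull e)"

lemma faces_eq: "faces M = components (- graph)"
  by (simp add: faces_def graph_def)

lemma finite_bonds_ball: "finite {e\<in>bonds M. convex hull e \<inter> cball x r \<noteq> {}}"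
proof -
  obtain K where K: "K > 0" "\<And>z. lnorm M z \<le> K * norm z" using lnorm_le_norm by blast
  have "{e\<in>bonds M. convex hull e \<inter> cball x r \<noteq> {}} \<subseteq>
      {e\<in>bonds M. \<exists>y\<in>convex hull e. lnorm M (y - x) \<le> K * r}"
  proof safe
    fix e y assume "y \<in> convex hull e" "y \<in> cball x r"
    moreover from this have "norm (y - x) \<le> r" by (simp add: dist_norm norm_minus_commute)
    hence "lnorm M (y - x) \<le> K * r"
      using K(2)[of "y - x"] K(1) by (meson mult_left_mono order_trans less_imp_le)
    ultimately show "\<exists>y\<in>convex hull e. lnorm M (y - x) \<le> K * r" by blast
  qed
  thus ?thesis using finite_bonds_near by (rule finite_subset)
qed

lemma finite_sites_ball: "finite {v\<in>sites M. v \<in> cball x r}"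
proof -
  obtain K where K: "K > 0" "\<And>z. lnorm M z \<le> K * norm z" using lnorm_le_norm by blast
  have "lnorm M (v - x) \<le> K * r" if "v \<in> cball x r" for v
  proof -
    have "norm (v - x) \<le> r" using that by (simp add: dist_norm norm_minus_commute)
    thus ?thesis using K(2)[of "v - x"] K(1) by (meson mult_left_mono order_trans less_imp_le)
  qed
  hence "{v\<in>sites M. v \<in> cball x r} \<subseteq> {v\<in>sites M. lnorm M (v - x) \<le> K * r}" by blast
  thus ?thesis using finite_sites_lnorm by (rule finite_subset)
qed

lemma closed_locally_finite_Union:
  fixes f :: "'a \<Rightarrow> complex set"
  assumes "\<And>x. finite {i\<in>I. f i \<inter> cball x 1 \<noteq> {}}" "\<And>i. i \<in> I \<Longrightarrow> closed (f i)"
  shows "closed (\<Union>i\<in>I. f i)"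
proof -
  have "open (- (\<Union>i\<in>I. f i))"
    unfolding open_contains_ball
  proof
    fix x assume x: "x \<in> - (\<Union>i\<in>I. f i)"
    let ?J = "{i\<in>I. f i \<inter> cball x 1 \<noteq> {}}"
    have "closed (\<Union>i\<in>?J. f i)" using assms by (intro closed_UN) auto
    hence "open (ball x 1 - (\<Union>i\<in>?J. f i))" by (intro open_Diff) auto
    moreover have "x \<in> ball x 1 - (\<Union>i\<in>?J. f i)" using x by auto
    ultimately obtain r where "r > 0" "ball x r \<subseteq> ball x 1 - (\<Union>i\<in>?J. f i)" by (rule openE)
    moreover have "ball x 1 - (\<Union>i\<in>?J. f i) \<subseteq> - (\<Union>i\<in>I. f i)"
    proof safe
      fix y i assume y: "y \<in> ball x 1" "y \<notin> (\<Union>i\<in>?J. f i)" "i \<in> I" "y \<in> f i"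
      hence "y \<in> f i \<inter> cball x 1" by auto
      hence "i \<in> ?J" using y(3) by (intro CollectI conjI) auto
      with y(2,4) show False by (simp only: UN_iff) blast
    qed
    ultimately show "\<exists>r>0. ball x r \<subseteq> - (\<Union>i\<in>I. f i)" by (meson order_trans)
  qed
  thus ?thesis by (simp add: closed_def)
qed

lemma closed_hull_bond: "e \<in> bonds M \<Longrightarrow> closed (convex hull e)"
  by (elim bondE) (simp add: segment_convex_hull[symmetric])

lemma compact_hull_bond: "e \<in> bonds M \<Longrightarrow> compact (convex hull e)"
  by (elim bondE) (simp add: segment_convex_hull[symmetric])

lemma closed_bonds: "B \<subseteq> bonds M \<Longrightarrow> closed (\<Union>e\<in>B. convex hull e)"
  using closed_hull_bond
  by (intro closed_locally_finite_Union finite_subset[OF _ finite_bonds_ball]) auto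

lemma closed_sites: "X \<subseteq> sites M \<Longrightarrow> closed X"
proof -
  assume X: "X \<subseteq> sites M"
  have "closed (\<Union>v\<in>X. {v})"
  proof (rule closed_locally_finite_Union)
    show "finite {v\<in>X. {v} \<inter> cball x 1 \<noteq> {}}" for x
      by (rule finite_subset[OF _ finite_sites_ball[of x 1]]) (use X in auto)
  qed simp
  thus ?thesis by simp
qed

lemma closed_graph: "closed graph"
  unfolding graph_def by (rule closed_bonds) simp

lemma open_face: "F \<in> faces M \<Longrightarrow> open F"
  using open_components[of "- graph"] closed_graph by (auto simp: faces_eq)

lemma face_subset: "F \<in> faces M \<Longrightarrow> F \<subseteq> - graph"
  unfolding faces_eq by (rule in_components_subset)

lemma face_connected: "F \<in> faces M \<Longrightarrow> connected F"
  unfolding faces_eq by (rule in_components_connected)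

lemma face_nonempty: "F \<in> faces M \<Longrightarrow> F \<noteq> {}"
  unfolding faces_eq by (rule in_components_nonempty)

lemma face_eq: "F \<in> faces M \<Longrightarrow> G \<in> faces M \<Longrightarrow> F \<inter> G \<noteq> {} \<Longrightarrow> F = G"
  unfolding faces_eq using components_nonoverlap by blast

lemma face_exists: "connected H \<Longrightarrow> H \<noteq> {} \<Longrightarrow> H \<subseteq> - graph \<Longrightarrow> \<exists>F\<in>faces M. H \<subseteq> F"
  unfolding faces_eq using exists_component_superset[of H "- graph"] by blast

lemma face_absorbs: "F \<in> faces M \<Longrightarrow> connected H \<Longrightarrow> H \<subseteq> - graph \<Longrightarrow> F \<inter> H \<noteq> {} \<Longrightarrow> H \<subseteq> F"
  unfolding faces_eq using components_maximal by blast

lemma frontier_face: "F \<in> faces M \<Longrightarrow> frontier F = closure F - F"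
  using open_face by (simp add: frontier_def interior_open)

lemma bond_graph: "e \<in> bonds M \<Longrightarrow> convex hull e \<subseteq> graph"
  by (auto simp: graph_def)

text \<open>The site has a bond of its own, since it is connected to its translate by
  \<open>lat 1 0\<close>, and two distinct bonds meet in common end points only. So no site lies in
  the interior of a bond, although only bonds are assumed not to cross.\<close>

lemma site_on_bond:
  assumes "v \<in> sites M" "e \<in> bonds M" "v \<in> convex hull e"
  shows "v \<in> e"
proof -
  have "(v, lat 1 0 + v) \<in> {(x, y). {x, y} \<in> bonds M}\<^sup>*"
    using assms(1) by (intro sites_connected site_add) auto
  moreover have "v \<noteq> lat 1 0 + v"
  proof
    assume "v = lat 1 0 + v"
    hence "lat 1 0 = 0" by simp
    thus False using coord_lat(1)[of 1 0] by (simp del: coord_lat)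
  qed
  ultimately have "\<exists>y. (v, y) \<in> {(x, y). {x, y} \<in> bonds M}" by (metis converse_rtranclE)
  then obtain y where "{v, y} \<in> bonds M" by blast
  moreover have "v \<in> convex hull {v, y}" by (simp add: hull_inc)
  ultimately show ?thesis using noncrossing[OF assms(2), of "{v, y}"] assms(3)
    by (cases "e = {v, y}") auto
qed

lemma closure_meets_ball: "x \<in> closure F \<Longrightarrow> r > 0 \<Longrightarrow> F \<inter> ball x r \<noteq> {}"
  unfolding closure_approachable by (metis dist_commute disjoint_iff mem_ball)

text \<open>\<open>H1\<close> and \<open>H2\<close> are the two half discs into which the bond divides a small disc.\<close>

lemma bond_nbhd:
  assumes e: "e \<in> bonds M" and x: "x \<in> convex hull e - e"
  obtains r H1 H2 where "r > 0" "ball x r \<inter> e = {}" "convex H1" "convex H2" "H1 \<noteq> {}" "H2 \<noteq> {}"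
    "ball x r - convex hull e = H1 \<union> H2" "ball x r \<inter> convex hull e \<subseteq> closure H1 \<inter> closure H2"
    "H1 \<subseteq> - graph" "H2 \<subseteq> - graph"
proof -
  obtain a b where ab: "e = {a, b}" "a \<noteq> b" using e by (rule bondE)
  let ?G = "\<Union>f\<in>bonds M - {e}. convex hull f"
  have "x \<notin> convex hull f" if "f \<in> bonds M - {e}" for f
    using noncrossing[OF e, of f] x that by auto
  hence "x \<notin> ?G" by simp
  hence "x \<in> - ?G" by (simp only: Compl_iff not_False_eq_True)
  moreover have "open (- ?G)" by (intro open_Compl closed_bonds) auto
  ultimately obtain r0 where r0: "r0 > 0" "ball x r0 \<subseteq> - ?G" by (meson openE)
  \<comment> \<open>Small enough to miss all other bonds and both end points, so that the bond cuts
    the disc along a full diameter.\<close>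
  define r where "r = min r0 (min (dist x a) (dist x b))"
  have "x \<noteq> a" "x \<noteq> b" using x ab by auto
  hence r: "r > 0" using r0 by (simp add: r_def)
  have "r \<le> r0" by (simp add: r_def)
  hence rG: "ball x r \<subseteq> - ?G" using r0(2) subset_ball by (meson order_trans)
  have re: "ball x r \<inter> e = {}" by (auto simp: r_def ab)
  define d where "d = b - a"
  \<comment> \<open>\<open>s\<close> is a multiple of the signed distance from the line through the
    bond; \<open>\<tau>\<close>, defined next, is the position along that line, 0 at
    \<open>a\<close> and 1 at \<open>b\<close>.\<close>
  define s where "s y = Im ((y - a) * cnj d)" for y
  define \<tau> where "\<tau> y = Re ((y - a) * cnj d) / (norm d)\<^sup>2" for y
  have d: "d \<noteq> 0" using ab by (simp add: d_def)
  have dd: "d * cnj d = of_real ((norm d)\<^sup>2)" by (simp add: complex_mult_cnj cmod_def)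
  have line: "y - a = of_real (\<tau> y) * d" if "s y = 0" for y
  proof -
    have "(y - a) * cnj d = of_real (Re ((y - a) * cnj d))"
      using that by (simp add: complex_eq_iff s_def)
    hence "(y - a) * (d * cnj d) = of_real (Re ((y - a) * cnj d)) * d" by (metis mult.assoc mult.commute)
    thus ?thesis unfolding dd using d by (simp add: \<tau>_def field_simps)
  qed
  have hull: "y \<in> convex hull e \<longleftrightarrow> s y = 0 \<and> 0 \<le> \<tau> y \<and> \<tau> y \<le> 1" for y
  proof
    assume "y \<in> convex hull e"
    then obtain u where u: "0 \<le> u" "u \<le> 1" "y = (1 - u) *\<^sub>R a + u *\<^sub>R b"
      unfolding ab segment_convex_hull[symmetric] closed_segment_def by auto
    hence "y - a = of_real u * d" by (simp add: d_def algebra_simps scaleR_conv_of_real)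
    hence "(y - a) * cnj d = of_real (u * (norm d)\<^sup>2)" by (simp add: dd mult.assoc)
    thus "s y = 0 \<and> 0 \<le> \<tau> y \<and> \<tau> y \<le> 1" using u d by (simp add: s_def \<tau>_def)
  next
    assume y: "s y = 0 \<and> 0 \<le> \<tau> y \<and> \<tau> y \<le> 1"
    have "y = (1 - \<tau> y) *\<^sub>R a + \<tau> y *\<^sub>R b"
      using line[of y] y by (simp add: d_def algebra_simps scaleR_conv_of_real)
    thus "y \<in> convex hull e"
      using y unfolding ab segment_convex_hull[symmetric] closed_segment_def by blast
  qed
  have in_hull: "y \<in> convex hull e" if "y \<in> ball x r" "s y = 0" for y
  proof -
    have sx: "s x = 0" "0 \<le> \<tau> x" "\<tau> x \<le> 1" using x hull by auto
    have lx: "x - a = of_real (\<tau> x) * d" by (rule line[OF sx(1)])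
    have "x - b = (x - a) - d" by (simp add: d_def)
    hence lx': "x - b = - of_real (1 - \<tau> x) * d" unfolding lx by (simp add: algebra_simps)
    have "x - y = (x - a) - (y - a)" by simp
    hence "x - y = of_real (\<tau> x - \<tau> y) * d"
      unfolding lx line[OF that(2)] by (simp add: algebra_simps)
    hence "\<bar>\<tau> x - \<tau> y\<bar> * norm d < r" using that(1)
      unfolding mem_ball dist_norm by (simp only: norm_mult norm_of_real)
    moreover have "r \<le> \<tau> x * norm d" "r \<le> (1 - \<tau> x) * norm d"
      using sx unfolding r_def dist_norm lx lx' norm_mult norm_minus_cancel norm_of_real by auto
    ultimately have "\<bar>\<tau> x - \<tau> y\<bar> < \<tau> x" "\<bar>\<tau> x - \<tau> y\<bar> < 1 - \<tau> x"
      using d by (meson mult_less_cancel_right_disj norm_ge_zero not_less order_less_le_trans)+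
    thus ?thesis using hull[of y] that(2) by auto
  qed
  define H where "H \<sigma> = ball x r \<inter> {y. 0 < \<sigma> * s y}" for \<sigma> :: real
  have s_lin: "s y = inner y (\<i> * d) - inner a (\<i> * d)" for y
    by (simp add: s_def inner_complex_def algebra_simps)
  have cvx: "convex (H \<sigma>)" for \<sigma>
  proof -
    have eq: "{y. 0 < \<sigma> * s y} = {y. inner (\<sigma> *\<^sub>R (\<i> * d)) y > \<sigma> * inner a (\<i> * d)}"
      by (auto simp: s_lin inner_commute[of _ "\<i> * d"] algebra_simps)
    show ?thesis unfolding H_def eq by (intro convex_Int convex_ball convex_halfspace_gt)
  qed
  have clos: "y \<in> closure (H \<sigma>)" if y: "y \<in> ball x r" "s y = 0" and \<sigma>: "\<sigma> \<noteq> 0" for y \<sigma>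
    unfolding closure_approachable
  proof (intro allI impI)
    fix \<epsilon> :: real assume \<epsilon>: "0 < \<epsilon>"
    obtain \<rho> where \<rho>: "\<rho> > 0" "ball y \<rho> \<subseteq> ball x r" using y(1) openE[OF open_ball] by blast
    \<comment> \<open>The size of a perpendicular step off the line, to the side chosen by the sign
      of \<open>\<sigma>\<close>, that stays within both \<open>\<rho>\<close> and
      \<open>\<epsilon>\<close>.\<close>
    define k where "k = min \<rho> \<epsilon> / 2 / norm (of_real \<sigma> * d)"
    have nz: "norm (of_real \<sigma> * d) > 0" using \<sigma> d by simp
    hence k: "k > 0" "k * norm (of_real \<sigma> * d) < \<rho>" "k * norm (of_real \<sigma> * d) < \<epsilon>"
      using \<rho> \<epsilon> by (auto simp: k_def)
    let ?y = "y + of_real (k * \<sigma>) * (\<i> * d)"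
    have "dist ?y y = k * norm (of_real \<sigma> * d)" using k(1) by (simp add: dist_norm norm_mult)
    moreover have "s ?y = k * \<sigma> * (norm d)\<^sup>2"
    proof -
      have "(?y - a) * cnj d = (y - a) * cnj d + of_real (k * \<sigma>) * \<i> * (d * cnj d)"
        by (simp add: algebra_simps)
      thus ?thesis using y(2) unfolding s_def dd by simp
    qed
    moreover have "0 < \<sigma> * (k * \<sigma> * (norm d)\<^sup>2)"
    proof -
      have "\<sigma> * (k * \<sigma> * (norm d)\<^sup>2) = k * (\<sigma>\<^sup>2 * (norm d)\<^sup>2)" by (simp add: power2_eq_square)
      also have "0 < \<dots>" using k \<sigma> d by simp
      finally show ?thesis .
    qed
    moreover from calculation k have "?y \<in> ball y \<rho>" by (simp only: mem_ball dist_commute)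
    hence "?y \<in> ball x r" using \<rho>(2) by blast
    ultimately have "?y \<in> H \<sigma>" "dist ?y y < \<epsilon>"
      using k unfolding H_def by simp_all
    thus "\<exists>h\<in>H \<sigma>. dist h y < \<epsilon>" by blast
  qed
  show ?thesis
  proof
    show "r > 0" "ball x r \<inter> e = {}" by (rule r re)+
    show "convex (H 1)" "convex (H (- 1))" by (rule cvx)+
    have sx: "x \<in> ball x r" "s x = 0" using x hull r by auto
    show "H 1 \<noteq> {}" "H (- 1) \<noteq> {}" using clos[OF sx, of 1] clos[OF sx, of "- 1"] by auto
    show "ball x r - convex hull e = H 1 \<union> H (- 1)"
      using in_hull hull by (auto simp: H_def) (metis linorder_neqE_linordered_idom)
    thus "H 1 \<subseteq> - graph" "H (- 1) \<subseteq> - graph"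
      using rG by (auto simp: graph_def)
    show "ball x r \<inter> convex hull e \<subseteq> closure (H 1) \<inter> closure (H (- 1))"
      using clos hull by auto
  qed
qed

text \<open>The inner points of the bond that lie in the closure of the face form a relatively
  closed set. It is also open: near such a point the face contains one of the two half discs, and
  the bond lies in the closure of both. So a face that touches one inner point of a bond borders all
  of it.\<close>

lemma frontier_bond:
  assumes F: "F \<in> faces M" and e: "e \<in> bonds M" and x: "x \<in> convex hull e - e" "x \<in> closure F"
  shows "convex hull e \<subseteq> frontier F"
proof -
  obtain a b where ab: "e = {a, b}" "a \<noteq> b" using e by (rule bondE)
  have O: "convex hull e - e = open_segment a b"
    unfolding ab open_segment_def by (simp add: segment_convex_hull)
  have op: "\<exists>r>0. ball y r \<inter> open_segment a b \<subseteq> closure F"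
    if y: "y \<in> open_segment a b" "y \<in> closure F" for y
  proof -
    obtain r H1 H2 where r: "r > 0" "ball y r \<inter> e = {}" "convex H1" "convex H2"
      "ball y r - convex hull e = H1 \<union> H2" "ball y r \<inter> convex hull e \<subseteq> closure H1 \<inter> closure H2"
      "H1 \<subseteq> - graph" "H2 \<subseteq> - graph"
      by (rule bond_nbhd[OF e, of y]) (use y O in auto)
    have "F \<inter> ball y r \<noteq> {}" using closure_meets_ball y(2) r(1) by blast
    hence "F \<inter> H1 \<noteq> {} \<or> F \<inter> H2 \<noteq> {}" using r(5) face_subset[OF F] bond_graph[OF e] by blast
    hence "H1 \<subseteq> F \<or> H2 \<subseteq> F" using face_absorbs[OF F] r convex_connected by metis
    hence "closure H1 \<inter> closure H2 \<subseteq> closure F" using closure_mono by blast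
    thus ?thesis using r(1,6) O by blast
  qed
  have "open_segment a b \<subseteq> closure F"
  proof (rule ccontr)
    assume n: "\<not> open_segment a b \<subseteq> closure F"
    have "openin (top_of_set (open_segment a b)) (open_segment a b \<inter> closure F)"
      unfolding openin_contains_ball using op by (auto simp: Int_commute)
    moreover have "closedin (top_of_set (open_segment a b)) (open_segment a b \<inter> closure F)"
      by (simp add: closedin_closed_Int)
    moreover have "connected (open_segment a b)" by (simp add: convex_connected)
    ultimately have "open_segment a b \<inter> closure F = {} \<or> open_segment a b \<inter> closure F = open_segment a b"
      unfolding connected_clopen by blast
    thus False using n x O by blast
  qed
  hence "closure (open_segment a b) \<subseteq> closure F" by (rule closure_minimal) simp
  hence "convex hull e \<subseteq> closure F" using ab by (simp add: segment_convex_hull[symmetric])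
  thus ?thesis using frontier_face[OF F] bond_graph[OF e] face_subset[OF F] by blast
qed

text \<open>By \<open>frontier_bond\<close> it is enough to look at the midpoint, where each of the
  two half discs belongs to a single face.\<close>

lemma finite_faces_bond:
  assumes e: "e \<in> bonds M"
  shows "finite {F\<in>faces M. convex hull e \<subseteq> frontier F}" "{F\<in>faces M. convex hull e \<subseteq> frontier F} \<noteq> {}"
proof -
  obtain a b where ab: "e = {a, b}" "a \<noteq> b" using e by (rule bondE)
  have x: "midpoint a b \<in> convex hull e - e"
    using ab by (auto simp: segment_convex_hull[symmetric])
  obtain r H1 H2 where r: "r > 0" "convex H1" "convex H2" "H1 \<noteq> {}" "H2 \<noteq> {}"
      "ball (midpoint a b) r - convex hull e = H1 \<union> H2"
      "ball (midpoint a b) r \<inter> convex hull e \<subseteq> closure H1 \<inter> closure H2"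
      "H1 \<subseteq> - graph" "H2 \<subseteq> - graph"
    by (rule bond_nbhd[OF e x])
  obtain F1 F2 where F: "F1 \<in> faces M" "H1 \<subseteq> F1" "F2 \<in> faces M" "H2 \<subseteq> F2"
    using face_exists r convex_connected by metis
  have "F = F1 \<or> F = F2" if "F \<in> faces M" "convex hull e \<subseteq> frontier F" for F
  proof -
    have "midpoint a b \<in> closure F" using that x frontier_face by auto
    hence "F \<inter> ball (midpoint a b) r \<noteq> {}" using closure_meets_ball r(1) by blast
    hence "F \<inter> H1 \<noteq> {} \<or> F \<inter> H2 \<noteq> {}" using r(6) face_subset[OF that(1)] bond_graph[OF e] by blast
    thus ?thesis using F face_eq[OF that(1)] by blast
  qed
  hence "{F\<in>faces M. convex hull e \<subseteq> frontier F} \<subseteq> {F1, F2}" by blast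
  thus "finite {F\<in>faces M. convex hull e \<subseteq> frontier F}" by (rule finite_subset) simp
  have "midpoint a b \<in> ball (midpoint a b) r \<inter> convex hull e" using r(1) x by auto
  hence "midpoint a b \<in> closure F1" using r(7) closure_mono[OF F(2)] by blast
  hence "convex hull e \<subseteq> frontier F1" using frontier_bond[OF F(1) e x] by simp
  thus "{F\<in>faces M. convex hull e \<subseteq> frontier F} \<noteq> {}" using F(1) by blast
qed

lemma connected_not_separated:
  "open W \<Longrightarrow> open U \<Longrightarrow> U \<inter> W = {} \<Longrightarrow> T \<subseteq> U \<union> W \<Longrightarrow> x \<in> U \<Longrightarrow> y \<in> W \<Longrightarrow>
    connected T \<Longrightarrow> x \<in> T \<Longrightarrow> y \<in> T \<Longrightarrow> False"
  using connectedD[of T U W] by blast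

text \<open>The end points of the bonds are left out so that the set is open
  (\<open>open_star\<close>). Pairs of such sets serve as separations in the connectedness arguments
  below.\<close>

definition star :: "complex set set \<Rightarrow> complex set" where
  "star S = (\<Union>e\<in>S. (convex hull e - e) \<union> \<Union>{F\<in>faces M. convex hull e \<subseteq> frontier F})"

lemma open_star:
  assumes "S \<subseteq> bonds M"
  shows "open (star S)"
  unfolding open_contains_ball
proof
  fix x assume "x \<in> star S"
  then obtain e where e: "e \<in> S" "x \<in> convex hull e - e \<or> (\<exists>F\<in>faces M. convex hull e \<subseteq> frontier F \<and> x \<in> F)"
    by (auto simp: star_def)
  hence eb: "e \<in> bonds M" using assms by auto
  show "\<exists>r>0. ball x r \<subseteq> star S"
    using e(2)
  proof
    assume x: "x \<in> convex hull e - e"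
    obtain r H1 H2 where r: "r > 0" "ball x r \<inter> e = {}" "convex H1" "convex H2" "H1 \<noteq> {}" "H2 \<noteq> {}"
        "ball x r - convex hull e = H1 \<union> H2" "ball x r \<inter> convex hull e \<subseteq> closure H1 \<inter> closure H2"
        "H1 \<subseteq> - graph" "H2 \<subseteq> - graph"
      by (rule bond_nbhd[OF eb x])
    obtain F1 F2 where F: "F1 \<in> faces M" "H1 \<subseteq> F1" "F2 \<in> faces M" "H2 \<subseteq> F2"
      using face_exists r convex_connected by metis
    have "x \<in> ball x r \<inter> convex hull e" using r(1) x by auto
    hence "x \<in> closure F1" "x \<in> closure F2"
      using r(8) closure_mono[OF F(2)] closure_mono[OF F(4)] by blast+
    hence "convex hull e \<subseteq> frontier F1" "convex hull e \<subseteq> frontier F2"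
      using frontier_bond eb x F by auto
    hence "F1 \<union> F2 \<union> (convex hull e - e) \<subseteq> star S" using e(1) F by (auto simp: star_def)
    hence "ball x r \<subseteq> star S" using r(2,7) F by blast
    with r(1) show ?thesis by blast
  next
    assume "\<exists>F\<in>faces M. convex hull e \<subseteq> frontier F \<and> x \<in> F"
    then obtain F where F: "F \<in> faces M" "convex hull e \<subseteq> frontier F" "x \<in> F" by blast
    then obtain r where "r > 0" "ball x r \<subseteq> F" using open_face openE by blast
    moreover have "F \<subseteq> star S" using F e(1) by (auto simp: star_def)
    ultimately show ?thesis by blast
  qed
qed

lemma open_faces: "D \<subseteq> faces M \<Longrightarrow> open (\<Union>D)"
  using open_face by blast

definition touching :: "complex set set \<Rightarrow> complex set set" where
  "touching S = {F\<in>faces M. \<exists>e\<in>S. convex hull e \<subseteq> frontier F}"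

lemma star_eq: "star S = (\<Union>e\<in>S. convex hull e - e) \<union> \<Union>(touching S)"
  by (auto simp: star_def touching_def)

lemma bond_interior_disjoint:
  "e \<in> bonds M \<Longrightarrow> f \<in> bonds M \<Longrightarrow> x \<in> convex hull e - e \<Longrightarrow> x \<in> convex hull f - f \<Longrightarrow> e = f"
  using noncrossing by blast

lemma Union_faces_disjoint:
  "C \<subseteq> faces M \<Longrightarrow> D \<subseteq> faces M \<Longrightarrow> C \<inter> D = {} \<Longrightarrow> \<Union>C \<inter> \<Union>D = {}"
  using face_eq by blast

text \<open>Faces avoid the graph while inner points of bonds belong to it, so faces could only meet
  faces, and bonds only bonds.\<close>

lemma star_disjoint:
  assumes "S \<subseteq> bonds M" "T \<subseteq> bonds M" "S \<inter> T = {}"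
    and "C \<subseteq> faces M" "D \<subseteq> faces M" "C \<inter> D = {}"
  shows "((\<Union>e\<in>S. convex hull e - e) \<union> \<Union>C) \<inter> ((\<Union>e\<in>T. convex hull e - e) \<union> \<Union>D) = {}"
proof -
  have "\<Union>C \<inter> \<Union>D = {}" using Union_faces_disjoint assms by blast
  moreover have "(\<Union>e\<in>S. convex hull e - e) \<inter> (\<Union>e\<in>T. convex hull e - e) = {}"
    using bond_interior_disjoint assms(1-3) by blast
  moreover have "\<Union>C \<subseteq> - graph" "\<Union>D \<subseteq> - graph" using face_subset assms(4,5) by blast+
  moreover have "(\<Union>e\<in>S. convex hull e - e) \<subseteq> graph" "(\<Union>e\<in>T. convex hull e - e) \<subseteq> graph"
    using bond_graph assms(1,2) by blast+
  moreover have gen: "C \<inter> D = {} \<Longrightarrow> P \<inter> Q = {} \<Longrightarrow> C \<subseteq> - G \<Longrightarrow> D \<subseteq> - G \<Longrightarrow> P \<subseteq> G \<Longrightarrow> Q \<subseteq> G \<Longrightarrow>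
      (P \<union> C) \<inter> (Q \<union> D) = {}" for P Q C D G :: "complex set"
    by blast
  ultimately show ?thesis by (intro gen)
qed

definition dual_nbr :: "complex set rel" where
  "dual_nbr = {(F, G). F \<in> faces M \<and> G \<in> faces M \<and> (\<exists>e\<in>bonds M. convex hull e \<subseteq> frontier F \<inter> frontier G)}"

text \<open>The plane remains connected when the sites are removed, hence one gets from every face to
  every other one by crossing bonds.\<close>

lemma faces_connected:
  assumes "F \<in> faces M" "G \<in> faces M"
  shows "(F, G) \<in> dual_nbr\<^sup>*"
proof (rule ccontr)
  assume n: "(F, G) \<notin> dual_nbr\<^sup>*"
  define D where "D = {G\<in>faces M. (F, G) \<in> dual_nbr\<^sup>*}"
  define S where "S = {e\<in>bonds M. \<exists>G\<in>D. convex hull e \<subseteq> frontier G}"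
  have tS: "touching S \<subseteq> D"
  proof
    fix H assume "H \<in> touching S"
    then obtain e G where *: "H \<in> faces M" "e \<in> bonds M" "G \<in> D" "convex hull e \<subseteq> frontier G"
      "convex hull e \<subseteq> frontier H" by (auto simp: touching_def S_def)
    hence "(G, H) \<in> dual_nbr" by (auto simp: dual_nbr_def D_def)
    with * show "H \<in> D" by (auto simp: D_def)
  qed
  have tT: "touching (bonds M - S) \<subseteq> faces M - D" by (auto simp: touching_def S_def)
  let ?U = "(\<Union>e\<in>S. convex hull e - e) \<union> \<Union>D"
  let ?W = "(\<Union>e\<in>bonds M - S. convex hull e - e) \<union> \<Union>(faces M - D)"
  have "?U = star S \<union> \<Union>D" "?W = star (bonds M - S) \<union> \<Union>(faces M - D)"
    unfolding star_eq using tS tT by blast+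
  moreover have "open (star S)" "open (star (bonds M - S))"
    by (intro open_star; auto simp: S_def)+
  moreover have "open (\<Union>D)" "open (\<Union>(faces M - D))" by (intro open_faces; auto simp: D_def)+
  ultimately have "open ?U" "open ?W" by (simp_all add: open_Un)
  moreover have "?U \<inter> ?W = {}" by (rule star_disjoint) (auto simp: S_def D_def)
  moreover have "UNIV - sites M \<subseteq> ?U \<union> ?W"
  proof
    fix x assume x: "x \<in> UNIV - sites M"
    show "x \<in> ?U \<union> ?W"
    proof (cases "x \<in> graph")
      case True
      then obtain e where e: "e \<in> bonds M" "x \<in> convex hull e" by (auto simp: graph_def)
      moreover have "e \<subseteq> sites M" using e(1) by (auto elim!: bondE)
      ultimately show ?thesis using x by blast
    next
      case False
      then obtain H where "H \<in> faces M" "x \<in> H" using face_exists[of "{x}"] by auto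
      thus ?thesis by blast
    qed
  qed
  moreover have "connected (UNIV - sites M)"
    using countable_sites by (intro connected_open_diff_countable) auto
  \<comment> \<open>Faces are open, hence uncountable, so each keeps a point outside the countable
    set of sites.\<close>
  moreover have "F - sites M \<noteq> {}" "G - sites M \<noteq> {}"
  proof -
    have "uncountable H" if H: "H \<in> faces M" for H
    proof
      obtain y where "y \<in> H" using face_nonempty[OF H] by blast
      then obtain r where "r > 0" "ball y r \<subseteq> H" by (rule openE[OF open_face[OF H]])
      moreover assume "countable H"
      ultimately show False using uncountable_ball[of r y] countable_subset by blast
    qed
    thus "F - sites M \<noteq> {}" "G - sites M \<noteq> {}"
      using assms countable_sites by (metis Diff_eq_empty_iff countable_subset)+
  qed
  moreover have "F \<in> D" "G \<in> faces M - D" using n assms by (auto simp: D_def)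
  ultimately show False
    using connectedD[of "UNIV - sites M" ?U ?W] by blast
qed

lemma connected_bond_union:
  assumes "X \<subseteq> sites M"
    and conn: "\<And>u v. u \<in> X \<Longrightarrow> v \<in> X \<Longrightarrow> (u, v) \<in> {(x, y). {x, y} \<in> bonds M \<and> x \<in> X \<and> y \<in> X}\<^sup>*"
  shows "connected (X \<union> (\<Union>e\<in>{e\<in>bonds M. e \<subseteq> X}. convex hull e))" (is "connected ?K")
  unfolding connected_iff_connected_component
proof (intro ballI)
  fix x y assume xy: "x \<in> ?K" "y \<in> ?K"
  have edge: "connected_component ?K u p" if "e \<in> bonds M" "e \<subseteq> X" "u \<in> e" "p \<in> convex hull e" for e u p
    unfolding connected_component_def
    by (rule exI[of _ "convex hull e"]) (use that in \<open>auto intro: convex_connected hull_inc\<close>)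
  have site: "connected_component ?K u v" if "u \<in> X" "v \<in> X" for u v
  proof -
    have "(u, v) \<in> {(x, y). {x, y} \<in> bonds M \<and> x \<in> X \<and> y \<in> X}\<^sup>*" by (rule conn) fact+
    thus ?thesis
    proof (induction rule: rtrancl_induct)
      case base show ?case using that(1) by simp
    next
      case (step v w)
      have "connected_component ?K v w"
        by (rule edge[of "{v, w}"]) (use step(2) in \<open>auto intro: hull_inc\<close>)
      with step(3) show ?case by (rule connected_component_trans)
    qed
  qed
  have near: "\<exists>u\<in>X. connected_component ?K u p" if "p \<in> ?K" for p
    using that
  proof
    assume "p \<in> X" thus ?thesis by (auto intro!: bexI[of _ p])
  next
    assume "p \<in> (\<Union>e\<in>{e\<in>bonds M. e \<subseteq> X}. convex hull e)"
    then obtain e where e: "e \<in> bonds M" "e \<subseteq> X" "p \<in> convex hull e" by auto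
    then obtain u v where "e = {u, v}" by (auto elim: bondE)
    with e edge[of e u p] show ?thesis by auto
  qed
  from near[OF xy(1)] near[OF xy(2)] site show "connected_component ?K x y"
    by (meson connected_component_sym connected_component_trans)
qed

text \<open>By Janiszewski's theorem, the midpoints of any two bonds of the cut lie in a connected set
  that is disjoint from the bonds within \<open>A\<close> and from those within \<open>E\<close>. Two classes of bonds
  of the cut without a common face would split this set into two open parts.\<close>

lemma cut_connected:
  assumes AE: "A \<union> E = sites M" "A \<inter> E = {}" "finite A"
    and A: "\<And>u v. u \<in> A \<Longrightarrow> v \<in> A \<Longrightarrow> (u, v) \<in> {(x, y). {x, y} \<in> bonds M \<and> x \<in> A \<and> y \<in> A}\<^sup>*"
    and E: "\<And>u v. u \<in> E \<Longrightarrow> v \<in> E \<Longrightarrow> (u, v) \<in> {(x, y). {x, y} \<in> bonds M \<and> x \<in> E \<and> y \<in> E}\<^sup>*"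
    and bdry: "bdry = {e\<in>bonds M. e \<inter> A \<noteq> {} \<and> e \<inter> E \<noteq> {}}"
    and e12: "e1 \<in> bdry" "e2 \<in> bdry"
  shows "(e1, e2) \<in> {(e, f). e \<in> bdry \<and> f \<in> bdry \<and>
    (\<exists>F\<in>faces M. convex hull e \<subseteq> frontier F \<and> convex hull f \<subseteq> frontier F)}\<^sup>*" (is "_ \<in> ?R\<^sup>*")
proof (rule ccontr)
  assume n: "(e1, e2) \<notin> ?R\<^sup>*"
  \<comment> \<open>The two sides of the cut as subsets of the plane; the bonds of the cut belong to
    neither.\<close>
  define KA where "KA = A \<union> (\<Union>e\<in>{e\<in>bonds M. e \<subseteq> A}. convex hull e)"
  define KE where "KE = E \<union> (\<Union>e\<in>{e\<in>bonds M. e \<subseteq> E}. convex hull e)"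
  have sub: "A \<subseteq> sites M" "E \<subseteq> sites M" using AE by auto
  have conn: "connected KA" "connected KE"
    unfolding KA_def KE_def using A E sub by (intro connected_bond_union; simp)+
  have "closed KE" unfolding KE_def using sub by (intro closed_Un closed_sites closed_bonds) auto
  have fin: "finite {e\<in>bonds M. e \<subseteq> A}" using AE(3) by (intro finite_subset[OF _ finite_Pow_iff[THEN iffD2]]) auto
  have "compact KA" unfolding KA_def
    using compact_hull_bond
    by (intro compact_Un compact_UN[OF fin] finite_imp_compact[OF AE(3)]) blast
  have disj: "KA \<inter> KE = {}"
  proof -
    have 1: "v \<notin> convex hull f" if "v \<in> A" "f \<in> bonds M" "f \<subseteq> E" for v f
      using site_on_bond[of v f] that sub AE(2) by blast
    have 2: "v \<notin> convex hull f" if "v \<in> E" "f \<in> bonds M" "f \<subseteq> A" for v f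
      using site_on_bond[of v f] that sub AE(2) by blast
    have 3: "convex hull e \<inter> convex hull f = {}" if "e \<in> bonds M" "f \<in> bonds M" "e \<subseteq> A" "f \<subseteq> E" for e f
    proof -
      have "e \<noteq> {}" using that(1) by (auto elim: bondE)
      hence "e \<noteq> f" using that AE(2) by blast
      thus ?thesis using noncrossing[OF that(1,2)] that AE(2) by blast
    qed
    show ?thesis unfolding KA_def KE_def using 1 2 3 AE(2) by blast
  qed
  have ends: "\<exists>a b. e = {a, b} \<and> a \<in> A \<and> b \<in> E" if "e \<in> bdry" for e
  proof -
    have "e \<in> bonds M" "e \<inter> A \<noteq> {}" "e \<inter> E \<noteq> {}" using that bdry by auto
    thus ?thesis using AE(2) by (auto elim!: bondE)
  qed
  obtain a1 b1 where ab1: "e1 = {a1, b1}" "a1 \<in> A" "b1 \<in> E" using ends e12 by blast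
  obtain a2 b2 where ab2: "e2 = {a2, b2}" "a2 \<in> A" "b2 \<in> E" using ends e12 by blast
  have mid: "midpoint a b \<in> convex hull {a, b} - {a, b}" if "a \<in> A" "b \<in> E" for a b
    using that AE(2) by (auto simp: segment_convex_hull[symmetric])
  have avoid: "convex hull {a, b} \<inter> KA \<subseteq> {a}" "convex hull {a, b} \<inter> KE \<subseteq> {b}"
    if "{a, b} \<in> bonds M" "a \<in> A" "b \<in> E" for a b
  proof -
    have s: "convex hull {a, b} \<inter> sites M \<subseteq> {a, b}" using site_on_bond that(1) by blast
    have h: "convex hull {a, b} \<inter> convex hull f \<subseteq> {a, b} \<inter> f"
      if "f \<in> bonds M" "f \<subseteq> A \<or> f \<subseteq> E" for f
      using noncrossing[of "{a, b}" f] that \<open>a \<in> A\<close> \<open>b \<in> E\<close> \<open>{a, b} \<in> bonds M\<close> AE(2) by blast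
    show "convex hull {a, b} \<inter> KA \<subseteq> {a}"
      unfolding KA_def using s h sub \<open>b \<in> E\<close> AE(2) by blast
    show "convex hull {a, b} \<inter> KE \<subseteq> {b}"
      unfolding KE_def using s h sub \<open>a \<in> A\<close> AE(2) by blast
  qed
  let ?x1 = "midpoint a1 b1" and ?x2 = "midpoint a2 b2"
  \<comment> \<open>Half of a cut bond leads from its midpoint to one side of the cut without
    touching the other side.\<close>
  have half: "closed_segment (midpoint a b) b \<subseteq> convex hull {a, b} - {a}"
    "closed_segment (midpoint a b) a \<subseteq> convex hull {a, b} - {b}" if "a \<noteq> b" for a b :: complex
  proof -
    have 1: "closed_segment (midpoint a b) b \<subseteq> closed_segment a b - {a}" if "a \<noteq> b" for a b :: complex
    proof -
      have "closed_segment (midpoint a b) b \<subseteq> closed_segment a b" by (intro subset_closed_segment[THEN iffD2]) auto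
      moreover have "a \<notin> closed_segment (midpoint a b) b"
      proof
        assume "a \<in> closed_segment (midpoint a b) b"
        hence "dist (midpoint a b) b = dist (midpoint a b) a + dist a b"
          by (metis between between_mem_segment)
        thus False using that by (simp add: dist_midpoint dist_commute)
      qed
      ultimately show ?thesis by blast
    qed
    show "closed_segment (midpoint a b) b \<subseteq> convex hull {a, b} - {a}"
      using 1[OF that] by (simp add: segment_convex_hull)
    show "closed_segment (midpoint a b) a \<subseteq> convex hull {a, b} - {b}"
      using 1[of b a] that by (simp add: segment_convex_hull midpoint_sym insert_commute)
  qed
  have b12: "{a1, b1} \<in> bonds M" "{a2, b2} \<in> bonds M" "a1 \<noteq> b1" "a2 \<noteq> b2"
    using ab1 ab2 e12 bdry AE(2) by auto
  \<comment> \<open>The midpoints are joined by two half bonds and one side of the cut, once through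
    each side. These are the two hypotheses of Janiszewski's theorem.\<close>
  have "connected_component (- KA) ?x1 ?x2"
    unfolding connected_component_def
  proof (rule exI[of _ "(closed_segment ?x1 b1 \<union> KE) \<union> closed_segment ?x2 b2"], intro conjI)
    show "connected (closed_segment ?x1 b1 \<union> KE \<union> closed_segment ?x2 b2)"
      using conn(2) ab1 ab2 by (intro connected_Un connected_segment) (auto simp: KE_def)
    show "closed_segment ?x1 b1 \<union> KE \<union> closed_segment ?x2 b2 \<subseteq> - KA"
      using disj avoid(1)[OF b12(1) ab1(2,3)] avoid(1)[OF b12(2) ab2(2,3)] half(1)[OF b12(3)] half(1)[OF b12(4)] by blast
  qed auto
  moreover have "connected_component (- KE) ?x1 ?x2"
    unfolding connected_component_def
  proof (rule exI[of _ "(closed_segment ?x1 a1 \<union> KA) \<union> closed_segment ?x2 a2"], intro conjI)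
    show "connected (closed_segment ?x1 a1 \<union> KA \<union> closed_segment ?x2 a2)"
      using conn(1) ab1 ab2 by (intro connected_Un connected_segment) (auto simp: KA_def)
    show "closed_segment ?x1 a1 \<union> KA \<union> closed_segment ?x2 a2 \<subseteq> - KE"
      using disj avoid(2)[OF b12(1) ab1(2,3)] avoid(2)[OF b12(2) ab2(2,3)] half(2)[OF b12(3)] half(2)[OF b12(4)] by blast
  qed auto
  ultimately have "connected_component (- (KA \<union> KE)) ?x1 ?x2"
    using \<open>compact KA\<close> \<open>closed KE\<close> disj by (intro Janiszewski) auto
  then obtain T where T: "connected T" "T \<subseteq> - (KA \<union> KE)" "?x1 \<in> T" "?x2 \<in> T"
    unfolding connected_component_def by blast
  define S where "S = {f\<in>bdry. (e1, f) \<in> ?R\<^sup>*}"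
  have cutb: "bdry \<subseteq> bonds M" by (auto simp: bdry)
  have Sb: "S \<subseteq> bonds M" "bdry - S \<subseteq> bonds M" using cutb by (auto simp: S_def)
  have tt: "touching (bdry - S) \<inter> touching S = {}"
  proof (rule ccontr)
    assume "touching (bdry - S) \<inter> touching S \<noteq> {}"
    then obtain F e f where *: "F \<in> faces M" "f \<in> bdry" "f \<notin> S" "e \<in> S" "convex hull e \<subseteq> frontier F"
      "convex hull f \<subseteq> frontier F" by (auto simp: touching_def)
    hence "(e, f) \<in> ?R" by (auto simp: S_def)
    moreover have "(e1, e) \<in> ?R\<^sup>*" using *(4) by (simp add: S_def)
    ultimately have "(e1, f) \<in> ?R\<^sup>*" by (rule rtrancl_into_rtrancl[rotated])
    thus False using * by (simp add: S_def)
  qed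
  let ?U = "(\<Union>e\<in>S. convex hull e - e) \<union> \<Union>(touching S)"
  let ?W = "(\<Union>e\<in>bdry - S. convex hull e - e) \<union> \<Union>(faces M - touching S)"
  have "touching (bdry - S) \<subseteq> faces M" by (auto simp: touching_def)
  hence "touching (bdry - S) \<subseteq> faces M - touching S" using tt by blast
  hence "?W = star (bdry - S) \<union> \<Union>(faces M - touching S)"
    unfolding star_eq by blast
  hence "open ?W" using open_star[OF Sb(2)] open_faces[of "faces M - touching S"] by (simp add: open_Un)
  moreover have "open ?U" using open_star[OF Sb(1)] by (simp add: star_eq)
  moreover have "?U \<inter> ?W = {}" using Sb by (intro star_disjoint) (auto simp: touching_def)
  moreover have "T \<subseteq> ?U \<union> ?W"
  proof
    fix x assume "x \<in> T"
    hence x: "x \<notin> KA" "x \<notin> KE" using T(2) by auto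
    show "x \<in> ?U \<union> ?W"
    proof (cases "x \<in> graph")
      case True
      then obtain e where e: "e \<in> bonds M" "x \<in> convex hull e" by (auto simp: graph_def)
      then obtain u v where uv: "e = {u, v}" "u \<in> sites M" "v \<in> sites M" by (auto elim: bondE)
      have "\<not> e \<subseteq> A" "\<not> e \<subseteq> E" using x e by (auto simp: KA_def KE_def)
      hence "e \<in> bdry" using uv AE(1) e(1) by (auto simp: bdry)
      moreover have "x \<notin> e" using x uv AE(1) by (auto simp: KA_def KE_def)
      ultimately show ?thesis using e(2) by blast
    next
      case False
      then obtain H where "H \<in> faces M" "x \<in> H" using face_exists[of "{x}"] by auto
      thus ?thesis by blast
    qed
  qed
  moreover have "?x1 \<in> ?U"
  proof -
    have "e1 \<in> S" using e12(1) by (simp add: S_def)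
    thus ?thesis using mid[OF ab1(2,3)] unfolding ab1(1)[symmetric] by (intro UnI1 UN_I)
  qed
  moreover have "?x2 \<in> ?W"
  proof -
    have "e2 \<in> bdry - S" using e12(2) n unfolding S_def by simp
    thus ?thesis using mid[OF ab2(2,3)] unfolding ab2(1)[symmetric] by (intro UnI1 UN_I)
  qed
  ultimately show False by (rule connected_not_separated) (rule T)+
qed

end


section \<open>Boundedness of the faces\<close>

text \<open>Both curves are prolonged to the boundary of a large box, \<open>\<gamma>\<close>
  horizontally and \<open>q\<close> vertically, and the Fashoda meet theorem applies. The bounds on
  the two curves keep the meeting point off the prolongations.\<close>

lemma strip_crossing:
  fixes \<gamma> q :: "real \<Rightarrow> real ^ 2"
  assumes \<gamma>: "path \<gamma>" "pathstart \<gamma> = vector [- n, m]" "pathfinish \<gamma> = vector [n, m]"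
    "\<And>z. z \<in> path_image \<gamma> \<Longrightarrow> \<bar>z $ 2 - m\<bar> \<le> D"
    and q: "path q" "\<And>z. z \<in> path_image q \<Longrightarrow> \<bar>z $ 1\<bar> < n"
    "pathstart q $ 2 < m - D" "pathfinish q $ 2 > m + D"
  shows "path_image \<gamma> \<inter> path_image q \<noteq> {}"
proof -
  have "bounded (path_image \<gamma> \<union> path_image q)" using \<gamma>(1) q(1) by (simp add: bounded_path_image)
  then obtain N0 where N0: "\<And>z. z \<in> path_image \<gamma> \<union> path_image q \<Longrightarrow> norm z \<le> N0"
    unfolding bounded_iff by blast
  define N where "N = max N0 (max n \<bar>m\<bar>)"
  have N: "\<bar>z $ 1\<bar> \<le> N" "\<bar>z $ 2\<bar> \<le> N" if "z \<in> path_image \<gamma> \<union> path_image q" for z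
    using N0[OF that] component_le_norm_cart[of z 1] component_le_norm_cart[of z 2] by (auto simp: N_def)
  have n0: "0 < n" using q(2)[OF pathstart_in_path_image] by (smt (verit))
  have D0: "0 \<le> D" using \<gamma>(4)[OF pathstart_in_path_image] by (smt (verit))
  define x0 x1 where "x0 = pathstart q" and "x1 = pathfinish q"
  have x01: "\<bar>x0 $ 1\<bar> < n" "\<bar>x1 $ 1\<bar> < n" using q(2) by (auto simp: x0_def x1_def)
  let ?v = "\<lambda>x y. vector [x, y] :: real ^ 2"
  define f where "f = linepath (?v (- N) m) (?v (- n) m) +++ \<gamma> +++ linepath (?v n m) (?v N m)"
  define h where "h = linepath (?v (x0 $ 1) (- N)) x0 +++ q +++ linepath x1 (?v (x1 $ 1) N)"
  have seg1: "z $ 2 = m \<and> a \<le> z $ 1 \<and> z $ 1 \<le> b" if z: "z \<in> closed_segment (?v a m) (?v b m)" and ab: "a \<le> b" for z a b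
  proof -
    obtain u where u: "0 \<le> u" "u \<le> 1" "z = (1 - u) *\<^sub>R ?v a m + u *\<^sub>R ?v b m"
      using z unfolding closed_segment_def by auto
    have "z $ 1 = a + u * (b - a)" "z $ 1 = b - (1 - u) * (b - a)" by (simp_all add: u(3) algebra_simps)
    moreover have "0 \<le> u * (b - a)" "0 \<le> (1 - u) * (b - a)" using u ab by auto
    ultimately show ?thesis by (simp add: u(3) algebra_simps)
  qed
  have seg2: "z $ 1 = x $ 1 \<and> min (x $ 2) c \<le> z $ 2 \<and> z $ 2 \<le> max (x $ 2) c"
    if z: "z \<in> closed_segment x (?v (x $ 1) c)" for z x c
  proof -
    obtain u where u: "0 \<le> u" "u \<le> 1" "z = (1 - u) *\<^sub>R x + u *\<^sub>R ?v (x $ 1) c"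
      using z unfolding closed_segment_def by auto
    have "z $ 2 = (1 - u) * x $ 2 + u * c" by (simp add: u(3))
    moreover have "(1 - u) * min (x $ 2) c + u * min (x $ 2) c \<le> (1 - u) * x $ 2 + u * c"
      "(1 - u) * x $ 2 + u * c \<le> (1 - u) * max (x $ 2) c + u * max (x $ 2) c"
      using u by (intro add_mono mult_left_mono; simp)+
    ultimately show ?thesis by (simp add: u(3) algebra_simps)
  qed
  have pf: "path f" "path h" using \<gamma>(1-3) q(1) by (auto simp: f_def h_def x0_def x1_def)
  have If: "path_image f = closed_segment (?v (- N) m) (?v (- n) m) \<union> (path_image \<gamma> \<union> closed_segment (?v n m) (?v N m))"
    unfolding f_def using \<gamma>(2,3) by (simp add: path_image_join)
  have Ih: "path_image h = closed_segment x0 (?v (x0 $ 1) (- N)) \<union> (path_image q \<union> closed_segment x1 (?v (x1 $ 1) N))"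
    unfolding h_def using closed_segment_commute by (simp add: path_image_join x0_def x1_def) blast
  have nN: "n \<le> N" "\<bar>m\<bar> \<le> N" by (auto simp: N_def)
  have x2: "\<bar>x0 $ 2\<bar> \<le> N" "\<bar>x1 $ 2\<bar> \<le> N" using N by (auto simp: x0_def x1_def)
  have box: "z \<in> cbox (?v (- N) (- N)) (?v N N) \<longleftrightarrow> \<bar>z $ 1\<bar> \<le> N \<and> \<bar>z $ 2\<bar> \<le> N" for z
    by (auto simp: mem_box_cart forall_2)
  have fbox: "path_image f \<subseteq> cbox (?v (- N) (- N)) (?v N N)"
  proof
    fix z assume "z \<in> path_image f"
    thus "z \<in> cbox (?v (- N) (- N)) (?v N N)"
      unfolding If box using seg1[of z "- N" "- n"] seg1[of z n N] N[of z] nN n0 by auto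
  qed
  have hbox: "path_image h \<subseteq> cbox (?v (- N) (- N)) (?v N N)"
  proof
    fix z assume "z \<in> path_image h"
    thus "z \<in> cbox (?v (- N) (- N)) (?v N N)"
      unfolding Ih box using seg2[of z x0 "- N"] seg2[of z x1 N] N[of z] nN n0 x01 x2 by auto
  qed
  obtain z where z: "z \<in> path_image f" "z \<in> path_image h"
    by (rule fashoda[OF pf fbox hbox]) (auto simp: f_def h_def)
  have y: "x0 $ 2 < m - D" "x1 $ 2 > m + D" using q by (auto simp: x0_def x1_def)
  have z1: "\<bar>z $ 1\<bar> < n"
    using z(2) q(2)[of z] x01 seg2[of z x0 "- N"] seg2[of z x1 N] unfolding Ih by auto
  hence z\<gamma>: "z \<in> path_image \<gamma>"
    using z(1) seg1[of z "- N" "- n"] seg1[of z n N] nN unfolding If by auto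
  have "z \<in> path_image q"
    using z(2) \<gamma>(4)[OF z\<gamma>] seg2[of z x0 "- N"] seg2[of z x1 N] y x2 D0 nN unfolding Ih by auto
  thus ?thesis using z\<gamma> by blast
qed

context lattice begin

lemma graph_translate: "t \<in> trans \<Longrightarrow> (+) t ` graph = graph"
proof -
  assume t: "t \<in> trans"
  have "(+) t ` graph = (\<Union>e\<in>(`) ((+) t) ` bonds M. convex hull e)"
    by (auto simp: graph_def convex_hull_translation image_UN)
  thus ?thesis by (simp add: graph_def trans_bonds[OF t])
qed

lemma face_translate:
  assumes t: "t \<in> trans" and F: "F \<in> faces M"
  shows "(+) t ` F \<in> faces M"
proof -
  have sub: "\<exists>G\<in>faces M. (+) s ` F' \<subseteq> G" if "s \<in> trans" "F' \<in> faces M" for s F'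
  proof (rule face_exists)
    show "connected ((+) s ` F')" using face_connected[OF that(2)]
      by (rule connected_continuous_image[rotated]) (intro continuous_intros)
    show "(+) s ` F' \<noteq> {}" using face_nonempty[OF that(2)] by simp
    have "(+) s ` F' \<inter> (+) s ` graph = (+) s ` (F' \<inter> graph)" by (rule image_Int[symmetric]) simp
    thus "(+) s ` F' \<subseteq> - graph" using face_subset[OF that(2)] graph_translate[OF that(1)] by auto
  qed
  obtain G where G: "G \<in> faces M" "(+) t ` F \<subseteq> G" using sub[OF t F] by blast
  obtain F' where F': "F' \<in> faces M" "(+) (- t) ` G \<subseteq> F'" using sub[OF trans_minus[OF t] G(1)] by blast
  have "(+) (- t) ` (+) t ` F \<subseteq> F'" using G(2) F'(2) by blast
  hence "F \<subseteq> F'" by (simp add: image_image)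
  hence "F = F'" using face_eq[OF F F'(1)] face_nonempty[OF F] by blast
  hence "(+) t ` (+) (- t) ` G \<subseteq> (+) t ` F" using F'(2) by blast
  hence "G \<subseteq> (+) t ` F" by (simp add: image_image)
  thus ?thesis using G by (metis subset_antisym)
qed

lemma path_component_graph:
  assumes "u \<in> sites M" "v \<in> sites M"
  shows "path_component graph u v"
proof -
  have edge: "path_component graph x y" if "{x, y} \<in> bonds M" for x y
    unfolding path_component_def
    by (rule exI[of _ "linepath x y"])
      (use bond_graph[OF that] in \<open>simp add: segment_convex_hull\<close>)
  obtain w where w: "{u, w} \<in> bonds M"
  proof -
    have "(u, lat 1 0 + u) \<in> {(x, y). {x, y} \<in> bonds M}\<^sup>*" using assms by (intro sites_connected site_add) auto
    moreover have "u \<noteq> lat 1 0 + u" using coord_lat(1)[of 1 0] by (auto simp del: coord_lat)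
    ultimately have "\<exists>y. (u, y) \<in> {(x, y). {x, y} \<in> bonds M}" by (metis converse_rtranclE)
    thus ?thesis using that by blast
  qed
  show ?thesis using sites_connected[OF assms]
  proof (induction rule: rtrancl_induct)
    case base
    have "u \<in> graph" using bond_graph[OF w] hull_inc[of u "{u, w}"] by auto
    thus ?case by (rule path_component_refl)
  next
    case (step y z)
    from path_component_trans[OF step(3) edge] step(2) show ?case by simp
  qed
qed

text \<open>A path in the graph from the origin to its translate by one period, repeated
  periodically and shifted up by \<open>m\<close> periods, is a barrier that no path inside a face
  can cross. \<open>f\<close> and \<open>g\<close> stand for the two coordinates in either order,
  \<open>g\<close> also with the opposite sign, so that all four directions are covered.\<close>

lemma face_strip:
  fixes f g :: "complex \<Rightarrow> real" and s r :: complex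
  assumes f: "\<And>x y. f (x + y) = f x + f y" "continuous_on UNIV f"
    and g: "\<And>x y. g (x + y) = g x + g y" "continuous_on UNIV g"
    and inj: "\<And>x y. f x = f y \<Longrightarrow> g x = g y \<Longrightarrow> x = y"
    and s: "s \<in> trans" "f s = 1" "g s = 0"
    and r: "r \<in> trans" "f r = 0" "g r = 1"
    and F: "F \<in> faces M"
  shows "\<exists>B. \<forall>z\<in>F. g z \<le> B"
proof -
  obtain p where p: "path p" "path_image p \<subseteq> graph" "pathstart p = 0" "pathfinish p = s"
    using path_component_graph[OF zero_site trans_site[OF s(1)]] unfolding path_component_def by blast
  have "compact ((\<lambda>z. \<bar>g z\<bar>) ` path_image p)"
    using p(1) continuous_on_subset[OF g(2)] by (intro compact_continuous_image continuous_intros compact_path_image) auto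
  then obtain D where D: "\<And>z. z \<in> path_image p \<Longrightarrow> \<bar>g z\<bar> \<le> D"
    using bounded_imp_bdd_above[OF compact_imp_bounded] unfolding bdd_above_def by fastforce
  obtain x where x: "x \<in> F" using face_nonempty[OF F] by blast
  \<comment> \<open>High enough for the whole barrier, which deviates from its level by at most
    \<open>D\<close>, to pass above the chosen point \<open>x\<close> of the face.\<close>
  define m where "m = nat \<lceil>\<bar>g x\<bar> + D + 1\<rceil>"
  have m: "g x < real m - D" unfolding m_def by linarith
  have f0: "f 0 = 0" "g 0 = 0" using f(1)[of 0 0] g(1)[of 0 0] by auto
  have fn: "f (of_nat k * s) = real k" "g (of_nat k * s) = 0" "f (of_nat k * r) = 0" "g (of_nat k * r) = real k" for k
    by (induction k) (auto simp: f0 f(1) g(1) s r algebra_simps)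
  have neg: "f (- z) = - f z" "g (- z) = - g z" for z
    using f(1)[of z "- z"] g(1)[of z "- z"] f0 by auto
  have diff: "f (y - z) = f y - f z" "g (y - z) = g y - g z" for y z
    using f(1)[of y "- z"] g(1)[of y "- z"] neg by auto
  define G where "G = graph \<inter> {z. \<bar>g z - real m\<bar> \<le> D}"
  have step: "path_component G (t + of_nat m * r) (t + s + of_nat m * r)" if t: "t \<in> trans" "g t = 0" for t
    unfolding path_component_def
  proof (rule exI[of _ "(+) (t + of_nat m * r) \<circ> p"], intro conjI)
    let ?t = "t + of_nat m * r"
    have tt: "?t \<in> trans" using t r by (intro trans_add trans_mult)
    show "path ((+) ?t \<circ> p)" using p(1) by (rule path_continuous_image) (intro continuous_intros)
    have "(+) ?t ` path_image p \<subseteq> graph" using graph_translate[OF tt] p(2) by blast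
    moreover have "\<bar>g (?t + z) - real m\<bar> \<le> D" if "z \<in> path_image p" for z
      using D[OF that] t(2) by (simp add: g(1) fn)
    ultimately show "path_image ((+) ?t \<circ> p) \<subseteq> G" by (auto simp: G_def path_image_compose)
    show "pathstart ((+) ?t \<circ> p) = ?t" "pathfinish ((+) ?t \<circ> p) = t + s + of_nat m * r"
      by (simp_all add: pathstart_compose pathfinish_compose p)
  qed
  have row: "path_component G (t + of_nat m * r) (t + of_nat k * s + of_nat m * r)" if t: "t \<in> trans" "g t = 0" for t k
  proof (induction k)
    case 0
    have "t + of_nat m * r \<in> G" using path_component_mem(1)[OF step[OF t]] .
    thus ?case by (simp add: path_component_refl)
  next
    case (Suc k)
    have "t + of_nat k * s \<in> trans" "g (t + of_nat k * s) = 0"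
      using t s by (auto simp: g(1) fn intro: trans_add trans_mult)
    from path_component_trans[OF Suc step[OF this]] show ?case by (simp add: algebra_simps)
  qed
  show ?thesis
  proof (intro exI[of _ "real m + D"] ballI, rule ccontr)
    fix y assume y: "y \<in> F" "\<not> g y \<le> real m + D"
    have "path_connected F" using face_connected[OF F] open_face[OF F] by (simp add: connected_open_path_connected)
    then obtain q where q: "path q" "path_image q \<subseteq> F" "pathstart q = x" "pathfinish q = y"
      using x y unfolding path_connected_def by blast
    have "compact ((\<lambda>z. \<bar>f z\<bar>) ` path_image q)"
      using q(1) continuous_on_subset[OF f(2)] by (intro compact_continuous_image continuous_intros compact_path_image) auto
    then obtain B where B: "\<And>z. z \<in> path_image q \<Longrightarrow> \<bar>f z\<bar> \<le> B"
      using bounded_imp_bdd_above[OF compact_imp_bounded] unfolding bdd_above_def by fastforce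
    \<comment> \<open>The barrier is made longer than the extent of \<open>q\<close> along
      \<open>f\<close>, so that \<open>q\<close> cannot get around its ends.\<close>
    define n where "n = nat \<lceil>\<bar>B\<bar> + 1\<rceil>"
    have n: "B < real n" unfolding n_def by linarith
    have "- (of_nat n * s) \<in> trans" using s by (intro trans_minus trans_mult)
    moreover have "g (- (of_nat n * s)) = 0" by (simp add: neg fn)
    ultimately have "path_component G (- (of_nat n * s) + of_nat m * r)
        (- (of_nat n * s) + of_nat (2 * n) * s + of_nat m * r)" by (rule row)
    moreover have "- (of_nat n * s) + of_nat (2 * n) * s + of_nat m * r = of_nat n * s + of_nat m * r"
      by (simp add: algebra_simps)
    ultimately obtain \<gamma> where \<gamma>: "path \<gamma>" "path_image \<gamma> \<subseteq> G"
      "pathstart \<gamma> = - (of_nat n * s) + of_nat m * r" "pathfinish \<gamma> = of_nat n * s + of_nat m * r"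
      unfolding path_component_def by auto
    define \<phi> where "\<phi> z = (vector [f z, g z] :: real ^ 2)" for z
    have \<phi>: "continuous_on A \<phi>" for A
    proof -
      have "\<phi> = (\<lambda>z. f z *\<^sub>R axis 1 1 + g z *\<^sub>R axis 2 1)"
        by (simp add: \<phi>_def fun_eq_iff vec_eq_iff forall_2 axis_def)
      thus ?thesis using continuous_on_subset[OF f(2)] continuous_on_subset[OF g(2)]
        by (auto intro!: continuous_intros)
    qed
    have "path_image (\<phi> \<circ> \<gamma>) \<inter> path_image (\<phi> \<circ> q) \<noteq> {}"
    proof (rule strip_crossing[where n = "real n" and m = "real m" and D = D])
      show "path (\<phi> \<circ> \<gamma>)" "path (\<phi> \<circ> q)" using \<gamma>(1) q(1) \<phi> by (auto intro: path_continuous_image)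
      show "pathstart (\<phi> \<circ> \<gamma>) = vector [- real n, real m]" "pathfinish (\<phi> \<circ> \<gamma>) = vector [real n, real m]"
        by (simp_all add: pathstart_compose pathfinish_compose \<gamma> \<phi>_def f(1) g(1) neg diff fn)
      show "\<bar>z $ 2 - real m\<bar> \<le> D" if "z \<in> path_image (\<phi> \<circ> \<gamma>)" for z
        using that \<gamma>(2) by (auto simp: path_image_compose \<phi>_def G_def)
      show "\<bar>z $ 1\<bar> < real n" if "z \<in> path_image (\<phi> \<circ> q)" for z
        using that B n by (fastforce simp: path_image_compose \<phi>_def)
      show "pathstart (\<phi> \<circ> q) $ 2 < real m - D" "real m + D < pathfinish (\<phi> \<circ> q) $ 2"
        using m y by (simp_all add: pathstart_compose pathfinish_compose q \<phi>_def)
    qed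
    then obtain a b where ab: "a \<in> path_image \<gamma>" "b \<in> path_image q" "\<phi> a = \<phi> b"
      by (auto simp: path_image_compose)
    have "f a = f b" "g a = g b" using arg_cong[OF ab(3), of "\<lambda>v. v $ 1"] arg_cong[OF ab(3), of "\<lambda>v. v $ 2"]
      by (simp_all add: \<phi>_def)
    hence "a = b" by (rule inj)
    thus False using ab \<gamma>(2) q(2) face_subset[OF F] by (auto simp: G_def)
  qed
qed

text \<open>It makes the positions of faces meaningful: a bounded face has finitely many corners,
  whereas the centroid of an infinite set is the default value 0 and would not move under
  translations.\<close>

lemma bounded_face:
  assumes F: "F \<in> faces M"
  shows "bounded F"
proof -
  have inj: "x = y" if "coord1 M x = coord1 M y" "coord2 M x = coord2 M y" for x y
    using decompose[of x] decompose[of y] that by simp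
  have "\<exists>B. \<forall>z\<in>F. coord2 M z \<le> B"
    by (rule face_strip[of "coord1 M" "coord2 M" "lat 1 0" "lat 0 1"])
      (auto simp: coord_add continuous_coord F inj)
  moreover have "\<exists>B. \<forall>z\<in>F. - coord2 M z \<le> B"
    by (rule face_strip[of "coord1 M" "\<lambda>z. - coord2 M z" "lat 1 0" "lat 0 (-1)"])
      (auto simp: coord_add continuous_coord F inj intro!: continuous_intros)
  moreover have "\<exists>B. \<forall>z\<in>F. coord1 M z \<le> B"
    by (rule face_strip[of "coord2 M" "coord1 M" "lat 0 1" "lat 1 0"])
      (auto simp: coord_add continuous_coord F inj)
  moreover have "\<exists>B. \<forall>z\<in>F. - coord1 M z \<le> B"
    by (rule face_strip[of "coord2 M" "\<lambda>z. - coord1 M z" "lat 0 1" "lat (-1) 0"])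
      (auto simp: coord_add continuous_coord F inj intro!: continuous_intros)
  ultimately obtain B1 B2 B3 B4 where B: "\<And>z. z \<in> F \<Longrightarrow> coord2 M z \<le> B1" "\<And>z. z \<in> F \<Longrightarrow> - coord2 M z \<le> B2"
    "\<And>z. z \<in> F \<Longrightarrow> coord1 M z \<le> B3" "\<And>z. z \<in> F \<Longrightarrow> - coord1 M z \<le> B4" by metis
  have "norm z \<le> 2 * (\<bar>B1\<bar> + \<bar>B2\<bar> + \<bar>B3\<bar> + \<bar>B4\<bar>)" if "z \<in> F" for z
    using norm_le_lnorm[of z] B[OF that] by (auto simp: lnorm_def)
  thus ?thesis unfolding bounded_iff by blast
qed

text \<open>Some face has a bond on its frontier, and every other face is linked to that one by
  crossing bonds.\<close>

lemma face_has_bond: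
  assumes "F \<in> faces M"
  obtains e where "e \<in> bonds M" "convex hull e \<subseteq> frontier F"
proof -
  have "path_component graph 0 (lat 1 0)" using zero_site trans_site by (intro path_component_graph) auto
  hence "graph \<noteq> {}" using path_component_mem(1) by blast
  then obtain e G where e: "e \<in> bonds M" "G \<in> faces M" "convex hull e \<subseteq> frontier G"
    using finite_faces_bond(2) by (fastforce simp: graph_def)
  have "(F, G) \<in> dual_nbr\<^sup>*" by (rule faces_connected[OF assms e(2)])
  thus ?thesis
  proof (cases rule: converse_rtranclE)
    case base thus ?thesis using e that by blast
  next
    case (step H)
    thus ?thesis using that by (auto simp: dual_nbr_def)
  qed
qed

end


section \<open>Translations, and connections in the dual model\<close>

lemma rtrancl_image:
  assumes "(x, y) \<in> R\<^sup>*" "\<And>x y. (x, y) \<in> R \<Longrightarrow> (f x, f y) \<in> S"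
  shows "(f x, f y) \<in> S\<^sup>*"
  using assms(1) by induction (auto intro: rtrancl_into_rtrancl assms(2))

context lattice begin

lemma dual_sites_translate:
  assumes "t \<in> trans" "d \<in> dual_sites M"
  shows "(+) t ` d \<in> dual_sites M"
  using assms face_translate site_add by (cases "kind M") (auto simp: dual_sites_def)

lemma centroid_translate:
  assumes "finite A" "A \<noteq> {}"
  shows "centroid ((+) t ` A) = t + centroid A"
proof -
  have "of_nat (card A) \<noteq> (0 :: complex)" using assms by simp
  thus ?thesis
    by (simp add: centroid_def sum.reindex card_image sum.distrib add_divide_distrib)
qed

lemma centroid_bond: "u \<noteq> v \<Longrightarrow> centroid {u, v} = midpoint u v"
  by (simp add: centroid_def midpoint_def scaleR_conv_of_real)

lemma centroid_bond_hull: "e \<in> bonds M \<Longrightarrow> centroid e \<in> convex hull e"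
  by (elim bondE) (simp add: centroid_bond segment_convex_hull[symmetric])

lemma face_corners:
  assumes F: "F \<in> faces M"
  shows "finite (sites M \<inter> frontier F)" "sites M \<inter> frontier F \<noteq> {}"
proof -
  have "bounded (frontier F)"
    using bounded_closure[OF bounded_face[OF F]] by (rule bounded_subset) (auto simp: frontier_def)
  then obtain x r where "frontier F \<subseteq> cball x r" using bounded_subset_cball[of "frontier F"] by metis
  hence "sites M \<inter> frontier F \<subseteq> {v\<in>sites M. v \<in> cball x r}" by blast
  thus "finite (sites M \<inter> frontier F)" by (rule finite_subset) (rule finite_sites_ball)
  obtain e where e: "e \<in> bonds M" "convex hull e \<subseteq> frontier F" using face_has_bond[OF F] .
  then obtain u v where "e = {u, v}" "u \<in> sites M" by (auto elim: bondE)
  thus "sites M \<inter> frontier F \<noteq> {}" using e(2) hull_inc[of u e] by auto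
qed

lemma corners_translate:
  assumes "t \<in> trans"
  shows "sites M \<inter> frontier ((+) t ` F) = (+) t ` (sites M \<inter> frontier F)"
proof -
  have "(+) t ` (sites M \<inter> frontier F) = (+) t ` sites M \<inter> (+) t ` frontier F" by (rule image_Int) simp
  thus ?thesis by (simp add: trans_sites[OF assms] frontier_translation)
qed

lemma dual_position_translate:
  assumes "t \<in> trans" "d \<in> dual_sites M"
  shows "dual_position M ((+) t ` d) = t + dual_position M d"
proof (cases "kind M")
  case Site
  then obtain v where "d = {v}" using assms(2) by (auto simp: dual_sites_def)
  with Site centroid_translate[of "{v}" t] show ?thesis by (simp add: dual_position_def)
next
  case Bond
  hence "d \<in> faces M" using assms(2) by (simp add: dual_sites_def)
  with face_corners[OF this] Bond show ?thesis
    by (simp add: dual_position_def corners_translate[OF assms(1)] centroid_translate)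
qed

lemma elements_translate:
  assumes "t \<in> trans"
  shows "bij_betw ((`) ((+) t)) (elements M) (elements M)"
proof -
  have sub: "(`) ((+) s) ` elements M \<subseteq> elements M" if "s \<in> trans" for s
    using that by (cases "kind M") (auto simp: elements_def site_add bond_add)
  show ?thesis
  proof (rule bij_betw_byWitness[where f' = "(`) ((+) (- t))"])
    show "(`) ((+) t) ` elements M \<subseteq> elements M" "(`) ((+) (- t)) ` elements M \<subseteq> elements M"
      using sub assms trans_minus by blast+
  qed (simp_all add: image_image)
qed

lemma joined_in_translate:
  assumes t: "t \<in> trans"
  shows "joined_in M (\<lambda>e. \<omega> ((+) t ` e)) UNIV u v \<longleftrightarrow> joined_in M \<omega> UNIV (t + u) (t + v)"
proof -
  \<comment> \<open>Stated for all translations, because the converse is the same implication for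
    \<open>- t\<close>.\<close>
  have imp: "joined_in M \<omega> UNIV (s + u) (s + v)"
    if s: "s \<in> trans" and j: "joined_in M (\<lambda>e. \<omega> ((+) s ` e)) UNIV u v" for s \<omega> u v
  proof -
    have b: "{s + x, s + y} \<in> bonds M" if "{x, y} \<in> bonds M" for x y
      using bond_add[OF s that] by simp
    show ?thesis
    proof (cases "kind M")
      case Site
      hence "(u, v) \<in> {(x, y). {x, y} \<in> bonds M \<and> \<omega> {s + y}}\<^sup>*" using j by (simp add: joined_in_def)
      hence "(s + u, s + v) \<in> {(x, y). {x, y} \<in> bonds M \<and> \<omega> {y}}\<^sup>*"
        by (rule rtrancl_image) (simp add: b)
      thus ?thesis using j Site site_add[OF s] by (simp add: joined_in_def)
    next
      case Bond
      hence "(u, v) \<in> {(x, y). {x, y} \<in> bonds M \<and> \<omega> {s + x, s + y}}\<^sup>*" using j by (simp add: joined_in_def)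
      hence "(s + u, s + v) \<in> {(x, y). {x, y} \<in> bonds M \<and> \<omega> {x, y}}\<^sup>*"
        by (rule rtrancl_image) (simp add: b)
      thus ?thesis using j Bond site_add[OF s] by (simp add: joined_in_def)
    qed
  qed
  show ?thesis
  proof
    assume "joined_in M \<omega> UNIV (t + u) (t + v)"
    hence "joined_in M (\<lambda>e. \<omega> ((+) t ` (+) (- t) ` e)) UNIV (t + u) (t + v)" by (simp add: image_image)
    from imp[OF trans_minus[OF t], where \<omega> = "\<lambda>e. \<omega> ((+) t ` e)", OF this]
    show "joined_in M (\<lambda>e. \<omega> ((+) t ` e)) UNIV u v" by simp
  qed (rule imp[OF t])
qed

lemma dual_joined_in_translate:
  assumes t: "t \<in> trans"
  shows "dual_joined_in M (\<lambda>e. \<omega> ((+) t ` e)) UNIV d d' \<longleftrightarrow>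
    dual_joined_in M \<omega> UNIV ((+) t ` d) ((+) t ` d')"
proof -
  have imp: "dual_joined_in M \<omega> UNIV ((+) s ` d) ((+) s ` d')"
    if s: "s \<in> trans" and j: "dual_joined_in M (\<lambda>e. \<omega> ((+) s ` e)) UNIV d d'" for s \<omega> d d'
  proof -
    have f: "\<exists>f\<in>faces M. (+) s ` x \<union> (+) s ` y \<subseteq> frontier f" if "f \<in> faces M" "x \<union> y \<subseteq> frontier f" for x y f
      using face_translate[OF s that(1)] image_mono[OF that(2), of "(+) s"]
      by (intro bexI[of _ "(+) s ` f"]) (auto simp: frontier_translation)
    have b: "\<exists>e\<in>bonds M. convex hull e \<subseteq> frontier ((+) s ` x) \<inter> frontier ((+) s ` y) \<and> \<not> \<omega> e"
      if "e \<in> bonds M" "convex hull e \<subseteq> frontier x \<inter> frontier y" "\<not> \<omega> ((+) s ` e)" for x y e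
      using bond_add[OF s that(1)] image_mono[OF that(2), of "(+) s"] that(3)
      by (intro bexI[of _ "(+) s ` e"]) (auto simp: frontier_translation convex_hull_translation)
    show ?thesis
    proof (cases "kind M")
      case Site
      hence "(d, d') \<in> {(x, y). y \<in> dual_sites M \<and> \<not> \<omega> ((+) s ` y) \<and> (\<exists>f\<in>faces M. x \<union> y \<subseteq> frontier f)}\<^sup>*"
        using j by (simp add: dual_joined_in_def)
      hence "((+) s ` d, (+) s ` d') \<in>
          {(x, y). y \<in> dual_sites M \<and> \<not> \<omega> y \<and> (\<exists>f\<in>faces M. x \<union> y \<subseteq> frontier f)}\<^sup>*"
      proof (rule rtrancl_image)
        fix x y assume "(x, y) \<in> {(x, y). y \<in> dual_sites M \<and> \<not> \<omega> ((+) s ` y) \<and> (\<exists>f\<in>faces M. x \<union> y \<subseteq> frontier f)}"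
        then obtain g where "y \<in> dual_sites M" "\<not> \<omega> ((+) s ` y)" "g \<in> faces M" "x \<union> y \<subseteq> frontier g" by blast
        with f[of g x y] dual_sites_translate[OF s, of y]
        show "((+) s ` x, (+) s ` y) \<in> {(x, y). y \<in> dual_sites M \<and> \<not> \<omega> y \<and> (\<exists>f\<in>faces M. x \<union> y \<subseteq> frontier f)}"
          by simp
      qed
      thus ?thesis using j Site dual_sites_translate[OF s] by (simp add: dual_joined_in_def)
    next
      case Bond
      let ?R = "\<lambda>T. {(x, y). y \<in> dual_sites M \<and> (\<exists>e\<in>bonds M. convex hull e \<subseteq> frontier x \<inter> frontier y \<and> \<not> \<omega> (T e))}"
      have "(d, d') \<in> (?R ((`) ((+) s)))\<^sup>*" using j Bond by (simp add: dual_joined_in_def)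
      hence "((+) s ` d, (+) s ` d') \<in> (?R (\<lambda>e. e))\<^sup>*"
      proof (rule rtrancl_image)
        fix x y assume "(x, y) \<in> ?R ((`) ((+) s))"
        then obtain e where "y \<in> dual_sites M" "e \<in> bonds M" "convex hull e \<subseteq> frontier x \<inter> frontier y" "\<not> \<omega> ((+) s ` e)"
          by blast
        with b[of e x y] dual_sites_translate[OF s, of y]
        show "((+) s ` x, (+) s ` y) \<in> ?R (\<lambda>e. e)" by simp
      qed
      thus ?thesis using j Bond dual_sites_translate[OF s] by (simp add: dual_joined_in_def)
    qed
  qed
  show ?thesis
  proof
    assume "dual_joined_in M \<omega> UNIV ((+) t ` d) ((+) t ` d')"
    hence "dual_joined_in M (\<lambda>e. \<omega> ((+) t ` (+) (- t) ` e)) UNIV ((+) t ` d) ((+) t ` d')" by (simp add: image_image)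
    from imp[OF trans_minus[OF t], where \<omega> = "\<lambda>e. \<omega> ((+) t ` e)", OF this]
    show "dual_joined_in M (\<lambda>e. \<omega> ((+) t ` e)) UNIV d d'" by (simp add: image_image)
  qed (rule imp[OF t])
qed

text \<open>In the bond case each face has a bond on its frontier. Up to translation there are
  finitely many bonds, each with finitely many faces beside it.\<close>

lemma dual_orbits:
  obtains D where "finite D" "D \<subseteq> dual_sites M"
    "\<And>d. d \<in> dual_sites M \<Longrightarrow> \<exists>t\<in>trans. \<exists>d0\<in>D. d = (+) t ` d0"
proof (cases "kind M")
  case Site
  show ?thesis
  proof (rule that[of "(\<lambda>v. {v}) ` cell"])
    fix d assume "d \<in> dual_sites M"
    then obtain v where v: "d = {v}" "v \<in> sites M" using Site by (auto simp: dual_sites_def)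
    from v(2) obtain t u where "t \<in> trans" "u \<in> cell" "v = t + u" by (rule site_cell)
    thus "\<exists>t\<in>trans. \<exists>d0\<in>(\<lambda>v. {v}) ` cell. d = (+) t ` d0" using v(1) by auto
  qed (use finite_cell Site in \<open>auto simp: dual_sites_def cell_def\<close>)
next
  case Bond
  let ?D = "\<Union>e\<in>{f\<in>bonds M. f \<inter> cell \<noteq> {}}. {F\<in>faces M. convex hull e \<subseteq> frontier F}"
  show ?thesis
  proof (rule that[of ?D])
    show "finite ?D" using finite_bonds_cell finite_faces_bond(1) by auto
    show "?D \<subseteq> dual_sites M" using Bond by (auto simp: dual_sites_def)
    fix d assume "d \<in> dual_sites M"
    hence d: "d \<in> faces M" using Bond by (simp add: dual_sites_def)
    obtain e where e: "e \<in> bonds M" "convex hull e \<subseteq> frontier d" using face_has_bond[OF d] .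
    obtain t f where t: "t \<in> trans" "f \<in> bonds M" "f \<inter> cell \<noteq> {}" "e = (+) t ` f" using bond_cell[OF e(1)] .
    let ?d = "(+) (- t) ` d"
    have "?d \<in> faces M" using face_translate trans_minus t(1) d by blast
    moreover have "convex hull f \<subseteq> frontier ?d"
    proof -
      have "(+) (- t) ` (convex hull e) \<subseteq> (+) (- t) ` frontier d" using e(2) by blast
      moreover have "(+) (- t) ` (convex hull e) = convex hull f"
        unfolding t(4) convex_hull_translation by (simp add: image_image)
      ultimately show ?thesis by (simp only: frontier_translation)
    qed
    ultimately have "?d \<in> ?D" using t by blast
    moreover have "d = (+) t ` ?d" by (simp add: image_image)
    ultimately show "\<exists>t\<in>trans. \<exists>d0\<in>?D. d = (+) t ` d0" using t(1) by blast
  qed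
qed

lemma face_near_bond:
  "\<exists>K>0. \<forall>F\<in>faces M. \<forall>e\<in>bonds M. \<forall>u\<in>e. convex hull e \<subseteq> frontier F \<longrightarrow>
    lnorm M (centroid (sites M \<inter> frontier F) - u) \<le> K"
proof -
  let ?E = "{f\<in>bonds M. f \<inter> cell \<noteq> {}}"
  let ?P = "SIGMA e:?E. {F\<in>faces M. convex hull e \<subseteq> frontier F} \<times> e"
  have "finite e" if "e \<in> bonds M" for e using that by (auto elim: bondE)
  hence "finite ?P" using finite_bonds_cell finite_faces_bond(1) by (intro finite_SigmaI) auto
  hence fin: "finite ((\<lambda>(e, F, u). lnorm M (centroid (sites M \<inter> frontier F) - u)) ` ?P)" by blast
  define K where "K = Max ((\<lambda>(e, F, u). lnorm M (centroid (sites M \<inter> frontier F) - u)) ` ?P)"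
  have K: "lnorm M (centroid (sites M \<inter> frontier F) - u) \<le> K"
    if "e \<in> ?E" "F \<in> faces M" "convex hull e \<subseteq> frontier F" "u \<in> e" for e F u
    unfolding K_def using that by (intro Max_ge[OF fin]) (rule image_eqI[of _ _ "(e, F, u)"], auto)
  show ?thesis
  proof (intro exI[of _ "max K 1"] conjI ballI impI)
    fix F e u assume F: "F \<in> faces M" "e \<in> bonds M" "u \<in> e" "convex hull e \<subseteq> frontier F"
    obtain t f where t: "t \<in> trans" "f \<in> bonds M" "f \<inter> cell \<noteq> {}" "e = (+) t ` f" using bond_cell[OF F(2)] .
    let ?F = "(+) (- t) ` F"
    have mt: "- t \<in> trans" using trans_minus t(1) .
    have "(+) (- t) ` (convex hull e) \<subseteq> (+) (- t) ` frontier F" using F(4) by blast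
    moreover have "(+) (- t) ` (convex hull e) = convex hull f"
      unfolding t(4) convex_hull_translation by (simp add: image_image)
    ultimately have "convex hull f \<subseteq> frontier ?F" by (simp only: frontier_translation)
    moreover have "?F \<in> faces M" using face_translate mt F(1) by blast
    moreover have "u - t \<in> f" using F(3) t(4) by auto
    ultimately have "lnorm M (centroid (sites M \<inter> frontier ?F) - (u - t)) \<le> K"
      using t by (intro K[of f]) auto
    moreover have "centroid (sites M \<inter> frontier ?F) = - t + centroid (sites M \<inter> frontier F)"
      unfolding corners_translate[OF mt] using face_corners[OF F(1)] by (rule centroid_translate)
    ultimately show "lnorm M (centroid (sites M \<inter> frontier F) - u) \<le> max K 1" by simp
  qed simp
qed

section \<open>Connections as finitary events\<close>

lemma finitary_joined_in: "finitary (elements M) (\<lambda>\<omega>. joined_in M \<omega> R u v)"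
proof (cases "u \<in> sites M \<and> u \<in> R")
  case True
  let ?R = "\<lambda>\<omega>. {(x, y). {x, y} \<in> bonds M \<and> y \<in> R \<and>
    (case kind M of Site \<Rightarrow> \<omega> {y} | Bond \<Rightarrow> \<omega> {x, y})}"
  have "finitary (elements M) (\<lambda>\<omega>. (x, y) \<in> ?R \<omega>)" for x y
  proof (cases "{x, y} \<in> bonds M \<and> y \<in> R")
    case True
    thus ?thesis using bond_sites[of x y]
      by (cases "kind M") (auto simp: elements_def intro!: finitary_atom)
  qed (auto simp: finitary_const)
  hence "finitary (elements M) (\<lambda>\<omega>. (u, v) \<in> (?R \<omega>)\<^sup>*)" by (rule finitary_rtrancl)
  moreover have "finitary (elements M) (\<lambda>\<omega>. kind M = Site \<longrightarrow> \<omega> {u})"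
    using True by (cases "kind M") (auto simp: finitary_const elements_def intro!: finitary_atom)
  ultimately show ?thesis unfolding joined_in_def using True by (simp add: finitary_conj)
next
  case False
  hence "(\<lambda>\<omega>. joined_in M \<omega> R u v) = (\<lambda>\<omega>. False)" by (auto simp: joined_in_def)
  thus ?thesis by (simp add: finitary_const)
qed

text \<open>\<open>\<eta>\<close> marks the vacant elements; in these, dual connections are
  increasing.\<close>

lemma finitary_dual_joined_in: "finitary (elements M) (\<lambda>\<eta>. dual_joined_in M (\<lambda>e. \<not> \<eta> e) R d d')"
proof (cases "d \<in> dual_sites M \<and> dual_position M d \<in> R")
  case True
  let ?R = "\<lambda>\<eta>. {(x, y). y \<in> dual_sites M \<and> dual_position M y \<in> R \<and>
        (case kind M of
           Site \<Rightarrow> \<not> \<not> \<eta> y \<and> (\<exists>f\<in>faces M. x \<union> y \<subseteq> frontier f)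
         | Bond \<Rightarrow> \<exists>e\<in>bonds M. convex hull e \<subseteq> frontier x \<inter> frontier y \<and> \<not> \<not> \<eta> e)}"
  have "finitary (elements M) (\<lambda>\<eta>. (x, y) \<in> ?R \<eta>)" for x y
  proof (cases "y \<in> dual_sites M \<and> dual_position M y \<in> R")
    case y: True
    show ?thesis
    proof (cases "kind M")
      case Site
      hence "y \<in> elements M" using y by (simp add: elements_def dual_sites_def)
      from finitary_conj[OF finitary_atom[OF this] finitary_const] show ?thesis using y Site by simp
    next
      case Bond
      have "finitary (elements M) (\<lambda>\<eta>. \<exists>e. (e \<in> bonds M \<and> convex hull e \<subseteq> frontier x \<inter> frontier y) \<and> (e \<in> elements M \<and> \<eta> e))"
      proof (rule finitary_ex, rule finitary_conj[OF finitary_const])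
        show "finitary (elements M) (\<lambda>\<eta>. e \<in> elements M \<and> \<eta> e)" for e
          by (cases "e \<in> elements M") (auto simp: finitary_const finitary_atom)
      qed
      thus ?thesis using y Bond by (simp add: elements_def Bex_def conj_assoc cong: conj_cong)
    qed
  qed (auto simp: finitary_const)
  hence "finitary (elements M) (\<lambda>\<eta>. (d, d') \<in> (?R \<eta>)\<^sup>*)" by (rule finitary_rtrancl)
  moreover have "finitary (elements M) (\<lambda>\<eta>. kind M = Site \<longrightarrow> \<not> \<not> \<eta> d)"
    using True by (cases "kind M") (auto simp: finitary_const elements_def dual_sites_def intro!: finitary_atom)
  ultimately show ?thesis unfolding dual_joined_in_def using True by (simp add: finitary_conj)
next
  case False
  hence "(\<lambda>\<eta>. dual_joined_in M (\<lambda>e. \<not> \<eta> e) R d d') = (\<lambda>\<eta>. False)" by (auto simp: dual_joined_in_def)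
  thus ?thesis by (simp add: finitary_const)
qed

lemma joined_in_trans: "joined_in M \<omega> R u v \<Longrightarrow> joined_in M \<omega> R v w \<Longrightarrow> joined_in M \<omega> R u w"
  by (auto simp: joined_in_def)

lemma dual_joined_in_trans:
  "dual_joined_in M \<omega> R u v \<Longrightarrow> dual_joined_in M \<omega> R v w \<Longrightarrow> dual_joined_in M \<omega> R u w"
  by (auto simp: dual_joined_in_def)

lemma joined_in_all:
  assumes "u \<in> sites M" "v \<in> sites M" "\<And>e. \<omega> e"
  shows "joined_in M \<omega> UNIV u v"
  using sites_connected[OF assms(1,2)] assms by (cases "kind M") (simp_all add: joined_in_def)

text \<open>Connectedness of the dual graph, in the form that yields a finite set of elements whose
  vacancy forces a dual connection.\<close>

lemma dual_joined_in_none: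
  assumes "d \<in> dual_sites M" "d' \<in> dual_sites M" "\<And>e. \<not> \<omega> e"
  shows "dual_joined_in M \<omega> UNIV d d'"
proof (cases "kind M")
  case Site
  then obtain u v where uv: "d = {u}" "d' = {v}" "u \<in> sites M" "v \<in> sites M"
    using assms(1,2) by (auto simp: dual_sites_def)
  have "({u}, {v}) \<in> {(x, y). y \<in> dual_sites M \<and> (\<exists>f\<in>faces M. x \<union> y \<subseteq> frontier f)}\<^sup>*"
  proof (rule rtrancl_image[OF sites_connected[OF uv(3,4)]])
    fix x y assume "(x, y) \<in> {(x, y). {x, y} \<in> bonds M}"
    hence b: "{x, y} \<in> bonds M" by simp
    then obtain f where "f \<in> faces M" "convex hull {x, y} \<subseteq> frontier f" using finite_faces_bond(2) by blast
    moreover have "{x, y} \<subseteq> convex hull {x, y}" by (rule hull_subset)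
    ultimately show "({x}, {y}) \<in> {(x, y). y \<in> dual_sites M \<and> (\<exists>f\<in>faces M. x \<union> y \<subseteq> frontier f)}"
      using Site bond_sites[OF b] by (auto simp: dual_sites_def)
  qed
  thus ?thesis using Site assms uv by (simp add: dual_joined_in_def)
next
  case Bond
  hence "(d, d') \<in> dual_nbr\<^sup>*" using assms(1,2) by (intro faces_connected) (simp_all add: dual_sites_def)
  moreover have "dual_nbr \<subseteq> {(x, y). y \<in> dual_sites M \<and> dual_position M y \<in> UNIV \<and>
      (\<exists>e\<in>bonds M. convex hull e \<subseteq> frontier x \<inter> frontier y \<and> \<not> \<omega> e)}"
    using Bond assms(3) by (auto simp: dual_nbr_def dual_sites_def)
  ultimately show ?thesis using Bond assms(1) unfolding dual_joined_in_def
    by (auto dest: rtrancl_mono)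
qed

end


section \<open>Finite clusters are surrounded by dual paths\<close>

lemma rtrancl_image_star:
  assumes "(x, y) \<in> R\<^sup>*" "\<And>x y. (x, y) \<in> R \<Longrightarrow> (f x, f y) \<in> S\<^sup>*"
  shows "(f x, f y) \<in> S\<^sup>*"
  using assms(1) by induction (auto intro: rtrancl_trans assms(2))

lemma rtrancl_exit:
  assumes "(x, y) \<in> R\<^sup>*" "P x" "\<not> P y"
  obtains u v where "(x, u) \<in> R\<^sup>*" "(u, v) \<in> R" "(v, y) \<in> R\<^sup>*" "P u" "\<not> P v"
proof -
  have "\<exists>u v. (x, u) \<in> R\<^sup>* \<and> (u, v) \<in> R \<and> (v, y) \<in> R\<^sup>* \<and> P u \<and> \<not> P v"
    using assms
  proof (induction rule: rtrancl_induct)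
    case (step y w)
    thus ?case by (cases "P y") (blast intro: rtrancl_into_rtrancl)+
  qed simp
  thus ?thesis using that by blast
qed

context lattice begin

definition cluster :: "(complex set \<Rightarrow> bool) \<Rightarrow> complex \<Rightarrow> complex set" where
  "cluster \<omega> z = {v. joined_in M \<omega> UNIV z v}"

lemma connects_to_infinity_iff: "connects_to_infinity M \<omega> z \<longleftrightarrow> infinite (cluster \<omega> z)"
  by (simp add: connects_to_infinity_def cluster_def)

lemma cluster_sites: "cluster \<omega> z \<subseteq> sites M"
proof
  fix v assume "v \<in> cluster \<omega> z"
  hence "(z, v) \<in> {(x, y). {x, y} \<in> bonds M}\<^sup>*" "z \<in> sites M"
    unfolding cluster_def joined_in_def by (auto elim!: rtrancl_mono[THEN subsetD, rotated])
  thus "v \<in> sites M" by induction (auto dest: bond_sites)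
qed

lemma cluster_step:
  assumes "a \<in> cluster \<omega> z" "{a, b} \<in> bonds M" "kind M = Site \<Longrightarrow> \<omega> {b}" "kind M = Bond \<Longrightarrow> \<omega> {a, b}"
  shows "b \<in> cluster \<omega> z"
  using assms unfolding cluster_def joined_in_def
  by (cases "kind M") (auto intro: rtrancl_into_rtrancl)

lemma cluster_start: "v \<in> cluster \<omega> z \<Longrightarrow> z \<in> cluster \<omega> z"
  by (simp add: cluster_def joined_in_def)

lemma cluster_connected:
  assumes "v \<in> cluster \<omega> z"
  shows "(z, v) \<in> {(x, y). {x, y} \<in> bonds M \<and> x \<in> cluster \<omega> z \<and> y \<in> cluster \<omega> z}\<^sup>*"
proof -
  have z: "z \<in> cluster \<omega> z" using assms by (rule cluster_start)
  let ?R = "{(x, y). {x, y} \<in> bonds M \<and> y \<in> UNIV \<and>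
    (case kind M of Site \<Rightarrow> \<omega> {y} | Bond \<Rightarrow> \<omega> {x, y})}"
  have "(z, v) \<in> ?R\<^sup>*" using assms by (simp add: cluster_def joined_in_def)
  hence "v \<in> cluster \<omega> z \<and> (z, v) \<in> {(x, y). {x, y} \<in> bonds M \<and> x \<in> cluster \<omega> z \<and> y \<in> cluster \<omega> z}\<^sup>*"
  proof (induction rule: rtrancl_induct)
    case base show ?case using z by simp
  next
    case (step x y)
    have "y \<in> cluster \<omega> z"
    proof (rule cluster_step)
      show "x \<in> cluster \<omega> z" using step(3) ..
    qed (use step(2) in simp_all)
    moreover from this have "(x, y) \<in> {(x, y). {x, y} \<in> bonds M \<and> x \<in> cluster \<omega> z \<and> y \<in> cluster \<omega> z}"
      using step(2,3) by simp
    ultimately show ?case using rtrancl_into_rtrancl[OF conjunct2[OF step(3)]] by simp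
  qed
  thus ?thesis ..
qed

text \<open>Connectedness of the lattice made quantitative: up to translation there are finitely
  many pairs of sites at distance at most \<open>D\<close>, so the paths joining them have a common
  bound.\<close>

lemma near_path:
  fixes D :: real
  obtains K where "K > 0"
    "\<forall>u\<in>sites M. \<forall>v\<in>sites M. lnorm M (v - u) \<le> D \<longrightarrow>
     (u, v) \<in> {(x, y). {x, y} \<in> bonds M \<and> lnorm M (x - u) \<le> K \<and> lnorm M (y - u) \<le> K}\<^sup>*"
proof -
  let ?R = "\<lambda>u K. {(x, y). {x, y} \<in> bonds M \<and> lnorm M (x - u) \<le> K \<and> lnorm M (y - u) \<le> K}"
  have mono: "(u, v) \<in> (?R u K')\<^sup>*" if "(u, v) \<in> (?R u K)\<^sup>*" "K \<le> K'" for u v K K'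
    by (rule subsetD[OF rtrancl_mono that(1)]) (use that(2) in auto)
  have ex: "\<exists>K. (u, v) \<in> (?R u K)\<^sup>*" if "u \<in> sites M" "v \<in> sites M" for u v
    using sites_connected[OF that]
  proof (induction rule: rtrancl_induct)
    case (step x y)
    then obtain K where K: "(u, x) \<in> (?R u K)\<^sup>*" by blast
    let ?K = "max K (max (lnorm M (x - u)) (lnorm M (y - u)))"
    have "(x, y) \<in> ?R u ?K" using step(2) by (simp add: le_max_iff_disj)
    with mono[OF K, of ?K] have "(u, y) \<in> (?R u ?K)\<^sup>*" by (meson max.cobounded1 rtrancl_into_rtrancl)
    thus ?case ..
  qed auto
  let ?P = "SIGMA u:cell. {v\<in>sites M. lnorm M (v - u) \<le> D}"
  have fin: "finite ?P" using finite_cell finite_sites_lnorm by auto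
  have "\<forall>p\<in>?P. \<exists>K. (fst p, snd p) \<in> (?R (fst p) K)\<^sup>*" using ex by (auto simp: cell_def)
  from bchoice[OF this] obtain k where k: "\<forall>p\<in>?P. (fst p, snd p) \<in> (?R (fst p) (k p))\<^sup>*" ..
  define K where "K = Max (insert 1 (k ` ?P))"
  have K: "(u, v) \<in> (?R u K)\<^sup>*" if "u \<in> cell" "v \<in> sites M" "lnorm M (v - u) \<le> D" for u v
  proof -
    have "k (u, v) \<le> K" unfolding K_def using fin that by (intro Max_ge) auto
    moreover have "(u, v) \<in> (?R u (k (u, v)))\<^sup>*" using bspec[OF k, of "(u, v)"] that by simp
    ultimately show ?thesis using mono by blast
  qed
  show ?thesis
  proof (rule that)
    have "1 \<le> K" unfolding K_def using fin by (intro Max_ge) auto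
    thus "0 < K" by simp
  next
    show "\<forall>u\<in>sites M. \<forall>v\<in>sites M. lnorm M (v - u) \<le> D \<longrightarrow> (u, v) \<in> (?R u K)\<^sup>*"
    proof (intro ballI impI)
      fix u v assume uv: "u \<in> sites M" "v \<in> sites M" "lnorm M (v - u) \<le> D"
      obtain t u' where t: "t \<in> trans" "u' \<in> cell" "u = t + u'" using uv(1) by (rule site_cell)
      have "v - t \<in> sites M" using site_add_iff[OF t(1), of "v - t"] uv(2) by simp
      hence "(u', v - t) \<in> (?R u' K)\<^sup>*" using t uv by (intro K) (auto simp: algebra_simps)
      hence "(t + u', t + (v - t)) \<in> (?R u K)\<^sup>*"
      proof (rule rtrancl_image)
        fix x y assume "(x, y) \<in> ?R u' K"
        thus "(t + x, t + y) \<in> ?R u K" using bond_add[OF t(1), of "{x, y}"] by (simp add: t(3))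
      qed
      thus "(u, v) \<in> (?R u K)\<^sup>*" using t(3) by simp
    qed
  qed
qed

text \<open>The disjunction under \<open>dual_joined_in\<close> declares all elements away from the cluster occupied,
  so that the dual path can only use vacant elements near the cluster.\<close>

lemma finite_cluster_surrounded:
  "\<exists>K>0. \<forall>\<omega>. \<forall>z\<in>sites M. \<forall>v\<in>cluster \<omega> z. finite (cluster \<omega> z) \<longrightarrow>
     (\<forall>u\<in>cluster \<omega> z. lnorm M (u - z) \<le> lnorm M (v - z)) \<longrightarrow>
     (\<exists>d\<in>dual_sites M. \<exists>d'\<in>dual_sites M.
        lnorm M (dual_position M d - z) \<le> lnorm M (v - z) + K \<and>
        lnorm M (dual_position M d' - z) \<le> lnorm M (v - z) + K \<and>
        lnorm M (v - z) - K \<le> lnorm M (dual_position M d' - dual_position M d) \<and>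
        dual_joined_in M (\<lambda>e. \<omega> e \<or> \<not> lnorm M (centroid e - z) \<le> lnorm M (v - z) + K) UNIV d d')"
proof -
  obtain K1 where K1: "K1 > 0" "\<forall>u\<in>sites M. \<forall>v\<in>sites M. lnorm M (v - u) \<le> 1 \<longrightarrow>
     (u, v) \<in> {(x, y). {x, y} \<in> bonds M \<and> lnorm M (x - u) \<le> K1 \<and> lnorm M (y - u) \<le> K1}\<^sup>*"
    by (rule near_path[of 1])
  \<comment> \<open>From \<open>n0\<close> steps straight out of an extreme site of the cluster
    onwards, detours of size \<open>K1\<close> no longer meet the cluster.\<close>
  define n0 where "n0 = nat \<lceil>K1\<rceil> + 1"
  have n0: "K1 < real n0" unfolding n0_def by linarith
  obtain K2 where K2: "K2 > 0" "\<forall>u\<in>sites M. \<forall>v\<in>sites M. lnorm M (v - u) \<le> real n0 \<longrightarrow>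
     (u, v) \<in> {(x, y). {x, y} \<in> bonds M \<and> lnorm M (x - u) \<le> K2 \<and> lnorm M (y - u) \<le> K2}\<^sup>*"
    by (rule near_path[of "real n0"])
  from face_near_bond obtain K3 where K3: "K3 > 0" "\<forall>F\<in>faces M. \<forall>e\<in>bonds M. \<forall>u\<in>e.
    convex hull e \<subseteq> frontier F \<longrightarrow> lnorm M (centroid (sites M \<inter> frontier F) - u) \<le> K3"
    by (elim exE conjE)
  define K4 where "K4 = max K3 bond_bound"
  \<comment> \<open>Each end of the dual path may be off by \<open>K2\<close> from an extreme site
    to the boundary and by \<open>K4\<close> from there to the dual site; \<open>bond_bound\<close>
    accounts for the location of the vacant elements.\<close>
  define K where "K = 2 * K2 + 2 * K4 + bond_bound"
  have Kpos: "K > 0" "K4 > 0" using K2(1) K3(1) bond_bound(1) by (auto simp: K_def K4_def)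
  show ?thesis
  proof (intro exI[of _ K] conjI allI ballI impI)
    show "K > 0" by fact
    fix \<omega> z v1
    assume z: "z \<in> sites M" and v1: "v1 \<in> cluster \<omega> z" and fin: "finite (cluster \<omega> z)"
      and "\<forall>u\<in>cluster \<omega> z. lnorm M (u - z) \<le> lnorm M (v1 - z)"
    define C where "C = cluster \<omega> z"
    define \<rho> where "\<rho> = lnorm M (v1 - z)"
    have C\<rho>: "lnorm M (u - z) \<le> \<rho>" if "u \<in> C" for u
      using that \<open>\<forall>u\<in>cluster \<omega> z. _ u\<close> by (simp add: C_def \<rho>_def)
    have Cs: "C \<subseteq> sites M" unfolding C_def by (rule cluster_sites)
    define adj where "adj = {(x, y). {x, y} \<in> bonds M \<and> x \<notin> C \<and> y \<notin> C}"
    have "sym adj" by (auto simp: adj_def sym_def insert_commute)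
    hence symadj: "sym (adj\<^sup>*)" by (rule sym_rtrancl)
    have near: "(u, v) \<in> adj\<^sup>*"
      if "u \<in> sites M" "v \<in> sites M" "lnorm M (v - u) \<le> 1"
        and out: "\<And>x. lnorm M (x - u) \<le> K1 \<Longrightarrow> x \<notin> C" for u v
      by (rule subsetD[OF rtrancl_mono K1(2)[rule_format, OF that(1-3)]]) (auto simp: adj_def dest: out)
    have far: "(u, v) \<in> adj\<^sup>*"
      if "u \<in> sites M" "v \<in> sites M" "lnorm M (v - u) \<le> 1" "\<rho> + K1 < lnorm M (u - z)" for u v
    proof (rule near[OF that(1-3)])
      fix x assume "lnorm M (x - u) \<le> K1"
      hence "\<rho> < lnorm M (x - z)" using lnorm_triangle'[of u z x] that(4) lnorm_commute[of u x] by linarith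
      thus "x \<notin> C" using C\<rho> by force
    qed
    have vert: "(t, t + lat 0 n) \<in> adj\<^sup>*" if t: "t \<in> trans" "\<rho> + K1 < \<bar>coord1 M (t - z)\<bar>" for t n
    proof -
      have s: "(t + lat 0 i, t + lat 0 j) \<in> adj\<^sup>*" if "\<bar>j - i\<bar> \<le> 1" for i j
      proof (rule far)
        show "t + lat 0 i \<in> sites M" "t + lat 0 j \<in> sites M"
          using t(1) trans_site trans_add lat_trans by blast+
        have "t + lat 0 j - (t + lat 0 i) = lat 0 (j - i)" by (simp add: lat_def algebra_simps)
        moreover have "lnorm M (lat 0 (j - i)) = of_int \<bar>j - i\<bar>" by (simp add: lnorm_def)
        ultimately show "lnorm M (t + lat 0 j - (t + lat 0 i)) \<le> 1" using that by simp
        show "\<rho> + K1 < lnorm M (t + lat 0 i - z)"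
          using t(2) coord_le_lnorm(1)[of "t + lat 0 i - z"] by (simp add: coord_add coord_diff)
      qed
      show ?thesis
      proof (induction n rule: int_induct[where k = 0])
        case (step1 i) from rtrancl_trans[OF step1(2) s] show ?case by simp
      next
        case (step2 i) from rtrancl_trans[OF step2(2) s] show ?case by simp
      qed simp
    qed
    have horiz: "(t, t + lat n 0) \<in> adj\<^sup>*" if t: "t \<in> trans" "\<rho> + K1 < \<bar>coord2 M (t - z)\<bar>" for t n
    proof -
      have s: "(t + lat i 0, t + lat j 0) \<in> adj\<^sup>*" if "\<bar>j - i\<bar> \<le> 1" for i j
      proof (rule far)
        show "t + lat i 0 \<in> sites M" "t + lat j 0 \<in> sites M"
          using t(1) trans_site trans_add lat_trans by blast+
        have "t + lat j 0 - (t + lat i 0) = lat (j - i) 0" by (simp add: lat_def algebra_simps)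
        moreover have "lnorm M (lat (j - i) 0) = of_int \<bar>j - i\<bar>" by (simp add: lnorm_def)
        ultimately show "lnorm M (t + lat j 0 - (t + lat i 0)) \<le> 1" using that by simp
        show "\<rho> + K1 < lnorm M (t + lat i 0 - z)"
          using t(2) coord_le_lnorm(2)[of "t + lat i 0 - z"] by (simp add: coord_add coord_diff)
      qed
      show ?thesis
      proof (induction n rule: int_induct[where k = 0])
        case (step1 i) from rtrancl_trans[OF step1(2) s] show ?case by simp
      next
        case (step2 i) from rtrancl_trans[OF step2(2) s] show ?case by simp
      qed simp
    qed
    \<comment> \<open>\<open>lat k k\<close> is remote from \<open>z\<close> in both coordinates, so
      every remote translation reaches it along one vertical and one horizontal line that pass
      outside the cluster.\<close>
    define k where "k = \<lceil>\<bar>coord1 M z\<bar> + \<bar>coord2 M z\<bar> + \<rho> + K1 + 1\<rceil>"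
    have k: "\<rho> + K1 < \<bar>of_int k - coord1 M z\<bar>" "\<rho> + K1 < \<bar>of_int k - coord2 M z\<bar>"
      unfolding k_def by linarith+
    \<comment> \<open>The outer component of the complement of the cluster. Its complement
      \<open>A\<close> is the cluster with its holes filled. Unlike the cluster, \<open>A\<close>
      always has a connected complement, as \<open>cut_connected\<close> requires.\<close>
    define E where "E = {v\<in>sites M. v \<notin> C \<and> (v, lat k k) \<in> adj\<^sup>*}"
    have outE: "v \<in> E" if v: "v \<in> sites M" "\<rho> + K1 + 1 < lnorm M (v - z)" for v
    proof -
      obtain t u where t: "t \<in> trans" "u \<in> cell" "v = t + u" using v(1) by (rule site_cell)
      then obtain a b where ab: "t = lat a b" by (auto simp: trans_def)
      have u: "lnorm M u \<le> 1" using t(2) by (simp add: cell_def)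
      have "(v, t) \<in> adj\<^sup>*"
        using v u t lnorm_minus[of u] by (intro far) (auto intro: trans_site)
      moreover have "(t, lat k k) \<in> adj\<^sup>*"
      proof -
        have vz: "v - z = u + (t - z)" by (simp add: t(3))
        have "\<rho> + K1 < lnorm M (t - z)"
          using v(2) u lnorm_triangle[of u "t - z"] unfolding vz by linarith
        then consider "\<rho> + K1 < \<bar>coord1 M (t - z)\<bar>" | "\<rho> + K1 < \<bar>coord2 M (t - z)\<bar>"
          unfolding lnorm_def by linarith
        thus ?thesis
        proof cases
          case 1
          have "(lat a b, lat a b + lat 0 (k - b)) \<in> adj\<^sup>*" using 1 ab by (intro vert) auto
          moreover have "(lat a k, lat a k + lat (k - a) 0) \<in> adj\<^sup>*" using k by (intro horiz) (auto simp: coord_diff)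
          ultimately show ?thesis by (simp add: lat_add ab)
        next
          case 2
          have "(lat a b, lat a b + lat (k - a) 0) \<in> adj\<^sup>*" using 2 ab by (intro horiz) auto
          moreover have "(lat k b, lat k b + lat 0 (k - b)) \<in> adj\<^sup>*" using k by (intro vert) (auto simp: coord_diff)
          ultimately show ?thesis by (simp add: lat_add ab)
        qed
      qed
      moreover have "v \<notin> C" using C\<rho>[of v] v K1(1) by auto
      ultimately show ?thesis using v(1) by (auto simp: E_def)
    qed
    have adjE: "y \<in> E" if "(x, y) \<in> adj" "x \<in> E" for x y
    proof -
      have "(y, x) \<in> adj" using that(1) by (auto simp: adj_def insert_commute)
      moreover have "y \<in> sites M" "y \<notin> C" using that(1) bond_sites by (auto simp: adj_def)
      ultimately show ?thesis using that(2) by (auto simp: E_def intro: converse_rtrancl_into_rtrancl)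
    qed
    have adjE': "y \<in> E" if "(x, y) \<in> adj\<^sup>*" "x \<in> E" for x y
      using that by induction (auto intro: adjE)
    define A where "A = sites M - E"
    have finA: "finite A"
    proof (rule finite_subset)
      show "A \<subseteq> {v\<in>sites M. lnorm M (v - z) \<le> \<rho> + K1 + 1}" using outE by (force simp: A_def)
    qed (rule finite_sites_lnorm)
    have CA: "C \<subseteq> A" using Cs by (auto simp: A_def E_def)
    have AE: "A \<union> E = sites M" "A \<inter> E = {}" by (auto simp: A_def E_def)
    let ?RA = "{(x, y). {x, y} \<in> bonds M \<and> x \<in> A \<and> y \<in> A}"
    let ?RE = "{(x, y). {x, y} \<in> bonds M \<and> x \<in> E \<and> y \<in> E}"
    have symR: "sym (?RA\<^sup>*)" "sym (?RE\<^sup>*)"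
      by (intro sym_rtrancl; auto simp: sym_def insert_commute)+
    have toQ: "(u, lat k k) \<in> ?RE\<^sup>*" if "u \<in> E" for u
    proof -
      have "(u, lat k k) \<in> adj\<^sup>*" using that by (simp add: E_def)
      thus ?thesis using that
      proof (induction rule: converse_rtrancl_induct)
        case (step x y)
        have "y \<in> E" using adjE step by blast
        moreover have "(x, y) \<in> ?RE" using step(1,4) \<open>y \<in> E\<close> by (simp add: adj_def)
        ultimately show ?case using step(3) by (meson converse_rtrancl_into_rtrancl)
      qed simp
    qed
    have connE: "(u, v) \<in> ?RE\<^sup>*" if "u \<in> E" "v \<in> E" for u v
      using toQ[OF that(1)] symD[OF symR(2) toQ[OF that(2)]] by (rule rtrancl_trans)
    have Cz: "(u, z) \<in> ?RA\<^sup>*" if "u \<in> C" for u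
    proof -
      have "(z, u) \<in> ?RA\<^sup>*"
        by (rule subsetD[OF rtrancl_mono cluster_connected[of u \<omega> z]]) (use CA that in \<open>auto simp: C_def\<close>)
      thus ?thesis by (rule symD[OF symR(1)])
    qed
    \<comment> \<open>A path from \<open>A\<close> to \<open>z\<close> cannot enter \<open>E\<close>
      before it meets the cluster, since adjacent sites outside the cluster lie in the same
      component.\<close>
    have toz: "(u, z) \<in> ?RA\<^sup>*" if "u \<in> A" for u
    proof -
      have "(u, z) \<in> {(x, y). {x, y} \<in> bonds M}\<^sup>*" using that z by (intro sites_connected) (auto simp: A_def)
      thus ?thesis using that
      proof (induction rule: converse_rtrancl_induct)
        case (step x y)
        show ?case
        proof (cases "x \<in> C")
          case False
          have y: "y \<in> sites M" using step(1) bond_sites by blast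
          have "y \<in> A"
          proof (rule ccontr)
            assume "y \<notin> A"
            hence "y \<in> E" "y \<notin> C" using y CA by (auto simp: A_def)
            moreover from this False step(1) have "(y, x) \<in> adj" by (auto simp: adj_def insert_commute)
            ultimately show False using adjE step(4) by (auto simp: A_def)
          qed
          moreover have "(x, y) \<in> ?RA" using step(1,4) \<open>y \<in> A\<close> by simp
          ultimately show ?thesis using step(3) by (meson converse_rtrancl_into_rtrancl)
        qed (rule Cz)
      qed simp
    qed
    have connA: "(u, v) \<in> ?RA\<^sup>*" if "u \<in> A" "v \<in> A" for u v
      using toz[OF that(1)] symD[OF symR(1) toz[OF that(2)]] by (rule rtrancl_trans)
    define bdry where "bdry = {e\<in>bonds M. e \<inter> A \<noteq> {} \<and> e \<inter> E \<noteq> {}}"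
    \<comment> \<open>The holes have no bonds to \<open>E\<close>, so each bond of the cut starts in
      the cluster itself. It must then be blocked: the bond, or its end in \<open>E\<close>, is
      vacant.\<close>
    have bdryE: "\<exists>a b. e = {a, b} \<and> a \<in> C \<and> b \<in> E \<and> {a, b} \<in> bonds M" if e: "e \<in> bdry" for e
    proof -
      have eb: "e \<in> bonds M" "e \<inter> A \<noteq> {}" "e \<inter> E \<noteq> {}" using e by (auto simp: bdry_def)
      from eb(1) obtain x y where xy: "e = {x, y}" by (rule bondE)
      hence "x \<in> A \<and> y \<in> E \<or> y \<in> A \<and> x \<in> E" using eb(2,3) AE(2) by auto
      then obtain a b where ab: "e = {a, b}" "a \<in> A" "b \<in> E"
        using xy by (elim disjE) (auto simp: insert_commute)
      have "{a, b} \<in> bonds M" using eb(1) ab(1) by simp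
      note ab = ab this
      have "a \<in> C"
      proof (rule ccontr)
        assume "a \<notin> C"
        hence "(b, a) \<in> adj" using ab by (auto simp: adj_def E_def insert_commute)
        thus False using adjE ab(2,3) AE(2) by blast
      qed
      thus ?thesis using ab by blast
    qed
    define B where "B e \<longleftrightarrow> lnorm M (centroid e - z) \<le> \<rho> + K" for e
    have vacant: "\<not> (\<omega> {b} \<or> \<not> B {b})" if "a \<in> C" "b \<in> E" "{a, b} \<in> bonds M" "kind M = Site" for a b
    proof -
      have "b \<notin> C" using that(2) by (simp add: E_def)
      hence "\<not> \<omega> {b}" using cluster_step[of a \<omega> z b] that by (auto simp: C_def)
      moreover have "lnorm M (b - z) \<le> \<rho> + K"
        using C\<rho>[OF that(1)] bond_bound(2)[of b a] that(3) lnorm_triangle'[of b z a] Kpos K2(1)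
        by (simp add: insert_commute K_def)
      ultimately show ?thesis by (simp add: B_def centroid_def)
    qed
    have vacant': "\<not> (\<omega> e \<or> \<not> B e)" if e: "e \<in> bdry" "kind M = Bond" for e
    proof -
      obtain a b where ab: "e = {a, b}" "a \<in> C" "b \<in> E" "{a, b} \<in> bonds M" using bdryE[OF e(1)] by blast
      have "b \<notin> C" using ab by (simp add: E_def)
      hence "\<not> \<omega> e" using cluster_step[of a \<omega> z b] ab e(2) by (auto simp: C_def)
      moreover have "lnorm M (centroid e - z) \<le> \<rho> + K"
        using C\<rho>[OF ab(2)] bond_near(1)[OF ab(4), of "centroid e"] centroid_bond_hull[OF ab(4)]
          lnorm_triangle'[of "centroid e" z a] Kpos K2(1) by (simp add: ab(1) K_def)
      ultimately show ?thesis by (simp add: B_def)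
    qed
    \<comment> \<open>Walk outwards from a site \<open>v\<close> that is extreme in direction
      \<open>s\<close>. From \<open>n0\<close> steps on, the walk stays in the complement of the
      cluster, and it arrives in \<open>E\<close>. Hence the path of size \<open>K2\<close> from
      \<open>v\<close> to the point at \<open>n0\<close> steps has to cross the boundary.\<close>
    have extreme: "\<exists>e\<in>bdry. \<exists>u\<in>e. lnorm M (u - v) \<le> K2"
      if f: "\<And>x y. f (x + y) = f x + f y" "\<And>x. \<bar>f x\<bar> \<le> lnorm M x"
        and s: "s \<in> trans" "f s = 1" "lnorm M s = 1"
        and v: "v \<in> C" "\<And>u. u \<in> C \<Longrightarrow> f u \<le> f v" for f :: "complex \<Rightarrow> real" and s v
    proof -
      have f0: "f 0 = 0" using f(1)[of 0 0] by simp
      have fn: "f (of_nat n * s) = real n" for n by (induction n) (auto simp: f0 f(1) s(2) algebra_simps)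
      have fdiff: "f (x - y) = f x - f y" for x y using f(1)[of "x - y" y] by simp
      have ln: "lnorm M (of_nat n * s) = real n" for n
        using lnorm_scaleR[of "real n" s] s(3) by (simp add: scaleR_conv_of_real)
      have vs: "v \<in> sites M" using v(1) Cs by blast
      have ws: "v + of_nat n * s \<in> sites M" for n
        using site_add[OF trans_mult[OF s(1)] vs, of n] by (simp add: add.commute)
      have step: "(v + of_nat n * s, v + of_nat (Suc n) * s) \<in> adj\<^sup>*" if "n0 \<le> n" for n
      proof (rule near[OF ws ws])
        show "lnorm M (v + of_nat (Suc n) * s - (v + of_nat n * s)) \<le> 1" using s(3) by (simp add: algebra_simps)
        fix x assume "lnorm M (x - (v + of_nat n * s)) \<le> K1"
        hence "f (v + of_nat n * s) - f x \<le> K1"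
          using f(2)[of "x - (v + of_nat n * s)"] by (simp add: fdiff)
        hence "f v < f x" using n0 that by (simp add: f(1) fn)
        thus "x \<notin> C" using v(2) by force
      qed
      have chain: "(v + of_nat n0 * s, v + of_nat (n0 + j) * s) \<in> adj\<^sup>*" for j
      proof (induction j)
        case (Suc j) from rtrancl_trans[OF Suc step[of "n0 + j"]] show ?case by simp
      qed simp
      define j where "j = nat \<lceil>2 * \<rho> + K1 + 2\<rceil>"
      have "v + of_nat (n0 + j) * s \<in> E"
      proof (rule outE[OF ws])
        have "real (n0 + j) - \<rho> \<le> lnorm M (v + of_nat (n0 + j) * s - z)"
          using lnorm_triangle[of "v + of_nat (n0 + j) * s - z" "- (v - z)"] C\<rho>[OF v(1)] ln[of "n0 + j"]
            lnorm_minus[of "v - z"] by (simp add: algebra_simps)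
        moreover have "2 * \<rho> + K1 + 1 < real j" unfolding j_def by linarith
        ultimately show "\<rho> + K1 + 1 < lnorm M (v + of_nat (n0 + j) * s - z)" by simp
      qed
      hence "v + of_nat n0 * s \<in> E" using symD[OF symadj chain[of j]] adjE' by blast
      hence "v + of_nat n0 * s \<notin> A" using AE by blast
      moreover have "v \<in> A" using v(1) CA by blast
      moreover have "(v, v + of_nat n0 * s) \<in> {(x, y). {x, y} \<in> bonds M \<and> lnorm M (x - v) \<le> K2 \<and> lnorm M (y - v) \<le> K2}\<^sup>*"
        by (rule K2(2)[rule_format, OF vs ws]) (simp add: ln)
      ultimately obtain x y where xy: "{x, y} \<in> bonds M" "lnorm M (x - v) \<le> K2" "x \<in> A" "y \<notin> A"
        using rtrancl_exit[of v "v + of_nat n0 * s" _ "\<lambda>x. x \<in> A"] by (smt (verit) case_prodD mem_Collect_eq)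
      hence "{x, y} \<in> bdry" using bond_sites[OF xy(1)] AE by (auto simp: bdry_def)
      thus ?thesis using xy(2) by blast
    qed
    \<comment> \<open>\<open>f\<close> is the coordinate, up to sign, in which \<open>v1 - z\<close>
      attains its norm. Over the cluster it is maximal at \<open>v1\<close>, and its minimum is at
      most its value at \<open>z\<close>; so the two extremes are at least \<open>\<rho>\<close>
      apart.\<close>
    have "\<exists>f s. (\<forall>x y. f (x + y) = f x + f y) \<and> (\<forall>x. \<bar>f x\<bar> \<le> lnorm M x) \<and> s \<in> trans \<and> f s = 1 \<and>
      lnorm M s = 1 \<and> f (v1 - z) = \<rho>"
    proof -
      consider "\<rho> = coord1 M (v1 - z)" | "\<rho> = - coord1 M (v1 - z)" | "\<rho> = coord2 M (v1 - z)" | "\<rho> = - coord2 M (v1 - z)"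
        unfolding \<rho>_def lnorm_def by linarith
      thus ?thesis
      proof cases
        case 1 thus ?thesis by (intro exI[of _ "coord1 M"] exI[of _ "lat 1 0"])
            (auto simp: coord_add coord_le_lnorm, simp add: lnorm_def)
      next
        case 2 thus ?thesis by (intro exI[of _ "\<lambda>x. - coord1 M x"] exI[of _ "lat (-1) 0"])
            (auto simp: coord_add coord_le_lnorm, simp add: lnorm_def)
      next
        case 3 thus ?thesis by (intro exI[of _ "coord2 M"] exI[of _ "lat 0 1"])
            (auto simp: coord_add coord_le_lnorm, simp add: lnorm_def)
      next
        case 4 thus ?thesis by (intro exI[of _ "\<lambda>x. - coord2 M x"] exI[of _ "lat 0 (-1)"])
            (auto simp: coord_add coord_le_lnorm, simp add: lnorm_def)
      qed
    qed
    then obtain f s where f: "\<And>x y. f (x + y) = f x + f y" "\<And>x. \<bar>f x\<bar> \<le> lnorm M x"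
      and s: "s \<in> trans" "f s = 1" "lnorm M s = 1" and fv1: "f (v1 - z) = \<rho>" by blast
    have fdiff: "f (x - y) = f x - f y" for x y using f(1)[of "x - y" y] by simp
    have fneg: "f (- x) = - f x" for x using fdiff[of 0 x] f(1)[of 0 0] by simp
    have v1C: "v1 \<in> C" and zC: "z \<in> C" using v1 cluster_start by (auto simp: C_def)
    obtain e1 u1 where e1: "e1 \<in> bdry" "u1 \<in> e1" "lnorm M (u1 - v1) \<le> K2"
    proof -
      have "f u \<le> f v1" if "u \<in> C" for u
        using C\<rho>[OF that] f(2)[of "u - z"] fv1 by (simp add: fdiff)
      from extreme[OF f s v1C this] show ?thesis using that by blast
    qed
    have "finite C" "C \<noteq> {}" using fin zC by (auto simp: C_def)
    then obtain v2 where v2: "v2 \<in> C" "\<And>u. u \<in> C \<Longrightarrow> f v2 \<le> f u"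
      using ex_min_if_finite[of "f ` C"] by (metis (no_types, lifting) finite_imageI image_iff image_is_empty linorder_not_less)
    obtain e2 u2 where e2: "e2 \<in> bdry" "u2 \<in> e2" "lnorm M (u2 - v2) \<le> K2"
    proof -
      have "\<exists>e\<in>bdry. \<exists>u\<in>e. lnorm M (u - v2) \<le> K2"
        by (rule extreme[of "\<lambda>x. - f x" "- s"])
          (use f s v2 in \<open>auto simp: fneg trans_minus lnorm_minus\<close>)
      thus ?thesis using that by blast
    qed
    let ?S = "{(e, f). e \<in> bdry \<and> f \<in> bdry \<and>
      (\<exists>F\<in>faces M. convex hull e \<subseteq> frontier F \<and> convex hull f \<subseteq> frontier F)}"
    have link: "(e1, e2) \<in> ?S\<^sup>*"
      by (rule cut_connected[OF AE finA connA connE bdry_def e1(1) e2(1)])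
    define \<omega>' where "\<omega>' e \<longleftrightarrow> \<omega> e \<or> \<not> B e" for e
    \<comment> \<open>\<open>g\<close> attaches a dual site to each bond of the cut: its end in
      \<open>E\<close> for site percolation, a face beside it for bond percolation. Consecutive
      bonds border a common face \<open>F\<close>. In the first case this makes the dual sites
      adjacent; in the second they are joined by two dual steps, through \<open>F\<close>.\<close>
    have "\<exists>g. (\<forall>e\<in>bdry. g e \<in> dual_sites M \<and> (\<forall>u\<in>e. lnorm M (dual_position M (g e) - u) \<le> K4)) \<and>
      dual_joined_in M \<omega>' UNIV (g e1) (g e2)"
    proof (cases "kind M")
      case Site
      have "\<forall>e. \<exists>b. e \<in> bdry \<longrightarrow> b \<in> e \<and> b \<in> E \<and> \<not> \<omega>' {b}"
        using bdryE vacant[OF _ _ _ Site] unfolding \<omega>'_def by blast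
      then obtain b where b: "\<And>e. e \<in> bdry \<Longrightarrow> b e \<in> e \<and> b e \<in> E \<and> \<not> \<omega>' {b e}" by metis
      have ds: "{b e} \<in> dual_sites M" if "e \<in> bdry" for e
        using b[OF that] Site AE(1) by (auto simp: dual_sites_def)
      have "lnorm M (dual_position M {b e} - u) \<le> K4" if e: "e \<in> bdry" and u: "u \<in> e" for e u
      proof -
        obtain x y where xy: "e = {x, y}" "{x, y} \<in> bonds M" using bdryE[OF e] by blast
        have "lnorm M (b e - u) \<le> bond_bound"
          using b[OF e] u bond_bound(2)[OF xy(2)] bond_bound(1) lnorm_commute[of x y]
          by (auto simp: xy(1))
        thus ?thesis using Site by (simp add: dual_position_def centroid_def K4_def)
      qed
      moreover have "({b e1}, {b e2}) \<in> {(x, y). y \<in> dual_sites M \<and> \<not> \<omega>' y \<and> (\<exists>f\<in>faces M. x \<union> y \<subseteq> frontier f)}\<^sup>*"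
        using link
      proof (rule rtrancl_image[where f = "\<lambda>e. {b e}"])
        fix e f assume "(e, f) \<in> ?S"
        then obtain F where F: "e \<in> bdry" "f \<in> bdry" "F \<in> faces M" "convex hull e \<subseteq> frontier F" "convex hull f \<subseteq> frontier F"
          by blast
        have "b e \<in> frontier F" "b f \<in> frontier F"
          using F b[of e] b[of f] hull_inc[of _ e convex] hull_inc[of _ f convex] by blast+
        thus "({b e}, {b f}) \<in> {(x, y). y \<in> dual_sites M \<and> \<not> \<omega>' y \<and> (\<exists>f\<in>faces M. x \<union> y \<subseteq> frontier f)}"
          using F ds b by auto
      qed
      ultimately show ?thesis using Site ds b e1(1) unfolding dual_joined_in_def
        by (intro exI[of _ "\<lambda>e. {b e}"]) simp
    next
      case Bond
      have bb: "e \<in> bonds M" if "e \<in> bdry" for e using that by (simp add: bdry_def)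
      have "\<forall>e. \<exists>F. e \<in> bdry \<longrightarrow> F \<in> faces M \<and> convex hull e \<subseteq> frontier F"
        using finite_faces_bond(2)[OF bb] by blast
      then obtain \<phi> where \<phi>: "\<And>e. e \<in> bdry \<Longrightarrow> \<phi> e \<in> faces M \<and> convex hull e \<subseteq> frontier (\<phi> e)" by metis
      have "lnorm M (dual_position M (\<phi> e) - u) \<le> K4" if "e \<in> bdry" "u \<in> e" for e u
        using K3(2)[rule_format, of "\<phi> e" e u] \<phi>[OF that(1)] bb that Bond by (simp add: dual_position_def K4_def)
      moreover have "(\<phi> e1, \<phi> e2) \<in> {(x, y). y \<in> dual_sites M \<and>
          (\<exists>e\<in>bonds M. convex hull e \<subseteq> frontier x \<inter> frontier y \<and> \<not> \<omega>' e)}\<^sup>*" (is "_ \<in> ?D\<^sup>*")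
        using link
      proof (rule rtrancl_image_star)
        fix e f assume "(e, f) \<in> ?S"
        then obtain F where F: "e \<in> bdry" "f \<in> bdry" "F \<in> faces M" "convex hull e \<subseteq> frontier F" "convex hull f \<subseteq> frontier F"
          by blast
        have v: "\<not> \<omega>' e" "\<not> \<omega>' f" using vacant'[OF _ Bond] F by (auto simp: \<omega>'_def)
        have "(\<phi> e, F) \<in> ?D" using F \<phi>[OF F(1)] v(1) bb Bond by (auto simp: dual_sites_def)
        moreover have "(F, \<phi> f) \<in> ?D" using F \<phi>[OF F(2)] v(2) bb Bond by (auto simp: dual_sites_def)
        ultimately show "(\<phi> e, \<phi> f) \<in> ?D\<^sup>*" by (meson converse_rtrancl_into_rtrancl r_into_rtrancl)
      qed
      ultimately show ?thesis using Bond \<phi> e1(1) unfolding dual_joined_in_def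
        by (intro exI[of _ \<phi>]) (simp add: dual_sites_def)
    qed
    then obtain g where g: "\<And>e. e \<in> bdry \<Longrightarrow> g e \<in> dual_sites M"
      "\<And>e u. e \<in> bdry \<Longrightarrow> u \<in> e \<Longrightarrow> lnorm M (dual_position M (g e) - u) \<le> K4"
      "dual_joined_in M \<omega>' UNIV (g e1) (g e2)" by blast
    have pos: "lnorm M (dual_position M (g e) - z) \<le> \<rho> + K" if e: "e \<in> bdry" for e
    proof -
      obtain a b where "e = {a, b}" "a \<in> C" using bdryE[OF e] by blast
      thus ?thesis using g(2)[OF e, of a] C\<rho>[of a] lnorm_triangle'[of "dual_position M (g e)" z a] Kpos K2(1) bond_bound(1)
        by (simp add: K_def)
    qed
    have apart: "\<rho> - K \<le> lnorm M (dual_position M (g e2) - dual_position M (g e1))"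
    proof -
      let ?p = "dual_position M (g e1)" and ?q = "dual_position M (g e2)"
      have "f v1 - f u1 \<le> K2" "f u2 - f v2 \<le> K2"
        using f(2)[of "u1 - v1"] e1(3) f(2)[of "u2 - v2"] e2(3) by (auto simp: fdiff)
      moreover have "f u1 - f ?p \<le> K4" "f ?q - f u2 \<le> K4"
        using f(2)[of "?p - u1"] g(2)[OF e1(1,2)] f(2)[of "?q - u2"] g(2)[OF e2(1,2)] by (auto simp: fdiff)
      moreover have "f v1 = \<rho> + f z" "f v2 \<le> f z" using fv1 v2(2)[OF zC] by (auto simp: fdiff)
      moreover have "\<bar>f (?q - ?p)\<bar> \<le> lnorm M (?q - ?p)" by (rule f(2))
      ultimately show ?thesis using bond_bound(1) by (simp add: fdiff K_def)
    qed
    show "\<exists>d\<in>dual_sites M. \<exists>d'\<in>dual_sites M.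
        lnorm M (dual_position M d - z) \<le> lnorm M (v1 - z) + K \<and>
        lnorm M (dual_position M d' - z) \<le> lnorm M (v1 - z) + K \<and>
        lnorm M (v1 - z) - K \<le> lnorm M (dual_position M d' - dual_position M d) \<and>
        dual_joined_in M (\<lambda>e. \<omega> e \<or> \<not> lnorm M (centroid e - z) \<le> lnorm M (v1 - z) + K) UNIV d d'"
      using pos[OF e1(1)] pos[OF e2(1)] apart g(1)[OF e1(1)] g(1)[OF e2(1)] g(3)
      unfolding \<rho>_def \<omega>'_def[abs_def] B_def by blast
  qed
qed

end


section \<open>Percolation probabilities and the decay of dual connections\<close>

lemma pred_not: "Measurable.pred N Q \<Longrightarrow> Measurable.pred N (\<lambda>x. \<not> Q x)"
  by measurable

context lattice begin

definition perc_prob :: "(complex \<Rightarrow> real) \<Rightarrow> ((complex set \<Rightarrow> bool) \<Rightarrow> bool) \<Rightarrow> real" where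
  "perc_prob q Q = bern_prob (elements M) (\<lambda>e. q (centroid e)) Q"

lemma percolation_bern: "percolation M q = bern (elements M) (\<lambda>e. q (centroid e))"
  by (simp add: percolation_def bern_def)

lemma hom_prob_eq: "hom_prob M p Q = perc_prob (\<lambda>_. p) Q"
  by (simp add: hom_prob_def perc_prob_def bern_prob_def percolation_bern)

text \<open>Infinite clusters are not finitary events, so measurability is carried along as a notion
  of its own, for all densities at once.\<close>

definition event :: "((complex set \<Rightarrow> bool) \<Rightarrow> bool) \<Rightarrow> bool" where
  "event Q \<longleftrightarrow> (\<forall>q. Measurable.pred (bern (elements M) q) Q)"

lemma event_finitary: "finitary (elements M) Q \<Longrightarrow> event Q"
  using measurable_finitary[OF countable_elements] by (simp add: event_def)

lemma event_not: "event Q \<Longrightarrow> event (\<lambda>\<omega>. \<not> Q \<omega>)"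
  by (simp add: event_def pred_not)

lemma event_conj: "event Q \<Longrightarrow> event R \<Longrightarrow> event (\<lambda>\<omega>. Q \<omega> \<and> R \<omega>)"
  unfolding event_def using pred_intros_logic(3) by blast

lemma event_all: "(\<And>n::nat. event (Q n)) \<Longrightarrow> event (\<lambda>\<omega>. \<forall>n. Q n \<omega>)"
  unfolding event_def by (intro allI pred_intros_countable) blast

lemma event_ex: "(\<And>n::nat. event (Q n)) \<Longrightarrow> event (\<lambda>\<omega>. \<exists>n. Q n \<omega>)"
  unfolding event_def by (intro allI pred_intros_countable) blast

lemma event_bex: "finite A \<Longrightarrow> (\<And>a. a \<in> A \<Longrightarrow> event (Q a)) \<Longrightarrow> event (\<lambda>\<omega>. \<exists>a\<in>A. Q a \<omega>)"
  unfolding event_def by (intro allI pred_intros_finite) blast+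

lemma perc_prob_mono: "event R \<Longrightarrow> (\<And>\<omega>. Q \<omega> \<Longrightarrow> R \<omega>) \<Longrightarrow> perc_prob q Q \<le> perc_prob q R"
  unfolding perc_prob_def by (rule bern_prob_mono) (auto simp: event_def)

lemma perc_prob_bounds: "0 \<le> perc_prob q Q" "perc_prob q Q \<le> 1"
  by (simp_all add: perc_prob_def bern_prob_nonneg bern_prob_le_1)

lemma perc_prob_or:
  assumes "event Q" "event R"
  shows "perc_prob q (\<lambda>\<omega>. Q \<omega> \<or> R \<omega>) \<le> perc_prob q Q + perc_prob q R"
proof -
  let ?B = "bern (elements M) (\<lambda>e. q (centroid e))"
  interpret prob_space ?B by (rule prob_space_bern)
  have "{\<omega>\<in>space ?B. Q \<omega> \<or> R \<omega>} = {\<omega>\<in>space ?B. Q \<omega>} \<union> {\<omega>\<in>space ?B. R \<omega>}" by auto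
  thus ?thesis unfolding perc_prob_def bern_prob_def using assms
    by (simp add: event_def pred_def measure_Un_le)
qed

lemma perc_prob_bex:
  assumes "finite A" "\<And>a. a \<in> A \<Longrightarrow> event (Q a)"
  shows "perc_prob q (\<lambda>\<omega>. \<exists>a\<in>A. Q a \<omega>) \<le> (\<Sum>a\<in>A. perc_prob q (Q a))"
proof -
  let ?B = "bern (elements M) (\<lambda>e. q (centroid e))"
  interpret prob_space ?B by (rule prob_space_bern)
  have "{\<omega>\<in>space ?B. \<exists>a\<in>A. Q a \<omega>} = (\<Union>a\<in>A. {\<omega>\<in>space ?B. Q a \<omega>})" by auto
  moreover have "measure ?B (\<Union>a\<in>A. {\<omega>\<in>space ?B. Q a \<omega>}) \<le> (\<Sum>a\<in>A. measure ?B {\<omega>\<in>space ?B. Q a \<omega>})"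
    using assms by (intro finite_measure_subadditive_finite) (auto simp: event_def pred_def)
  ultimately show ?thesis unfolding perc_prob_def bern_prob_def by simp
qed

lemma perc_prob_ex:
  assumes "\<And>n::nat. event (Q n)" "\<And>n. perc_prob q (Q n) \<le> f n" "summable f"
  shows "perc_prob q (\<lambda>\<omega>. \<exists>n. Q n \<omega>) \<le> suminf f"
proof -
  let ?B = "bern (elements M) (\<lambda>e. q (centroid e))"
  interpret prob_space ?B by (rule prob_space_bern)
  have sum: "summable (\<lambda>n. perc_prob q (Q n))"
    by (rule summable_comparison_test'[OF assms(3)]) (use assms(2) perc_prob_bounds in auto)
  have "{\<omega>\<in>space ?B. \<exists>n. Q n \<omega>} = (\<Union>n. {\<omega>\<in>space ?B. Q n \<omega>})" by auto
  hence "perc_prob q (\<lambda>\<omega>. \<exists>n. Q n \<omega>) = measure ?B (\<Union>n. {\<omega>\<in>space ?B. Q n \<omega>})"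
    unfolding perc_prob_def bern_prob_def by simp
  also have "\<dots> \<le> (\<Sum>n. measure ?B {\<omega>\<in>space ?B. Q n \<omega>})"
    using assms(1) sum
    by (intro finite_measure_subadditive_countably) (auto simp: event_def pred_def perc_prob_def bern_prob_def)
  also have "\<dots> = (\<Sum>n. perc_prob q (Q n))" by (simp add: perc_prob_def bern_prob_def)
  also have "\<dots> \<le> suminf f" using assms sum by (intro suminf_le) auto
  finally show ?thesis .
qed

lemma perc_prob_Harris:
  assumes "finitary (elements M) Q" "finitary (elements M) R" "\<And>z. 0 \<le> q z \<and> q z \<le> 1"
  shows "perc_prob q Q * perc_prob q R \<le> perc_prob q (\<lambda>\<omega>. Q \<omega> \<and> R \<omega>)"
  unfolding perc_prob_def using assms by (intro Harris countable_elements) auto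

lemma perc_prob_translate:
  assumes "finitary (elements M) Q" "t \<in> trans"
  shows "perc_prob (\<lambda>_. p) (\<lambda>\<omega>. Q (\<lambda>e. \<omega> ((+) t ` e))) = perc_prob (\<lambda>_. p) Q"
  unfolding perc_prob_def using assms
  by (intro bern_prob_reindex countable_elements elements_translate) auto

text \<open>The configuration with everything occupied provides a finite certificate, whose
  probability is increasing in \<open>p\<close>.\<close>

lemma perc_prob_witness:
  assumes "finitary (elements M) Q" "Q (\<lambda>_. True)" "0 < p0"
  shows "\<exists>c>0. \<forall>p. p0 \<le> p \<and> p \<le> 1 \<longrightarrow> c \<le> perc_prob (\<lambda>_. p) Q"
proof -
  obtain W where W: "finite W" "W \<subseteq> elements M" "forces W Q"
    using finitary_witness[OF assms(1,2)] by metis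
  have "p0 ^ card W \<le> perc_prob (\<lambda>_. p) Q" if "p0 \<le> p" "p \<le> 1" for p
  proof -
    have "p0 ^ card W \<le> p ^ card W" using that assms(3) by (intro power_mono) auto
    also have "\<dots> = (\<Prod>e\<in>W. p)" by simp
    also have "\<dots> \<le> perc_prob (\<lambda>_. p) Q"
      unfolding perc_prob_def using assms that W by (intro bern_prob_forces[of _ Q W "\<lambda>_. p"] countable_elements) auto
    finally show ?thesis .
  qed
  thus ?thesis using assms(3) by (intro exI[of _ "p0 ^ card W"]) auto
qed

section \<open>Connections over a given distance\<close>

definition reach :: "complex \<Rightarrow> real \<Rightarrow> (complex set \<Rightarrow> bool) \<Rightarrow> bool" where
  "reach z R \<omega> \<longleftrightarrow> (\<exists>v. joined_in M \<omega> UNIV z v \<and> R \<le> lnorm M (v - z))"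

lemma finitary_reach: "finitary (elements M) (reach z R)"
  unfolding reach_def[abs_def]
  by (intro finitary_ex finitary_conj finitary_joined_in finitary_const)

text \<open>Up to the first time it is at distance \<open>R\<close>, a path uses only elements
  within \<open>R + bond_bound\<close> of its starting point.\<close>

lemma reach_local:
  assumes "reach z R \<omega>" "0 \<le> R"
  shows "reach z R (\<lambda>e. \<omega> e \<and> lnorm M (centroid e - z) \<le> R + bond_bound)"
proof -
  define \<omega>' where "\<omega>' e \<longleftrightarrow> \<omega> e \<and> lnorm M (centroid e - z) \<le> R + bond_bound" for e
  obtain v where v: "joined_in M \<omega> UNIV z v" "R \<le> lnorm M (v - z)" using assms(1) by (auto simp: reach_def)
  have z: "z \<in> sites M" "kind M = Site \<Longrightarrow> \<omega> {z}" using v(1) by (auto simp: joined_in_def)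
  have cz: "z \<in> cluster \<omega>' z"
    using z assms(2) bond_bound(1) by (simp add: cluster_def joined_in_def \<omega>'_def centroid_def)
  let ?R = "{(x, y). {x, y} \<in> bonds M \<and> y \<in> UNIV \<and> (case kind M of Site \<Rightarrow> \<omega> {y} | Bond \<Rightarrow> \<omega> {x, y})}"
  have "(z, v) \<in> ?R\<^sup>*" using v(1) by (simp add: joined_in_def)
  \<comment> \<open>Along the path, either the restricted configuration still connects or it has
    already reached distance \<open>R\<close>.\<close>
  hence "v \<in> cluster \<omega>' z \<or> reach z R \<omega>'"
  proof (induction rule: rtrancl_induct)
    case (step x y)
    have xy: "{x, y} \<in> bonds M" using step(2) by simp
    show ?case
    proof (cases "x \<in> cluster \<omega>' z \<and> lnorm M (x - z) < R")
      case True
      have 1: "lnorm M (centroid {x, y} - z) \<le> R + bond_bound"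
        using True bond_near(1)[OF xy, of "centroid {x, y}"] centroid_bond_hull[OF xy]
          lnorm_triangle'[of "centroid {x, y}" z x] by simp
      have 2: "lnorm M (centroid {y} - z) \<le> R + bond_bound"
        using True bond_bound(2)[OF xy] lnorm_commute[of x y] lnorm_triangle'[of y z x] by (simp add: centroid_def)
      have "y \<in> cluster \<omega>' z"
      proof (rule cluster_step)
        show "x \<in> cluster \<omega>' z" using True ..
        show "\<omega>' {y}" if "kind M = Site" using step(2) that 2 by (simp add: \<omega>'_def)
        show "\<omega>' {x, y}" if "kind M = Bond" using step(2) that 1 by (simp add: \<omega>'_def)
      qed (rule xy)
      thus ?thesis ..
    next
      case False
      thus ?thesis using step(3) by (auto simp: reach_def cluster_def)
    qed
  qed (use cz in simp)
  hence "reach z R \<omega>'" using v(2) by (auto simp: reach_def cluster_def)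
  moreover have "\<omega>' = (\<lambda>e. \<omega> e \<and> lnorm M (centroid e - z) \<le> R + bond_bound)"
    by (simp add: fun_eq_iff \<omega>'_def)
  ultimately show ?thesis by simp
qed

lemma perc_prob_restrict_mono:
  assumes "finitary (elements M) Q" "\<And>z. 0 \<le> q z \<and> q z \<le> 1" "\<And>z. 0 \<le> q' z \<and> q' z \<le> 1"
    and "\<And>x. lnorm M (x - z) \<le> R \<Longrightarrow> q x \<le> q' x"
  shows "perc_prob q (\<lambda>\<omega>. Q (\<lambda>e. \<omega> e \<and> lnorm M (centroid e - z) \<le> R)) \<le> perc_prob q' Q"
  using bern_prob_mono_density[OF countable_elements assms(1), of "\<lambda>e. q (centroid e)" "\<lambda>e. q' (centroid e)"
    "{e. lnorm M (centroid e - z) \<le> R}"] assms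
  unfolding perc_prob_def by auto

text \<open>The comparison of the inhomogeneous model with homogeneous ones, in both directions: the
  densities need to be ordered only where \<open>reach\<close> looks.\<close>

lemma perc_prob_reach_mono:
  assumes "0 \<le> R" "\<And>z. 0 \<le> q z \<and> q z \<le> 1" "\<And>z. 0 \<le> q' z \<and> q' z \<le> 1"
    and "\<And>x. lnorm M (x - z) \<le> R + bond_bound \<Longrightarrow> q x \<le> q' x"
  shows "perc_prob q (reach z R) \<le> perc_prob q' (reach z R)"
proof -
  have "perc_prob q (reach z R) \<le>
      perc_prob q (\<lambda>\<omega>. reach z R (\<lambda>e. \<omega> e \<and> lnorm M (centroid e - z) \<le> R + bond_bound))"
    using reach_local assms(1)
    by (intro perc_prob_mono event_finitary finitary_restrict[where B = "{e. lnorm M (centroid e - z) \<le> _}", simplified] finitary_reach) auto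
  also have "\<dots> \<le> perc_prob q' (reach z R)"
    by (rule perc_prob_restrict_mono[OF finitary_reach assms(2-4)])
  finally show ?thesis .
qed

lemma reach_translate:
  assumes t: "t \<in> trans"
  shows "perc_prob (\<lambda>_. p) (reach (t + z) R) = perc_prob (\<lambda>_. p) (reach z R)"
proof -
  have "reach z R (\<lambda>e. \<omega> ((+) t ` e)) = reach (t + z) R \<omega>" for \<omega>
  proof -
    have "reach z R (\<lambda>e. \<omega> ((+) t ` e)) = (\<exists>v. joined_in M \<omega> UNIV (t + z) (t + v) \<and> R \<le> lnorm M (t + v - (t + z)))"
      by (simp add: reach_def joined_in_translate[OF t])
    also have "\<dots> = (\<exists>v. joined_in M \<omega> UNIV (t + z) v \<and> R \<le> lnorm M (v - (t + z)))"
      by (metis add.commute diff_add_cancel)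
    finally show ?thesis by (simp add: reach_def)
  qed
  with perc_prob_translate[OF finitary_reach t, of p z R] show ?thesis by simp
qed

lemma finite_uniform_bound:
  fixes Q :: "'b \<Rightarrow> real \<Rightarrow> bool"
  assumes "finite A" "\<And>a. a \<in> A \<Longrightarrow> \<exists>c>0. Q a c" "\<And>a c c'. Q a c \<Longrightarrow> c' \<le> c \<Longrightarrow> Q a c'"
  shows "\<exists>c>0. \<forall>a\<in>A. Q a c"
  using assms(1,2)
proof (induction A rule: finite_induct)
  case empty show ?case by (intro exI[of _ 1]) simp
next
  case (insert a A)
  have "\<exists>c>0. \<forall>a\<in>A. Q a c" using insert.prems by (intro insert.IH) simp
  then obtain c where "c > 0" and c: "\<forall>a\<in>A. Q a c" by blast
  have "\<exists>c>0. Q a c" by (rule insert.prems) simp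
  then obtain c' where "c' > 0" and c': "Q a c'" by blast
  have "Q a (min c c')" by (rule assms(3)[OF c']) simp
  moreover have "\<forall>b\<in>A. Q b (min c c')"
  proof
    fix b assume "b \<in> A"
    with c have "Q b c" ..
    thus "Q b (min c c')" by (rule assms(3)) simp
  qed
  ultimately have "\<forall>b\<in>insert a A. Q b (min c c')" by simp
  moreover have "0 < min c c'" using \<open>c > 0\<close> \<open>c' > 0\<close> by simp
  ultimately show ?case by blast
qed

text \<open>Sites in different positions relative to the lattice of translations are compared by means of
  the Harris inequality.\<close>

lemma reach_from_site:
  assumes "0 < p0"
  obtains c where "c > 0"
    "\<And>z p R. z \<in> sites M \<Longrightarrow> p0 \<le> p \<Longrightarrow> p \<le> 1 \<Longrightarrow>
       c * perc_prob (\<lambda>_. p) (reach z (R + 1)) \<le> perc_prob (\<lambda>_. p) (reach 0 R)"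
proof -
  have "\<exists>c>0. \<forall>u\<in>cell. \<forall>p. p0 \<le> p \<and> p \<le> 1 \<longrightarrow> c \<le> perc_prob (\<lambda>_. p) (\<lambda>\<omega>. joined_in M \<omega> UNIV 0 u)"
  proof (rule finite_uniform_bound[OF finite_cell])
    fix u assume "u \<in> cell"
    thus "\<exists>c>0. \<forall>p. p0 \<le> p \<and> p \<le> 1 \<longrightarrow> c \<le> perc_prob (\<lambda>_. p) (\<lambda>\<omega>. joined_in M \<omega> UNIV 0 u)"
      using zero_site by (intro perc_prob_witness finitary_joined_in joined_in_all assms) (auto simp: cell_def)
  qed (meson order_trans)
  then obtain c where c: "c > 0"
    "\<And>u p. u \<in> cell \<Longrightarrow> p0 \<le> p \<Longrightarrow> p \<le> 1 \<Longrightarrow> c \<le> perc_prob (\<lambda>_. p) (\<lambda>\<omega>. joined_in M \<omega> UNIV 0 u)"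
    by blast
  show ?thesis
  proof (rule that[OF c(1)])
    fix z p R assume z: "z \<in> sites M" and p: "p0 \<le> p" "p \<le> 1"
    obtain t u where t: "t \<in> trans" "u \<in> cell" "z = t + u" using z by (rule site_cell)
    let ?P = "perc_prob (\<lambda>_. p)"
    have "c * ?P (reach z (R + 1)) \<le> ?P (\<lambda>\<omega>. joined_in M \<omega> UNIV 0 u) * ?P (reach u (R + 1))"
      unfolding t(3) reach_translate[OF t(1)] using c(2)[OF t(2) p] perc_prob_bounds by (intro mult_right_mono)
    also have "\<dots> \<le> ?P (\<lambda>\<omega>. joined_in M \<omega> UNIV 0 u \<and> reach u (R + 1) \<omega>)"
      using p assms by (intro perc_prob_Harris finitary_joined_in finitary_reach) auto
    also have "\<dots> \<le> ?P (reach 0 R)"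
    proof (rule perc_prob_mono[OF event_finitary[OF finitary_reach]])
      fix \<omega> assume "joined_in M \<omega> UNIV 0 u \<and> reach u (R + 1) \<omega>"
      then obtain v where v: "joined_in M \<omega> UNIV 0 u" "joined_in M \<omega> UNIV u v" "R + 1 \<le> lnorm M (v - u)"
        unfolding reach_def by blast
      have "joined_in M \<omega> UNIV 0 v" using v(1,2) by (rule joined_in_trans)
      moreover have "lnorm M (v - u) \<le> lnorm M v + lnorm M u"
        using lnorm_triangle[of v "- u"] lnorm_minus[of u] by simp
      ultimately show "reach 0 R \<omega>"
        using t(2) v(3) unfolding reach_def cell_def by (intro exI[of _ v]) simp
    qed
    finally show "c * ?P (reach z (R + 1)) \<le> ?P (reach 0 R)" .
  qed
qed

text \<open>A rhombus holds finitely many sites, so the infinite clusters are the unbounded ones.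
  This turns the event into a countable intersection of finitary events.\<close>

lemma cluster_infinite_iff:
  assumes "z \<in> sites M"
  shows "connects_to_infinity M \<omega> z \<longleftrightarrow> (\<forall>n::nat. reach z (real n) \<omega>)"
proof
  assume inf: "connects_to_infinity M \<omega> z"
  show "\<forall>n::nat. reach z (real n) \<omega>"
  proof (rule ccontr)
    assume "\<not> ?thesis"
    then obtain n where n: "\<not> reach z (real n) \<omega>" by blast
    have "cluster \<omega> z \<subseteq> {v\<in>sites M. lnorm M (v - z) \<le> real n}"
      using n cluster_sites by (fastforce simp: reach_def cluster_def)
    hence "finite (cluster \<omega> z)" using finite_sites_lnorm finite_subset by blast
    thus False using inf by (simp add: connects_to_infinity_iff)
  qed
next
  assume r: "\<forall>n::nat. reach z (real n) \<omega>"
  show "connects_to_infinity M \<omega> z"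
    unfolding connects_to_infinity_iff
  proof
    assume "finite (cluster \<omega> z)"
    hence "bdd_above ((\<lambda>v. lnorm M (v - z)) ` cluster \<omega> z)" by (intro bdd_above_finite) auto
    then obtain B where B: "\<And>v. v \<in> cluster \<omega> z \<Longrightarrow> lnorm M (v - z) \<le> B" by (auto simp: bdd_above_def)
    obtain n :: nat where "B < real n" using reals_Archimedean2 by blast
    thus False using B r[rule_format, of n] by (fastforce simp: reach_def cluster_def)
  qed
qed

lemma event_infinite: "z \<in> sites M \<Longrightarrow> event (\<lambda>\<omega>. connects_to_infinity M \<omega> z)"
  by (simp add: cluster_infinite_iff event_all event_finitary finitary_reach)

lemma infinite_le_reach:
  assumes "z \<in> sites M"
  shows "perc_prob q (\<lambda>\<omega>. connects_to_infinity M \<omega> z) \<le> perc_prob q (reach z R)"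
proof (rule perc_prob_mono[OF event_finitary[OF finitary_reach]])
  fix \<omega> assume inf: "connects_to_infinity M \<omega> z"
  obtain n :: nat where "R \<le> real n" using real_arch_simple by blast
  with inf show "reach z R \<omega>"
    unfolding cluster_infinite_iff[OF assms] reach_def by (meson order_trans)
qed

text \<open>Reaching far and belonging to an infinite cluster differ only by large finite clusters,
  whose probability is estimated below through dual connections.\<close>

lemma reach_le_infinite:
  assumes "z \<in> sites M"
  shows "perc_prob q (reach z R) \<le> perc_prob q (\<lambda>\<omega>. connects_to_infinity M \<omega> z) +
    perc_prob q (\<lambda>\<omega>. reach z R \<omega> \<and> \<not> connects_to_infinity M \<omega> z)"
proof -
  have "perc_prob q (reach z R) \<le> perc_prob q (\<lambda>\<omega>. connects_to_infinity M \<omega> z \<or>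
      (reach z R \<omega> \<and> \<not> connects_to_infinity M \<omega> z))"
  proof (rule perc_prob_mono)
    have "event (\<lambda>\<omega>. \<not> (\<not> connects_to_infinity M \<omega> z \<and> \<not> reach z R \<omega>))"
      using assms by (intro event_not event_conj event_infinite event_finitary finitary_reach)
    moreover have "(\<lambda>\<omega>. \<not> (\<not> connects_to_infinity M \<omega> z \<and> \<not> reach z R \<omega>)) =
        (\<lambda>\<omega>. connects_to_infinity M \<omega> z \<or> (reach z R \<omega> \<and> \<not> connects_to_infinity M \<omega> z))" by blast
    ultimately show "event (\<lambda>\<omega>. connects_to_infinity M \<omega> z \<or> (reach z R \<omega> \<and> \<not> connects_to_infinity M \<omega> z))"
      by simp
  qed blast
  also have "\<dots> \<le> perc_prob q (\<lambda>\<omega>. connects_to_infinity M \<omega> z) +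
    perc_prob q (\<lambda>\<omega>. reach z R \<omega> \<and> \<not> connects_to_infinity M \<omega> z)"
    using assms by (intro perc_prob_or event_infinite event_conj event_not event_finitary finitary_reach)
  finally show ?thesis .
qed

section \<open>Probabilities of dual connections\<close>

definition dual_prob :: "real \<Rightarrow> complex set \<Rightarrow> complex set \<Rightarrow> real" where
  "dual_prob p d d' = perc_prob (\<lambda>_. p) (\<lambda>\<omega>. dual_joined_in M \<omega> UNIV d d')"

lemma perc_prob_flip:
  assumes "finitary (elements M) Q" "\<And>z. 0 \<le> q z \<and> q z \<le> 1"
  shows "perc_prob q (\<lambda>\<omega>. Q (\<lambda>e. \<not> \<omega> e)) = perc_prob (\<lambda>z. 1 - q z) Q"
  unfolding perc_prob_def using assms by (intro bern_prob_flip countable_elements) auto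

lemma dual_prob_eq:
  assumes "0 \<le> p" "p \<le> 1"
  shows "dual_prob p d d' = perc_prob (\<lambda>_. 1 - p) (\<lambda>\<eta>. dual_joined_in M (\<lambda>e. \<not> \<eta> e) UNIV d d')"
  using perc_prob_flip[OF finitary_dual_joined_in, of "\<lambda>_. p" UNIV d d'] assms by (simp add: dual_prob_def)

text \<open>The Harris inequality for the vacant elements.\<close>

lemma dual_prob_trans:
  assumes "0 \<le> p" "p \<le> 1"
  shows "dual_prob p d d' * dual_prob p d' d'' \<le> dual_prob p d d''"
proof -
  let ?Q = "\<lambda>d d' \<eta>. dual_joined_in M (\<lambda>e. \<not> \<eta> e) UNIV d d'" and ?P = "perc_prob (\<lambda>_. 1 - p)"
  have "?P (?Q d d') * ?P (?Q d' d'') \<le> ?P (\<lambda>\<eta>. ?Q d d' \<eta> \<and> ?Q d' d'' \<eta>)"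
    using assms by (intro perc_prob_Harris finitary_dual_joined_in) auto
  also have "\<dots> \<le> ?P (?Q d d'')"
    by (intro perc_prob_mono event_finitary finitary_dual_joined_in) (blast intro: dual_joined_in_trans)
  finally show ?thesis using assms by (simp add: dual_prob_eq)
qed

lemma dual_prob_translate:
  assumes "t \<in> trans" "0 \<le> p" "p \<le> 1"
  shows "dual_prob p ((+) t ` d) ((+) t ` d') = dual_prob p d d'"
  using perc_prob_translate[OF finitary_dual_joined_in assms(1), of "1 - p" UNIV d d']
    dual_joined_in_translate[OF assms(1), of "\<lambda>e. \<not> _ e"] assms(2,3) by (simp add: dual_prob_eq)

lemma dual_origin: "dual_origin M \<in> dual_sites M"
  using planar by (simp add: planar_lattice_def)

text \<open>Dual sites need not be translates of the dual origin. Each is linked to a nearby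
  translate at a cost that is uniform in \<open>p \<le> p1\<close>, since an element is vacant with
  probability at least \<open>1 - p1 > 0\<close>. The two directions serve the start and the end of
  a dual path.\<close>

lemma dual_local:
  assumes "0 \<le> p1" "p1 < 1"
  obtains c K where "c > 0" "K > 0"
    "\<And>d. d \<in> dual_sites M \<Longrightarrow> \<exists>t\<in>trans. lnorm M (dual_position M d - t) \<le> K \<and>
       (\<forall>p. 0 \<le> p \<and> p \<le> p1 \<longrightarrow> c \<le> dual_prob p ((+) t ` dual_origin M) d \<and> c \<le> dual_prob p d ((+) t ` dual_origin M))"
proof -
  let ?o = "dual_origin M"
  obtain D where D: "finite D" "D \<subseteq> dual_sites M"
    "\<And>d. d \<in> dual_sites M \<Longrightarrow> \<exists>t\<in>trans. \<exists>d0\<in>D. d = (+) t ` d0" by (rule dual_orbits) (rule that; blast)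
  have w: "\<exists>c>0. \<forall>p. 0 \<le> p \<and> p \<le> p1 \<longrightarrow> c \<le> dual_prob p d d'"
    if d: "d \<in> dual_sites M" "d' \<in> dual_sites M" for d d'
  proof -
    have "\<exists>c>0. \<forall>p. 1 - p1 \<le> p \<and> p \<le> 1 \<longrightarrow>
      c \<le> perc_prob (\<lambda>_. p) (\<lambda>\<eta>. dual_joined_in M (\<lambda>e. \<not> \<eta> e) UNIV d d')"
      using d assms by (intro perc_prob_witness finitary_dual_joined_in dual_joined_in_none) auto
    then obtain c where c: "c > 0" "\<And>p. 1 - p1 \<le> p \<Longrightarrow> p \<le> 1 \<Longrightarrow>
      c \<le> perc_prob (\<lambda>_. p) (\<lambda>\<eta>. dual_joined_in M (\<lambda>e. \<not> \<eta> e) UNIV d d')" by blast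
    show ?thesis using c assms by (intro exI[of _ c]) (simp add: dual_prob_eq)
  qed
  have "\<exists>c>0. \<forall>d\<in>D. \<forall>p. 0 \<le> p \<and> p \<le> p1 \<longrightarrow> c \<le> dual_prob p ?o d \<and> c \<le> dual_prob p d ?o"
  proof (rule finite_uniform_bound[OF D(1)])
    fix d assume "d \<in> D"
    hence d: "d \<in> dual_sites M" using D(2) by blast
    obtain c c' where "c > 0" "\<And>p. 0 \<le> p \<and> p \<le> p1 \<Longrightarrow> c \<le> dual_prob p ?o d"
      "c' > 0" "\<And>p. 0 \<le> p \<and> p \<le> p1 \<Longrightarrow> c' \<le> dual_prob p d ?o"
      using w[OF dual_origin d] w[OF d dual_origin] by metis
    thus "\<exists>c>0. \<forall>p. 0 \<le> p \<and> p \<le> p1 \<longrightarrow> c \<le> dual_prob p ?o d \<and> c \<le> dual_prob p d ?o"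
      by (intro exI[of _ "min c c'"]) (auto simp: min_le_iff_disj)
  qed (meson order_trans)
  then obtain c where c: "c > 0" "\<And>d p. d \<in> D \<Longrightarrow> 0 \<le> p \<Longrightarrow> p \<le> p1 \<Longrightarrow> c \<le> dual_prob p ?o d \<and> c \<le> dual_prob p d ?o"
    by blast
  define K where "K = Max (insert 1 ((\<lambda>d. lnorm M (dual_position M d)) ` D))"
  have K: "lnorm M (dual_position M d) \<le> K" if "d \<in> D" for d
    unfolding K_def using D(1) that by (intro Max_ge) auto
  have "1 \<le> K" unfolding K_def using D(1) by (intro Max_ge) auto
  show ?thesis
  proof (rule that[OF c(1)])
    show "K > 0" using \<open>1 \<le> K\<close> by simp
    fix d assume "d \<in> dual_sites M"
    then obtain t d0 where t: "t \<in> trans" "d0 \<in> D" "d = (+) t ` d0" using D(3) by blast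
    have "dual_position M d = t + dual_position M d0"
      using t D(2) by (auto intro: dual_position_translate)
    moreover have "c \<le> dual_prob p ((+) t ` ?o) d \<and> c \<le> dual_prob p d ((+) t ` ?o)" if "0 \<le> p" "p \<le> p1" for p
      using c(2)[OF t(2) that] dual_prob_translate[OF t(1)] that assms by (simp add: t(3))
    ultimately show "\<exists>t\<in>trans. lnorm M (dual_position M d - t) \<le> K \<and>
       (\<forall>p. 0 \<le> p \<and> p \<le> p1 \<longrightarrow> c \<le> dual_prob p ((+) t ` ?o) d \<and> c \<le> dual_prob p d ((+) t ` ?o))"
      using K[OF t(2)] t(1) by (intro bexI[of _ t]) auto
  qed
qed

lemma tau_star_ge:
  assumes "d \<in> dual_sites M" "\<bar>lnorm M (dual_position M d) - real n\<bar> \<le> 1"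
  shows "dual_prob p (dual_origin M) d \<le> tau_star M p n"
  unfolding tau_star_def dual_prob_def hom_prob_eq
  by (rule cSUP_upper[where f = "\<lambda>d. perc_prob (\<lambda>_. p) (\<lambda>\<omega>. dual_joined_in M \<omega> UNIV (dual_origin M) d)"])
    (use assms perc_prob_bounds in \<open>auto intro!: bdd_aboveI\<close>)

text \<open>The Harris inequality makes the dual connectivity supermultiplicative along multiples of
  \<open>t\<close>, so that it is bounded by its rate of decay.\<close>

lemma dual_prob_decay:
  assumes "is_correlation_length M pc \<xi>" "pc < p" "p < 1" "0 \<le> p" "t \<in> trans"
  shows "dual_prob p (dual_origin M) ((+) t ` dual_origin M) \<le> exp (- lnorm M t / \<xi> p)"
proof (cases "t = 0 \<or> dual_prob p (dual_origin M) ((+) t ` dual_origin M) = 0")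
  case True
  thus ?thesis using perc_prob_bounds by (auto simp: dual_prob_def)
next
  case False
  let ?o = "dual_origin M"
  define \<theta> where "\<theta> = dual_prob p ?o ((+) t ` ?o)"
  have \<theta>: "0 < \<theta>" "\<theta> \<le> 1"
    using False perc_prob_bounds by (auto simp: \<theta>_def dual_prob_def order_less_le)
  have s: "0 < lnorm M t"
    using False norm_le_lnorm[of t] by (smt (verit) norm_le_zero_iff)
  define b where "b = lnorm M (dual_position M ?o)"
  have pow: "\<theta> ^ k \<le> dual_prob p ?o ((+) (of_nat k * t) ` ?o)" if "k > 0" for k
    using that
  proof (induction k rule: nat_induct_non_zero)
    case 1 show ?case by (simp add: \<theta>_def)
  next
    case (Suc k)
    have kt: "of_nat k * t \<in> trans" using assms(5) by (rule trans_mult)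
    have "\<theta> ^ Suc k \<le> dual_prob p ?o ((+) (of_nat k * t) ` ?o) *
        dual_prob p ((+) (of_nat k * t) ` ?o) ((+) (of_nat k * t) ` (+) t ` ?o)"
      using Suc(2) \<theta> dual_prob_translate[OF kt] assms by (simp add: \<theta>_def[symmetric] mult.commute)
    also have "\<dots> \<le> dual_prob p ?o ((+) (of_nat k * t) ` (+) t ` ?o)"
      using assms by (intro dual_prob_trans) auto
    also have "(+) (of_nat k * t) ` (+) t ` ?o = (+) (of_nat (Suc k) * t) ` ?o"
      by (simp add: image_image algebra_simps)
    finally show ?case .
  qed
  \<comment> \<open>The norm of the position of the \<open>k\<close>-th translate is rounded down,
    to an argument of \<open>tau_star\<close> whose window of width 1 contains this
    translate.\<close>
  define n where "n k = nat \<lfloor>lnorm M (of_nat k * t + dual_position M ?o)\<rfloor>" for k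
  have n_ge: "real k * lnorm M t - b - 1 \<le> real (n k)" for k
  proof -
    have "lnorm M (of_nat k * t) = real k * lnorm M t"
      using lnorm_scaleR[of "real k" t] by (simp add: scaleR_conv_of_real)
    moreover have "lnorm M (of_nat k * t) \<le> lnorm M (of_nat k * t + dual_position M ?o) + b"
      using lnorm_triangle[of "of_nat k * t + dual_position M ?o" "- dual_position M ?o"]
        lnorm_minus[of "dual_position M ?o"] by (simp add: b_def)
    moreover have "lnorm M (of_nat k * t + dual_position M ?o) \<le> real (n k) + 1"
      unfolding n_def using lnorm_nonneg[of "of_nat k * t + dual_position M ?o"] by linarith
    ultimately show ?thesis by linarith
  qed
  have "filterlim (\<lambda>k. real k * lnorm M t - b - 1) at_top sequentially"
    using s by real_asymp
  hence "filterlim (\<lambda>k. real (n k)) at_top sequentially"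
    by (rule filterlim_at_top_mono) (simp add: n_ge)
  hence nlim: "filterlim n at_top sequentially"
    by (simp add: filterlim_sequentially_iff_filterlim_real)
  have "(\<lambda>n. root n (tau_star M p n)) \<longlonglongrightarrow> exp (- 1 / \<xi> p)"
    using assms(1-3) by (simp add: is_correlation_length_def)
  hence lim: "(\<lambda>k. root (n k) (tau_star M p (n k))) \<longlonglongrightarrow> exp (- 1 / \<xi> p)"
    using nlim by (rule filterlim_compose)
  \<comment> \<open>The dual origin is displaced by \<open>b\<close> and the rounding costs 1;
    neither affects the limit.\<close>
  have "((\<lambda>k. real k / (real k * lnorm M t - b - 1)) \<longlongrightarrow> inverse (lnorm M t)) sequentially"
    using s by real_asymp
  hence lim2: "(\<lambda>k. \<theta> powr (real k / (real k * lnorm M t - b - 1))) \<longlonglongrightarrow> \<theta> powr (1 / lnorm M t)"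
    unfolding inverse_eq_divide using \<theta> by (intro tendsto_powr) auto
  have ev: "\<forall>\<^sub>F k in sequentially. \<theta> powr (real k / (real k * lnorm M t - b - 1)) \<le> root (n k) (tau_star M p (n k))"
  proof -
    have "\<forall>\<^sub>F k in sequentially. real k * lnorm M t - b - 1 > 0"
      using s by real_asymp
    thus ?thesis using eventually_gt_at_top[of 0]
    proof eventually_elim
      case (elim k)
      have n0: "0 < n k" using n_ge[of k] elim(1) by (cases "n k") auto
      have kt: "of_nat k * t \<in> trans" using assms(5) by (rule trans_mult)
      have "\<theta> powr (real k / (real k * lnorm M t - b - 1)) \<le> \<theta> powr (real k / real (n k))"
        using \<theta> n_ge[of k] elim n0 by (intro powr_mono' divide_left_mono mult_pos_pos) auto
      also have "\<dots> = root (n k) (\<theta> ^ k)"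
        using \<theta> n0 by (simp add: root_powr_inverse powr_realpow[symmetric] powr_powr)
      also have "\<dots> \<le> root (n k) (dual_prob p ?o ((+) (of_nat k * t) ` ?o))"
        using pow elim(2) n0 by simp
      also have "\<dots> \<le> root (n k) (tau_star M p (n k))"
      proof -
        have "\<bar>lnorm M (dual_position M ((+) (of_nat k * t) ` ?o)) - real (n k)\<bar> \<le> 1"
          unfolding dual_position_translate[OF kt dual_origin] n_def
          using lnorm_nonneg[of "of_nat k * t + dual_position M ?o"] by linarith
        thus ?thesis using n0 dual_sites_translate[OF kt dual_origin] by (simp add: tau_star_ge)
      qed
      finally show ?case .
    qed
  qed
  have "\<theta> powr (1 / lnorm M t) \<le> exp (- 1 / \<xi> p)"
    by (rule tendsto_le[OF sequentially_bot lim lim2 ev])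
  hence "(\<theta> powr (1 / lnorm M t)) powr lnorm M t \<le> exp (- 1 / \<xi> p) powr lnorm M t"
    using s by (intro powr_mono2) auto
  thus ?thesis using s \<theta> by (simp add: powr_powr \<theta>_def[symmetric] powr_def[of "exp _"])
qed

text \<open>Both dual sites are moved to translates of the dual origin. This costs a factor
  \<open>1 / c\<^sup>2\<close> and changes the distance by at most \<open>2 * K\<close>, which
  alters the exponential by a bounded factor because \<open>\<xi> p1 \<le> \<xi> p\<close>.\<close>

lemma dual_prob_bound:
  assumes "is_correlation_length M pc \<xi>" "antimono_on {pc<..1} \<xi>" "0 \<le> pc" "pc < p1" "p1 < 1"
  obtains C where "C > 0" "\<And>p d d'. pc < p \<Longrightarrow> p \<le> p1 \<Longrightarrow> d \<in> dual_sites M \<Longrightarrow> d' \<in> dual_sites M \<Longrightarrow>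
    dual_prob p d d' \<le> C * exp (- lnorm M (dual_position M d' - dual_position M d) / \<xi> p)"
proof -
  let ?o = "dual_origin M"
  have p10: "0 \<le> p1" using assms(3,4) by simp
  obtain c K where c: "c > 0" "K > 0"
    "\<And>d. d \<in> dual_sites M \<Longrightarrow> \<exists>t\<in>trans. lnorm M (dual_position M d - t) \<le> K \<and>
       (\<forall>p. 0 \<le> p \<and> p \<le> p1 \<longrightarrow> c \<le> dual_prob p ((+) t ` ?o) d \<and> c \<le> dual_prob p d ((+) t ` ?o))"
    by (rule dual_local[OF p10 assms(5)]) (rule that; blast)
  have \<xi>: "\<xi> p > 0" if "pc < p" "p < 1" for p using assms(1) that by (simp add: is_correlation_length_def)
  show ?thesis
  proof (rule that)
    show "exp (2 * K / \<xi> p1) / c\<^sup>2 > 0" using c by simp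
    fix p d d' assume p: "pc < p" "p \<le> p1" and d: "d \<in> dual_sites M" "d' \<in> dual_sites M"
    have p01: "0 \<le> p" "p \<le> 1" "p < 1" using p assms by auto
    obtain t where t: "t \<in> trans" "lnorm M (dual_position M d - t) \<le> K" "c \<le> dual_prob p ((+) t ` ?o) d"
      using c(3)[OF d(1)] p01 p by blast
    obtain t' where t': "t' \<in> trans" "lnorm M (dual_position M d' - t') \<le> K" "c \<le> dual_prob p d' ((+) t' ` ?o)"
      using c(3)[OF d(2)] p01 p by blast
    have nn: "0 \<le> dual_prob p a b" for a b by (simp add: dual_prob_def perc_prob_bounds)
    have "c * dual_prob p d d' * c \<le> dual_prob p ((+) t ` ?o) d * dual_prob p d d' * dual_prob p d' ((+) t' ` ?o)"
      using t t' nn c by (intro mult_mono) auto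
    also have "\<dots> \<le> dual_prob p ((+) t ` ?o) d' * dual_prob p d' ((+) t' ` ?o)"
      using nn p01 by (intro mult_right_mono dual_prob_trans) auto
    also have "\<dots> \<le> dual_prob p ((+) t ` ?o) ((+) t' ` ?o)"
      using p01 by (intro dual_prob_trans) auto
    also have "(+) t' ` ?o = (+) t ` (+) (t' - t) ` ?o" by (simp add: image_image)
    also have "dual_prob p ((+) t ` ?o) ((+) t ` (+) (t' - t) ` ?o) = dual_prob p ?o ((+) (t' - t) ` ?o)"
      using t p01 by (intro dual_prob_translate) auto
    also have "\<dots> \<le> exp (- lnorm M (t' - t) / \<xi> p)"
      using assms p p01 t t' by (intro dual_prob_decay trans_diff) auto
    also have "\<dots> \<le> exp (2 * K / \<xi> p1) * exp (- lnorm M (dual_position M d' - dual_position M d) / \<xi> p)"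
    proof -
      let ?l = "lnorm M (dual_position M d' - dual_position M d)"
      have "?l \<le> lnorm M (t' - t) + 2 * K"
        using lnorm_triangle'[of "dual_position M d'" "dual_position M d" t'] t(2) t'(2)
          lnorm_triangle'[of t' "dual_position M d" t] lnorm_commute[of t "dual_position M d"] by linarith
      hence "- lnorm M (t' - t) / \<xi> p \<le> (2 * K - ?l) / \<xi> p"
        using \<xi>[OF p(1) p01(3)] by (intro divide_right_mono) auto
      also have "\<dots> = 2 * K / \<xi> p - ?l / \<xi> p" by (simp add: diff_divide_distrib)
      also have "2 * K / \<xi> p \<le> 2 * K / \<xi> p1"
      proof -
        have "\<xi> p1 \<le> \<xi> p" using assms(2,4,5) p by (auto simp: monotone_on_def)
        thus ?thesis using \<xi>[OF assms(4,5)] c(2) by (intro divide_left_mono) auto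
      qed
      finally have "- lnorm M (t' - t) / \<xi> p \<le> 2 * K / \<xi> p1 + - ?l / \<xi> p" by simp
      thus ?thesis unfolding exp_add[symmetric] by simp
    qed
    finally show "dual_prob p d d' \<le> exp (2 * K / \<xi> p1) / c\<^sup>2 * exp (- lnorm M (dual_position M d' - dual_position M d) / \<xi> p)"
      using c(1) by (simp add: field_simps power2_eq_square)
  qed
qed

end


section \<open>Large finite clusters, and the one-arm probability\<close>

context lattice begin

lemma card_dual_sites:
  obtains C where "C > 0"
    "\<forall>z R. 0 \<le> R \<longrightarrow> finite {d\<in>dual_sites M. lnorm M (dual_position M d - z) \<le> R} \<and>
       real (card {d\<in>dual_sites M. lnorm M (dual_position M d - z) \<le> R}) \<le> C * (R + 1)\<^sup>2"
proof -
  obtain D where D: "finite D" "D \<subseteq> dual_sites M"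
    "\<And>d. d \<in> dual_sites M \<Longrightarrow> \<exists>t\<in>trans. \<exists>d0\<in>D. d = (+) t ` d0" by (rule dual_orbits) (rule that; blast)
  obtain C where C: "C > 0" "\<And>z R. 0 \<le> R \<Longrightarrow> real (card {v\<in>sites M. lnorm M (v - z) \<le> R}) \<le> C * (R + 1)\<^sup>2"
    using card_sites_lnorm by blast
  let ?S = "\<lambda>z R. {d\<in>dual_sites M. lnorm M (dual_position M d - z) \<le> R}"
  let ?T = "\<lambda>z R. {v\<in>sites M. lnorm M (v - z) \<le> R}"
  have "finite (?S z R) \<and> real (card (?S z R)) \<le> (real (card D) * C + 1) * (R + 1)\<^sup>2" if R: "0 \<le> R" for z R
  proof -
    let ?U = "SIGMA d0:D. ?T (z - dual_position M d0) R"
    have "?S z R \<subseteq> (\<lambda>(d0, t). (+) t ` d0) ` ?U"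
    proof
      fix d assume d: "d \<in> ?S z R"
      then obtain t d0 where t: "t \<in> trans" "d0 \<in> D" "d = (+) t ` d0" using D(3) by blast
      have "dual_position M d = t + dual_position M d0" using t D(2) by (auto intro: dual_position_translate)
      hence "(d0, t) \<in> ?U" using d t by (simp add: trans_site algebra_simps)
      thus "d \<in> (\<lambda>(d0, t). (+) t ` d0) ` ?U" using t(3) by force
    qed
    moreover have fin: "finite ?U" using D(1) finite_sites_lnorm by blast
    ultimately have "finite (?S z R)" "card (?S z R) \<le> card ?U"
      by (meson finite_imageI finite_subset, meson surj_card_le)
    moreover have "real (card ?U) = (\<Sum>d0\<in>D. real (card (?T (z - dual_position M d0) R)))"
      using D(1) finite_sites_lnorm by simp
    moreover have "\<dots> \<le> (\<Sum>d0\<in>D. C * (R + 1)\<^sup>2)" using C(2)[OF R] by (rule sum_mono)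
    ultimately have "finite (?S z R)" "real (card (?S z R)) \<le> real (card D) * C * (R + 1)\<^sup>2" by auto
    moreover have "real (card D) * C * (R + 1)\<^sup>2 \<le> (real (card D) * C + 1) * (R + 1)\<^sup>2"
      by (simp add: distrib_right)
    ultimately show ?thesis by linarith
  qed
  moreover have "0 < real (card D) * C + 1" using C(1) by (simp add: add_nonneg_pos)
  ultimately show ?thesis using that by blast
qed

text \<open>With everything outside the rhombus declared occupied, the dual path depends on vacant
  elements only where \<open>q\<close> is at least \<open>p\<close>.\<close>

lemma restricted_dual_le:
  assumes "\<And>x. 0 \<le> q x \<and> q x \<le> 1" "0 \<le> p" "p \<le> 1" "\<And>x. lnorm M (x - z) \<le> R \<Longrightarrow> p \<le> q x"
  shows "perc_prob q (\<lambda>\<omega>. dual_joined_in M (\<lambda>e. \<omega> e \<or> \<not> lnorm M (centroid e - z) \<le> R) UNIV d d') \<le> dual_prob p d d'"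
proof -
  define Q where "Q \<eta> = dual_joined_in M (\<lambda>e. \<not> \<eta> e) UNIV d d'" for \<eta>
  have fin: "finitary (elements M) Q" unfolding Q_def[abs_def] by (rule finitary_dual_joined_in)
  have fin': "finitary (elements M) (\<lambda>\<eta>. Q (\<lambda>e. \<eta> e \<and> lnorm M (centroid e - z) \<le> R))"
    using finitary_restrict[OF fin, of "{e. lnorm M (centroid e - z) \<le> R}"] by simp
  have "perc_prob q (\<lambda>\<omega>. dual_joined_in M (\<lambda>e. \<omega> e \<or> \<not> lnorm M (centroid e - z) \<le> R) UNIV d d') =
      perc_prob q (\<lambda>\<omega>. Q (\<lambda>e. \<not> \<omega> e \<and> lnorm M (centroid e - z) \<le> R))"
    by (simp add: Q_def)
  also have "\<dots> = perc_prob (\<lambda>x. 1 - q x) (\<lambda>\<eta>. Q (\<lambda>e. \<eta> e \<and> lnorm M (centroid e - z) \<le> R))"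
    using perc_prob_flip[OF fin' assms(1)] by simp
  also have "\<dots> \<le> perc_prob (\<lambda>_. 1 - p) Q"
    using assms by (intro perc_prob_restrict_mono fin) auto
  also have "\<dots> = dual_prob p d d'" using assms(2,3) by (simp add: dual_prob_eq Q_def[abs_def])
  finally show ?thesis .
qed

text \<open>The event is decreasing in \<open>\<omega>\<close>, so its measurability comes from
  composing a finitary event with the exchange of occupied and vacant.\<close>

lemma event_dual: "event (\<lambda>\<omega>. dual_joined_in M (\<lambda>e. \<omega> e \<or> B e) UNIV d d')"
proof -
  define Q where "Q \<eta> = dual_joined_in M (\<lambda>e. \<not> \<eta> e) UNIV d d'" for \<eta>
  have "finitary (elements M) (\<lambda>\<eta>. Q (\<lambda>e. \<eta> e \<and> e \<in> {e. \<not> B e}))"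
    unfolding Q_def[abs_def] by (intro finitary_restrict finitary_dual_joined_in)
  hence fin: "finitary (elements M) (\<lambda>\<eta>. Q (\<lambda>e. \<eta> e \<and> \<not> B e))" by simp
  show ?thesis
    unfolding event_def
  proof
    fix q
    let ?T = "\<lambda>\<omega>. \<lambda>e\<in>elements M. \<not> \<omega> e"
    have T: "?T \<in> measurable (bern (elements M) q) (bern (elements M) q)"
      unfolding bern_def by (intro measurable_restrict) measurable
    have "Measurable.pred (bern (elements M) q) (\<lambda>\<omega>. Q (\<lambda>e. ?T \<omega> e \<and> \<not> B e))"
      by (rule measurable_compose[OF T measurable_finitary[OF countable_elements fin]])
    moreover have "Q (\<lambda>e. ?T \<omega> e \<and> \<not> B e) = Q (\<lambda>e. \<not> \<omega> e \<and> \<not> B e)" for \<omega>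
      by (rule finitary_cong[OF fin]) simp
    ultimately show "Measurable.pred (bern (elements M) q) (\<lambda>\<omega>. dual_joined_in M (\<lambda>e. \<omega> e \<or> B e) UNIV d d')"
      by (simp add: Q_def)
  qed
qed

text \<open>Finite clusters are sorted by the integer part \<open>m\<close> of their radius, and
  then by the pair of dual sites joined by the surrounding path, for which there are
  \<open>O(m ^ 4)\<close> choices. The comparison density \<open>p\<close> may depend on
  \<open>m\<close>, because in the inhomogeneous model larger regions contain lower
  densities.\<close>

lemma finite_cluster_union_bound:
  assumes "is_correlation_length M pc \<xi>" "antimono_on {pc<..1} \<xi>" "0 \<le> pc" "pc < p1" "p1 < 1"
  obtains K C where "K > 0" "C > 0"
    "\<forall>q z N g. z \<in> sites M \<longrightarrow> (\<forall>x. 0 \<le> q x \<and> q x \<le> 1) \<longrightarrow> summable g \<longrightarrow> (\<forall>m. 0 \<le> g m) \<longrightarrow>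
       (\<forall>m\<ge>N. \<exists>p>pc. p \<le> p1 \<and> (\<forall>x. lnorm M (x - z) \<le> real m + K \<longrightarrow> p \<le> q x) \<and>
          C * (real m + 1) ^ 4 * exp (- (real m - K) / \<xi> p) \<le> g m) \<longrightarrow>
       perc_prob q (\<lambda>\<omega>. reach z (real N) \<omega> \<and> \<not> connects_to_infinity M \<omega> z) \<le> suminf g"
proof -
  obtain K0 where K0: "K0 > 0" "\<forall>\<omega>. \<forall>z\<in>sites M. \<forall>v\<in>cluster \<omega> z. finite (cluster \<omega> z) \<longrightarrow>
     (\<forall>u\<in>cluster \<omega> z. lnorm M (u - z) \<le> lnorm M (v - z)) \<longrightarrow>
     (\<exists>d\<in>dual_sites M. \<exists>d'\<in>dual_sites M.
        lnorm M (dual_position M d - z) \<le> lnorm M (v - z) + K0 \<and>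
        lnorm M (dual_position M d' - z) \<le> lnorm M (v - z) + K0 \<and>
        lnorm M (v - z) - K0 \<le> lnorm M (dual_position M d' - dual_position M d) \<and>
        dual_joined_in M (\<lambda>e. \<omega> e \<or> \<not> lnorm M (centroid e - z) \<le> lnorm M (v - z) + K0) UNIV d d')"
    using finite_cluster_surrounded by blast
  obtain C1 where C1: "C1 > 0" "\<forall>z R. 0 \<le> R \<longrightarrow> finite {d\<in>dual_sites M. lnorm M (dual_position M d - z) \<le> R} \<and>
       real (card {d\<in>dual_sites M. lnorm M (dual_position M d - z) \<le> R}) \<le> C1 * (R + 1)\<^sup>2"
    by (rule card_dual_sites)
  obtain C2 where C2: "C2 > 0" "\<And>p d d'. pc < p \<Longrightarrow> p \<le> p1 \<Longrightarrow> d \<in> dual_sites M \<Longrightarrow> d' \<in> dual_sites M \<Longrightarrow>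
    dual_prob p d d' \<le> C2 * exp (- lnorm M (dual_position M d' - dual_position M d) / \<xi> p)"
    by (rule dual_prob_bound[OF assms]) (rule that; blast)
  \<comment> \<open>The radius exceeds its integer part by less than 1.\<close>
  define K where "K = K0 + 1"
  have K: "K > 0" using K0(1) by (simp add: K_def)
  define C where "C = C1\<^sup>2 * (K + 1) ^ 4 * C2"
  have \<xi>: "\<xi> p > 0" if "pc < p" "p \<le> p1" for p using assms(1,5) that by (simp add: is_correlation_length_def)
  show ?thesis
  proof (rule that)
    show "K > 0" by (rule K)
    show "C > 0" using C1(1) C2(1) K by (simp add: C_def)
    show "\<forall>q z N g. z \<in> sites M \<longrightarrow> (\<forall>x. 0 \<le> q x \<and> q x \<le> 1) \<longrightarrow> summable g \<longrightarrow> (\<forall>m. 0 \<le> g m) \<longrightarrow>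
       (\<forall>m\<ge>N. \<exists>p>pc. p \<le> p1 \<and> (\<forall>x. lnorm M (x - z) \<le> real m + K \<longrightarrow> p \<le> q x) \<and>
          C * (real m + 1) ^ 4 * exp (- (real m - K) / \<xi> p) \<le> g m) \<longrightarrow>
       perc_prob q (\<lambda>\<omega>. reach z (real N) \<omega> \<and> \<not> connects_to_infinity M \<omega> z) \<le> suminf g"
    proof (intro allI impI)
      fix q z N g
      assume z: "z \<in> sites M" and q: "\<forall>x. 0 \<le> q x \<and> q x \<le> 1" and g: "summable g" "\<forall>m. 0 \<le> g m"
        and gN: "\<forall>m\<ge>N. \<exists>p>pc. p \<le> p1 \<and> (\<forall>x. lnorm M (x - z) \<le> real m + K \<longrightarrow> p \<le> q x) \<and>
          C * (real m + 1) ^ 4 * exp (- (real m - K) / \<xi> p) \<le> g m"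
      define S where "S m = {d\<in>dual_sites M. lnorm M (dual_position M d - z) \<le> real m + K}" for m :: nat
      define T where "T m = {(d, d'). d \<in> S m \<and> d' \<in> S m \<and> real m - K \<le> lnorm M (dual_position M d' - dual_position M d)}" for m
      define J where "J m x \<omega> = dual_joined_in M (\<lambda>e. \<omega> e \<or> \<not> lnorm M (centroid e - z) \<le> real m + K) UNIV (fst x) (snd x)" for m x \<omega>
      have S: "finite (S m)" "real (card (S m)) \<le> C1 * (real m + K + 1)\<^sup>2" for m
        using C1(2)[rule_format, of "real m + K" z] K by (auto simp: S_def)
      have TS: "T m \<subseteq> S m \<times> S m" for m by (auto simp: T_def)
      hence finT: "finite (T m)" for m using S(1)[of m] by (meson finite_SigmaI finite_subset)
      have evJ: "event (J m x)" for m x unfolding J_def[abs_def] by (rule event_dual)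
      have "perc_prob q (\<lambda>\<omega>. reach z (real N) \<omega> \<and> \<not> connects_to_infinity M \<omega> z) \<le>
          perc_prob q (\<lambda>\<omega>. \<exists>m. N \<le> m \<and> (\<exists>x\<in>T m. J m x \<omega>))"
      proof (rule perc_prob_mono)
        show "event (\<lambda>\<omega>. \<exists>m. N \<le> m \<and> (\<exists>x\<in>T m. J m x \<omega>))"
          by (intro event_ex event_conj event_bex finT evJ event_finitary finitary_const)
        fix \<omega> assume r: "reach z (real N) \<omega> \<and> \<not> connects_to_infinity M \<omega> z"
        hence fin: "finite (cluster \<omega> z)" by (simp add: connects_to_infinity_iff)
        obtain v0 where v0: "v0 \<in> cluster \<omega> z" "real N \<le> lnorm M (v0 - z)"
          using r by (auto simp: reach_def cluster_def)
        define \<rho> where "\<rho> = Max ((\<lambda>v. lnorm M (v - z)) ` cluster \<omega> z)"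
        have le\<rho>: "lnorm M (u - z) \<le> \<rho>" if "u \<in> cluster \<omega> z" for u
          unfolding \<rho>_def using fin that by (intro Max_ge) auto
        have "\<rho> \<in> (\<lambda>v. lnorm M (v - z)) ` cluster \<omega> z"
          unfolding \<rho>_def using fin v0(1) by (intro Max_in) auto
        then obtain v where v: "v \<in> cluster \<omega> z" "lnorm M (v - z) = \<rho>" by auto
        have N\<rho>: "real N \<le> \<rho>" using le\<rho>[OF v0(1)] v0(2) by simp
        have "\<forall>u\<in>cluster \<omega> z. lnorm M (u - z) \<le> lnorm M (v - z)" using le\<rho> v(2) by simp
        from K0(2)[rule_format, OF z v(1) fin this[rule_format]] obtain d d' where
          d: "d \<in> dual_sites M" "d' \<in> dual_sites M" "lnorm M (dual_position M d - z) \<le> \<rho> + K0"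
            "lnorm M (dual_position M d' - z) \<le> \<rho> + K0"
            "\<rho> - K0 \<le> lnorm M (dual_position M d' - dual_position M d)"
            "dual_joined_in M (\<lambda>e. \<omega> e \<or> \<not> lnorm M (centroid e - z) \<le> \<rho> + K0) UNIV d d'"
          unfolding v(2) by blast
        define m where "m = nat \<lfloor>\<rho>\<rfloor>"
        have m: "N \<le> m" "real m \<le> \<rho>" "\<rho> < real m + 1" using N\<rho> unfolding m_def by linarith+
        have "(d, d') \<in> T m" using d m by (simp add: T_def S_def K_def)
        moreover have "J m (d, d') \<omega>"
        proof -
          \<comment> \<open>The radius \<open>\<rho>\<close> is replaced by its integer part:
            enlarging the region in which elements may be vacant keeps the dual path, so countably
            many events \<open>J m\<close> cover all radii.\<close>
          have *: "dual_joined_in M (\<lambda>e. \<not> (\<not> \<omega> e \<and> lnorm M (centroid e - z) \<le> \<rho> + K0)) UNIV d d'"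
            using d(6) by simp
          have "dual_joined_in M (\<lambda>e. \<not> (\<not> \<omega> e \<and> lnorm M (centroid e - z) \<le> real m + K)) UNIV d d'"
            using finitary_mono[where Q = "\<lambda>\<eta>. dual_joined_in M (\<lambda>e. \<not> \<eta> e) UNIV d d'"
                and \<omega> = "\<lambda>e. \<not> \<omega> e \<and> lnorm M (centroid e - z) \<le> \<rho> + K0"
                and \<omega>' = "\<lambda>e. \<not> \<omega> e \<and> lnorm M (centroid e - z) \<le> real m + K",
                OF finitary_dual_joined_in _ *] m by (simp add: K_def)
          thus ?thesis by (simp add: J_def)
        qed
        ultimately show "\<exists>m. N \<le> m \<and> (\<exists>x\<in>T m. J m x \<omega>)" using m(1) by blast
      qed
      also have "\<dots> \<le> suminf g"
      proof (rule perc_prob_ex[OF _ _ g(1)])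
        show "event (\<lambda>\<omega>. N \<le> m \<and> (\<exists>x\<in>T m. J m x \<omega>))" for m
          by (intro event_conj event_bex finT evJ event_finitary finitary_const)
        show "perc_prob q (\<lambda>\<omega>. N \<le> m \<and> (\<exists>x\<in>T m. J m x \<omega>)) \<le> g m" for m
        proof (cases "N \<le> m")
          case False
          hence "perc_prob q (\<lambda>\<omega>. N \<le> m \<and> (\<exists>x\<in>T m. J m x \<omega>)) = 0" by (simp add: perc_prob_def bern_prob_def)
          thus ?thesis using g(2) by simp
        next
          case True
          then obtain p where p: "pc < p" "p \<le> p1" "\<And>x. lnorm M (x - z) \<le> real m + K \<Longrightarrow> p \<le> q x"
            "C * (real m + 1) ^ 4 * exp (- (real m - K) / \<xi> p) \<le> g m" using gN by blast
          have "perc_prob q (\<lambda>\<omega>. N \<le> m \<and> (\<exists>x\<in>T m. J m x \<omega>)) = perc_prob q (\<lambda>\<omega>. \<exists>x\<in>T m. J m x \<omega>)"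
            using True by simp
          also have "\<dots> \<le> (\<Sum>x\<in>T m. perc_prob q (J m x))"
            by (intro perc_prob_bex finT evJ)
          also have "\<dots> \<le> (\<Sum>x\<in>T m. C2 * exp (- (real m - K) / \<xi> p))"
          proof (rule sum_mono)
            fix x assume x: "x \<in> T m"
            then obtain d d' where dd: "x = (d, d')" "d \<in> dual_sites M" "d' \<in> dual_sites M"
              "real m - K \<le> lnorm M (dual_position M d' - dual_position M d)" by (auto simp: T_def S_def)
            have "perc_prob q (J m x) \<le> dual_prob p d d'"
              unfolding J_def[abs_def] dd(1) fst_conv snd_conv
              using q p assms by (intro restricted_dual_le) auto
            also have "\<dots> \<le> C2 * exp (- lnorm M (dual_position M d' - dual_position M d) / \<xi> p)"
              by (rule C2(2)) (use p dd in auto)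
            also have "\<dots> \<le> C2 * exp (- (real m - K) / \<xi> p)"
            proof -
              have "- lnorm M (dual_position M d' - dual_position M d) / \<xi> p \<le> - (real m - K) / \<xi> p"
                using dd(4) \<xi>[OF p(1,2)] by (intro divide_right_mono) auto
              thus ?thesis using C2(1) by (intro mult_left_mono) simp_all
            qed
            finally show "perc_prob q (J m x) \<le> C2 * exp (- (real m - K) / \<xi> p)" .
          qed
          also have "\<dots> = real (card (T m)) * (C2 * exp (- (real m - K) / \<xi> p))" by simp
          also have "\<dots> \<le> (C1\<^sup>2 * ((K + 1) ^ 4 * (real m + 1) ^ 4)) * (C2 * exp (- (real m - K) / \<xi> p))"
          proof (rule mult_right_mono)
            have "card (T m) \<le> card (S m \<times> S m)" using TS S(1) by (intro card_mono) auto
            hence "real (card (T m)) \<le> real (card (S m)) * real (card (S m))"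
              by (simp only: card_cartesian_product of_nat_mult[symmetric] of_nat_le_iff)
            also have "\<dots> \<le> (C1 * (real m + K + 1)\<^sup>2) * (C1 * (real m + K + 1)\<^sup>2)"
              using S(2)[of m] C1(1) by (intro mult_mono) auto
            also have "\<dots> = C1\<^sup>2 * (real m + K + 1) ^ 4" by (simp add: power2_eq_square power4_eq_xxxx)
            also have "\<dots> \<le> C1\<^sup>2 * ((K + 1) * (real m + 1)) ^ 4"
            proof (intro mult_left_mono power_mono)
              have "real m + K + 1 + K * real m = (K + 1) * (real m + 1)" by (simp add: algebra_simps)
              moreover have "0 \<le> K * real m" using K by simp
              ultimately show "real m + K + 1 \<le> (K + 1) * (real m + 1)" by linarith
            qed (use K in auto)
            finally show "real (card (T m)) \<le> C1\<^sup>2 * ((K + 1) ^ 4 * (real m + 1) ^ 4)"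
              by (simp add: power_mult_distrib)
          qed (use C2(1) in simp)
          also have "\<dots> = C * (real m + 1) ^ 4 * exp (- (real m - K) / \<xi> p)"
            by (simp add: C_def algebra_simps)
          also have "\<dots> \<le> g m" by (rule p(4))
          finally show ?thesis .
        qed
      qed
      finally show "perc_prob q (\<lambda>\<omega>. reach z (real N) \<omega> \<and> \<not> connects_to_infinity M \<omega> z) \<le> suminf g" .
    qed
  qed
qed

text \<open>By \<open>w < 1\<close> the exponent grows like \<open>m powr (1 - w)\<close>, so the
  exponential absorbs every power of \<open>m\<close>.\<close>

lemma stretched_exponential_bound:
  fixes w \<kappa> K :: real
  assumes "0 < w" "w < 1" "0 < \<kappa>"
  obtains B where "B > 0"
    "\<forall>m::nat. (real m + 1) ^ 4 * exp (- (real m - K) / (\<kappa> * (real m + 1)) powr w) \<le> B / (real m + 1) ^ 5"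
proof -
  have "(\<lambda>m::nat. (real m + 1) ^ 9 * exp (- (real m - K) / (\<kappa> * (real m + 1)) powr w)) \<longlonglongrightarrow> 0"
    using assms by real_asymp
  hence "Bseq (\<lambda>m::nat. (real m + 1) ^ 9 * exp (- (real m - K) / (\<kappa> * (real m + 1)) powr w))"
    by (intro convergent_imp_Bseq convergentI)
  then obtain B where B: "B > 0" "\<And>m::nat. norm ((real m + 1) ^ 9 * exp (- (real m - K) / (\<kappa> * (real m + 1)) powr w)) \<le> B"
    by (rule BseqE) blast
  have "(real m + 1) ^ 4 * exp (- (real m - K) / (\<kappa> * (real m + 1)) powr w) \<le> B / (real m + 1) ^ 5" for m :: nat
  proof -
    let ?e = "exp (- (real m - K) / (\<kappa> * (real m + 1)) powr w)"
    have "(real m + 1) ^ 4 * ?e * (real m + 1) ^ 5 = (real m + 1) ^ 9 * ?e"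
      by (simp add: power_add[symmetric] mult.assoc mult.left_commute)
    also have "\<dots> \<le> B" using B(2)[of m] by (simp add: abs_mult)
    finally show ?thesis by (simp add: pos_le_divide_eq)
  qed
  thus ?thesis using that B(1) by blast
qed

text \<open>Of the five powers of \<open>1 / (m + 1)\<close> at hand, two make the sum over
  \<open>m\<close> converge and three are left for the bound.\<close>

lemma finite_cluster_decay:
  assumes "is_correlation_length M pc \<xi>" "antimono_on {pc<..1} \<xi>" "0 \<le> pc" "pc < p1" "p1 < 1"
    and w: "0 < w" "w < 1" "0 < \<kappa>"
  obtains K C where "K > 0" "C > 0"
    "\<forall>q z N. z \<in> sites M \<longrightarrow> (\<forall>x. 0 \<le> q x \<and> q x \<le> 1) \<longrightarrow>
       (\<forall>m\<ge>N. \<exists>p>pc. p \<le> p1 \<and> (\<forall>x. lnorm M (x - z) \<le> real m + K \<longrightarrow> p \<le> q x) \<and>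
          \<xi> p \<le> (\<kappa> * (real m + 1)) powr w) \<longrightarrow>
       perc_prob q (\<lambda>\<omega>. reach z (real N) \<omega> \<and> \<not> connects_to_infinity M \<omega> z) \<le> C / (real N + 1) ^ 3"
proof -
  obtain K C0 where KC: "K > 0" "C0 > 0"
    "\<forall>q z N g. z \<in> sites M \<longrightarrow> (\<forall>x. 0 \<le> q x \<and> q x \<le> 1) \<longrightarrow> summable g \<longrightarrow> (\<forall>m. 0 \<le> g m) \<longrightarrow>
       (\<forall>m\<ge>N. \<exists>p>pc. p \<le> p1 \<and> (\<forall>x. lnorm M (x - z) \<le> real m + K \<longrightarrow> p \<le> q x) \<and>
          C0 * (real m + 1) ^ 4 * exp (- (real m - K) / \<xi> p) \<le> g m) \<longrightarrow>
       perc_prob q (\<lambda>\<omega>. reach z (real N) \<omega> \<and> \<not> connects_to_infinity M \<omega> z) \<le> suminf g"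
    by (rule finite_cluster_union_bound[OF assms(1-5)])
  obtain B where B: "B > 0" "\<forall>m::nat. (real m + 1) ^ 4 * exp (- (real m - K) / (\<kappa> * (real m + 1)) powr w) \<le> B / (real m + 1) ^ 5"
    by (rule stretched_exponential_bound[OF w])
  \<comment> \<open>The second summand covers the finitely many \<open>m < K\<close>, where the
    exponent is positive and is controlled by \<open>\<xi> p1 \<le> \<xi> p\<close>.\<close>
  define B' where "B' = B + (K + 1) ^ 9 * exp (K / \<xi> p1)"
  have B': "B' > 0" "B \<le> B'" using B(1) KC(1) by (auto simp: B'_def add_pos_pos)
  define h where "h m = inverse ((real (Suc m))\<^sup>2)" for m
  have "summable (\<lambda>n. inverse (real n ^ 2))" by (rule inverse_power_summable) simp
  hence h: "summable h" "\<And>m. 0 \<le> h m"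
    unfolding h_def[abs_def] by (subst summable_Suc_iff[of "\<lambda>n. inverse (real n ^ 2)"]) auto
  define C where "C = C0 * B' * suminf h + 1"
  have \<xi>: "\<xi> p > 0" if "pc < p" "p \<le> p1" for p using assms(1,5) that by (simp add: is_correlation_length_def)
  show ?thesis
  proof (rule that[OF KC(1)])
    show "C > 0" using KC(2) B' suminf_nonneg[OF h] by (simp add: C_def add_nonneg_pos)
    show "\<forall>q z N. z \<in> sites M \<longrightarrow> (\<forall>x. 0 \<le> q x \<and> q x \<le> 1) \<longrightarrow>
       (\<forall>m\<ge>N. \<exists>p>pc. p \<le> p1 \<and> (\<forall>x. lnorm M (x - z) \<le> real m + K \<longrightarrow> p \<le> q x) \<and>
          \<xi> p \<le> (\<kappa> * (real m + 1)) powr w) \<longrightarrow>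
       perc_prob q (\<lambda>\<omega>. reach z (real N) \<omega> \<and> \<not> connects_to_infinity M \<omega> z) \<le> C / (real N + 1) ^ 3"
    proof (intro allI impI)
      fix q z and N :: nat
      assume z: "z \<in> sites M" and q: "\<forall>x. 0 \<le> q x \<and> q x \<le> 1"
        and ex: "\<forall>m\<ge>N. \<exists>p>pc. p \<le> p1 \<and> (\<forall>x. lnorm M (x - z) \<le> real m + K \<longrightarrow> p \<le> q x) \<and>
          \<xi> p \<le> (\<kappa> * (real m + 1)) powr w"
      define g where "g m = (C0 * B' / (real N + 1) ^ 3) * h m" for m
      have g: "summable g" "\<forall>m. 0 \<le> g m"
        using h KC(2) B' by (auto simp: g_def[abs_def] intro!: summable_mult)
      have "perc_prob q (\<lambda>\<omega>. reach z (real N) \<omega> \<and> \<not> connects_to_infinity M \<omega> z) \<le> suminf g"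
      proof (rule KC(3)[rule_format, OF z _ g(1)])
        fix m assume m: "N \<le> m"
        then obtain p where p: "pc < p" "p \<le> p1" "\<forall>x. lnorm M (x - z) \<le> real m + K \<longrightarrow> p \<le> q x"
          "\<xi> p \<le> (\<kappa> * (real m + 1)) powr w" using ex by blast
        have "(real m + 1) ^ 4 * exp (- (real m - K) / \<xi> p) \<le> B' / (real m + 1) ^ 5"
        proof (cases "K \<le> real m")
          case True
          have "(real m - K) / (\<kappa> * (real m + 1)) powr w \<le> (real m - K) / \<xi> p"
            using True p(4) \<xi>[OF p(1,2)] by (intro divide_left_mono mult_pos_pos) auto
          hence "- (real m - K) / \<xi> p \<le> - (real m - K) / (\<kappa> * (real m + 1)) powr w"
            by (simp only: minus_divide_left[symmetric] neg_le_iff_le)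
          hence "(real m + 1) ^ 4 * exp (- (real m - K) / \<xi> p) \<le>
              (real m + 1) ^ 4 * exp (- (real m - K) / (\<kappa> * (real m + 1)) powr w)"
            by (intro mult_left_mono) simp_all
          also have "\<dots> \<le> B / (real m + 1) ^ 5" using B(2) by blast
          also have "\<dots> \<le> B' / (real m + 1) ^ 5" using B' by (intro divide_right_mono) auto
          finally show ?thesis .
        next
          case False
          hence mK: "real m + 1 \<le> K + 1" by simp
          have "\<xi> p1 \<le> \<xi> p" using assms(2,4,5) p by (auto simp: monotone_on_def)
          hence "(K - real m) / \<xi> p \<le> K / \<xi> p1"
            using False \<xi>[of p1] assms(4) KC(1) by (intro frac_le) auto
          hence "(real m + 1) ^ 9 * exp (- (real m - K) / \<xi> p) \<le> (K + 1) ^ 9 * exp (K / \<xi> p1)"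
            using mK by (intro mult_mono power_mono) auto
          also have "\<dots> \<le> B'" using B(1) by (simp add: B'_def)
          finally have "(real m + 1) ^ 9 * exp (- (real m - K) / \<xi> p) \<le> B'" .
          moreover have "(real m + 1) ^ 9 * exp (- (real m - K) / \<xi> p) =
              (real m + 1) ^ 4 * exp (- (real m - K) / \<xi> p) * (real m + 1) ^ 5"
            using power_add[of "real m + 1" 4 5] by simp
          ultimately show ?thesis by (simp only: pos_le_divide_eq zero_less_power)
        qed
        hence "C0 * ((real m + 1) ^ 4 * exp (- (real m - K) / \<xi> p)) \<le> C0 * (B' / (real m + 1) ^ 5)"
          using KC(2) by (intro mult_left_mono) auto
        also have "C0 * (B' / (real m + 1) ^ 5) = C0 * B' / (real m + 1) ^ 3 * h m"
          by (simp add: h_def field_simps power_add[symmetric])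
        also have "\<dots> \<le> g m"
          unfolding g_def using m KC(2) B' h(2)
          by (intro mult_right_mono divide_left_mono power_mono mult_pos_pos) auto
        finally show "\<exists>p>pc. p \<le> p1 \<and> (\<forall>x. lnorm M (x - z) \<le> real m + K \<longrightarrow> p \<le> q x) \<and>
          C0 * (real m + 1) ^ 4 * exp (- (real m - K) / \<xi> p) \<le> g m"
          using p by (intro exI[of _ p]) (simp add: mult.assoc)
      qed (use q g in auto)
      also have "suminf g = (C0 * B' / (real N + 1) ^ 3) * suminf h"
        unfolding g_def[abs_def] by (rule suminf_mult[OF h(1)])
      also have "\<dots> \<le> C / (real N + 1) ^ 3"
        by (simp add: C_def divide_right_mono)
      finally show "perc_prob q (\<lambda>\<omega>. reach z (real N) \<omega> \<and> \<not> connects_to_infinity M \<omega> z) \<le> C / (real N + 1) ^ 3" .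
    qed
  qed
qed

text \<open>Where the crossing leaves the half plane \<open>coord1 M x \<le> 0\<close>, it is at a
  site within a bond length of the left side, and from there it still has to traverse the whole
  width of the square.\<close>

lemma crossing_reach:
  assumes "crossing M (real n) (real n) \<omega>" "1 \<le> n"
  shows "\<exists>x\<in>{v\<in>sites M. lnorm M (v - 0) \<le> real n + bond_bound}. reach x (real n) \<omega>"
proof -
  obtain u v where uv: "coord1 M u \<le> 0" "real n \<le> coord1 M v" "joined_in M \<omega> (strip M (real n)) u v"
    using assms(1) by (auto simp: crossing_def)
  let ?R = "\<lambda>S. {(x, y). {x, y} \<in> bonds M \<and> y \<in> S \<and> (case kind M of Site \<Rightarrow> \<omega> {y} | Bond \<Rightarrow> \<omega> {x, y})}"
  have path: "(u, v) \<in> (?R (strip M (real n)))\<^sup>*" "u \<in> sites M" "u \<in> strip M (real n)" "kind M = Site \<Longrightarrow> \<omega> {u}"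
    using uv(3) by (simp_all add: joined_in_def)
  have "\<not> coord1 M v \<le> 0" using uv(2) assms(2) by simp
  obtain x y where xy: "(u, x) \<in> (?R (strip M (real n)))\<^sup>*" "(x, y) \<in> ?R (strip M (real n))"
    "(y, v) \<in> (?R (strip M (real n)))\<^sup>*" "coord1 M x \<le> 0" "\<not> coord1 M y \<le> 0"
    by (rule rtrancl_exit[OF path(1), of "\<lambda>x. coord1 M x \<le> 0", OF uv(1) \<open>\<not> coord1 M v \<le> 0\<close>])
  have x: "x \<in> sites M" "x \<in> strip M (real n)" "kind M = Site \<Longrightarrow> \<omega> {x}"
    using xy(1) path(2-4) by (cases rule: rtranclE; auto dest: bond_sites)+
  have b: "{x, y} \<in> bonds M" using xy(2) by simp
  have "coord1 M y - coord1 M x \<le> bond_bound"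
    using coord_le_lnorm(1)[of "y - x"] bond_bound(2)[OF b] lnorm_commute[of x y] by (simp add: coord_diff)
  hence "lnorm M (x - 0) \<le> real n + bond_bound"
    using x(2) xy(4,5) bond_bound(1) by (simp add: lnorm_def strip_def)
  moreover have "reach x (real n) \<omega>"
  proof -
    have "(x, v) \<in> (?R (strip M (real n)))\<^sup>*" using xy(2,3) by (rule converse_rtrancl_into_rtrancl)
    moreover have "?R (strip M (real n)) \<subseteq> ?R UNIV" by auto
    ultimately have "(x, v) \<in> (?R UNIV)\<^sup>*" using rtrancl_mono by blast
    hence "joined_in M \<omega> UNIV x v" using x by (simp add: joined_in_def)
    moreover have "real n \<le> lnorm M (v - x)"
      using coord_le_lnorm(1)[of "v - x"] uv(2) xy(4) by (simp add: coord_diff)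
    ultimately show ?thesis by (auto simp: reach_def)
  qed
  ultimately show ?thesis using x(1) by blast
qed

text \<open>A crossing of a square of side \<open>n\<close> starts at one of \<open>O(n\<^sup>2)\<close> sites.\<close>

lemma one_arm_lower_bound:
  assumes "is_threshold M pc" "rsw_bounds M pc"
  obtains c where "c > 0"
    "\<forall>\<^sub>F n in sequentially. c / (real n + 1)\<^sup>2 \<le> perc_prob (\<lambda>_. pc) (reach 0 (real n - 1))"
proof -
  have pc: "0 < pc" "pc < 1" using assms(1) by (auto simp: is_threshold_def)
  from assms(2)[unfolded rsw_bounds_def, rule_format, OF zero_less_one] obtain c where "c > 0"
    and ev: "\<forall>\<^sub>F n in sequentially. hom_prob M pc (crossing M (1 * real n) (real n)) \<in> {c..1 - c} \<and>
      hom_prob M pc (dual_crossing M (1 * real n) (real n)) \<in> {c..1 - c}" by blast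
  have c: "c > 0" "\<forall>\<^sub>F n in sequentially. c \<le> hom_prob M pc (crossing M (1 * real n) (real n))"
    by (rule \<open>c > 0\<close>, rule eventually_mono[OF ev]) simp
  obtain c' where c': "c' > 0" "\<And>z p R. z \<in> sites M \<Longrightarrow> pc \<le> p \<Longrightarrow> p \<le> 1 \<Longrightarrow>
       c' * perc_prob (\<lambda>_. p) (reach z (R + 1)) \<le> perc_prob (\<lambda>_. p) (reach 0 R)"
    by (rule reach_from_site[OF pc(1)]) (rule that; blast)
  obtain C where C: "C > 0" "\<And>z R. 0 \<le> R \<Longrightarrow> real (card {v\<in>sites M. lnorm M (v - z) \<le> R}) \<le> C * (R + 1)\<^sup>2"
    using card_sites_lnorm by blast
  define D where "D = C * (bond_bound + 1)\<^sup>2"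
  have D: "D > 0" using C(1) bond_bound(1) by (simp add: D_def)
  show ?thesis
  proof (rule that)
    show "c * c' / D > 0" using c c' D by simp
    show "\<forall>\<^sub>F n in sequentially. c * c' / D / (real n + 1)\<^sup>2 \<le> perc_prob (\<lambda>_. pc) (reach 0 (real n - 1))"
      using c(2) eventually_ge_at_top[of 1]
    proof eventually_elim
      case (elim n)
      let ?P = "perc_prob (\<lambda>_. pc)"
      let ?V = "{v\<in>sites M. lnorm M (v - 0) \<le> real n + bond_bound}"
      have "c \<le> ?P (crossing M (real n) (real n))" using elim(1) by (simp add: hom_prob_eq)
      also have "\<dots> \<le> ?P (\<lambda>\<omega>. \<exists>x\<in>?V. reach x (real n) \<omega>)"
        using crossing_reach[OF _ elim(2)]
        by (intro perc_prob_mono event_bex finite_sites_lnorm event_finitary finitary_reach) blast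
      also have "\<dots> \<le> (\<Sum>x\<in>?V. ?P (reach x (real n)))"
        by (intro perc_prob_bex finite_sites_lnorm event_finitary finitary_reach)
      \<comment> \<open>Each starting site is traded for the origin, at the cost of the factor
        \<open>c'\<close> and of one unit of distance.\<close>
      also have "\<dots> \<le> (\<Sum>x\<in>?V. ?P (reach 0 (real n - 1)) / c')"
      proof (rule sum_mono)
        fix x assume "x \<in> ?V"
        hence "c' * ?P (reach x (real n)) \<le> ?P (reach 0 (real n - 1))"
          using c'(2)[of x pc "real n - 1"] pc by simp
        thus "?P (reach x (real n)) \<le> ?P (reach 0 (real n - 1)) / c'"
          using c'(1) by (simp add: pos_le_divide_eq mult.commute)
      qed
      also have "\<dots> = real (card ?V) * (?P (reach 0 (real n - 1)) / c')" by simp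
      also have "\<dots> \<le> (D * (real n + 1)\<^sup>2) * (?P (reach 0 (real n - 1)) / c')"
      proof (rule mult_right_mono)
        have "real (card ?V) \<le> C * (real n + bond_bound + 1)\<^sup>2" using bond_bound(1) by (intro C(2)) simp
        also have "\<dots> \<le> C * ((bond_bound + 1) * (real n + 1))\<^sup>2"
        proof (intro mult_left_mono power_mono)
          have "real n + bond_bound + 1 + bond_bound * real n = (bond_bound + 1) * (real n + 1)"
            by (simp add: algebra_simps)
          moreover have "0 \<le> bond_bound * real n" using bond_bound(1) by simp
          ultimately show "real n + bond_bound + 1 \<le> (bond_bound + 1) * (real n + 1)" by linarith
        qed (use C(1) bond_bound(1) in auto)
        finally show "real (card ?V) \<le> D * (real n + 1)\<^sup>2" by (simp add: D_def power_mult_distrib mult.assoc)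
      qed (use c'(1) perc_prob_bounds in simp)
      finally have "c * c' \<le> D * (real n + 1)\<^sup>2 * ?P (reach 0 (real n - 1))"
        using c'(1) by (simp add: pos_le_divide_eq)
      thus ?case using D by (simp add: pos_divide_le_eq mult.commute mult.left_commute mult.assoc)
    qed
  qed
qed

end


section \<open>Asymptotics of the expected number of sites\<close>

text \<open>Iteration gives a geometric series of ratio \<open>2 powr (- b)\<close>, which converges
  because \<open>b > 0\<close>.\<close>

lemma halving_recursion:
  fixes F :: "nat \<Rightarrow> real"
  assumes "0 < b" "0 \<le> A" "2 \<le> N0" "\<And>N. N0 \<le> N \<Longrightarrow> F N \<le> F (N div 2) + A * real N powr b"
  obtains B where "B > 0" "\<forall>N\<ge>1. F N \<le> B * real N powr b"
proof -
  define r where "r = 2 powr (- b)"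
  have r: "0 < r" "r < 1" using assms(1) by (auto simp: r_def powr_less_one)
  \<comment> \<open>The sum covers the values below \<open>N0\<close>; the last summand makes
    \<open>B * r + A \<le> B\<close>.\<close>
  define B where "B = 1 + (\<Sum>N<N0. \<bar>F N\<bar>) + A / (1 - r)"
  have "0 \<le> (\<Sum>N<N0. \<bar>F N\<bar>)" by (intro sum_nonneg) auto
  hence B1: "B \<ge> 1" "A / (1 - r) \<le> B" using assms(2) r by (auto simp: B_def)
  have "F N \<le> B * real N powr b" if "N \<ge> 1" for N
    using that
  proof (induction N rule: less_induct)
    case (less N)
    have one: "1 \<le> real N powr b" using less.prems assms(1) by (intro ge_one_powr_ge_zero) auto
    show ?case
    proof (cases "N < N0")
      case True
      have "F N \<le> \<bar>F N\<bar>" by simp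
      also have "\<dots> \<le> (\<Sum>N<N0. \<bar>F N\<bar>)" using True by (intro member_le_sum) auto
      also have "\<dots> \<le> B" using assms(2) r by (simp add: B_def)
      also have "\<dots> \<le> B * real N powr b" using B1(1) one by (simp add: mult_le_cancel_left1)
      finally show ?thesis .
    next
      case False
      hence N: "N0 \<le> N" "2 \<le> N" using assms(3) by auto
      have "F (N div 2) \<le> B * real (N div 2) powr b" using N by (intro less.IH) auto
      also have "\<dots> \<le> B * (real N / 2) powr b"
        using B1 assms(1) by (intro mult_left_mono powr_mono2) (auto simp: real_of_nat_div)
      also have "\<dots> = B * r * real N powr b"
        using N by (simp add: powr_divide r_def powr_minus field_simps)
      finally have "F N \<le> (B * r + A) * real N powr b"
        using assms(4)[OF N(1)] by (simp add: distrib_right)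
      also have "\<dots> \<le> B * real N powr b"
      proof (rule mult_right_mono)
        have "A \<le> B * (1 - r)" using B1(2) r by (simp add: pos_divide_le_eq)
        thus "B * r + A \<le> B" by (simp add: algebra_simps)
      qed simp
      finally show ?thesis .
    qed
  qed
  thus ?thesis using that B1 by (meson less_le_trans zero_less_one)
qed

text \<open>Positivity of \<open>\<theta>\<close> keeps the denominator
  \<open>\<theta> * ln N\<close> away from 0, so an error \<open>\<eta>\<close> in the exponent
  becomes a relative error \<open>\<eta> / \<theta>\<close>.\<close>

lemma log_equiv_powrI:
  fixes f :: "nat \<Rightarrow> real"
  assumes \<theta>: "0 < \<theta>"
    and lower: "\<And>\<eta>. 0 < \<eta> \<Longrightarrow> \<forall>\<^sub>F N in sequentially. real N powr (\<theta> - \<eta>) \<le> f N"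
    and upper: "\<And>\<eta>. 0 < \<eta> \<Longrightarrow> \<forall>\<^sub>F N in sequentially. f N \<le> real N powr (\<theta> + \<eta>)"
  shows "log_equiv sequentially f (\<lambda>N. real N powr \<theta>)"
  unfolding log_equiv_def
proof (rule tendstoI)
  fix \<epsilon> :: real assume \<epsilon>: "0 < \<epsilon>"
  define \<eta> where "\<eta> = \<theta> * \<epsilon> / 2"
  have \<eta>: "0 < \<eta>" "\<eta> / \<theta> < \<epsilon>" using \<theta> \<epsilon> by (auto simp: \<eta>_def)
  show "\<forall>\<^sub>F N in sequentially. dist (ln (f N) / ln (real N powr \<theta>)) 1 < \<epsilon>"
    using lower[OF \<eta>(1)] upper[OF \<eta>(1)] eventually_ge_at_top[of 2]
  proof eventually_elim
    case (elim N)
    have N: "0 < ln (real N)" using elim(3) by simp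
    have "0 < real N powr (\<theta> - \<eta>)" using elim(3) by simp
    hence f: "0 < f N" using elim(1) by linarith
    have "(\<theta> - \<eta>) * ln (real N) \<le> ln (f N)"
      using ln_mono[OF elim(1)] elim(3) f by (simp add: ln_powr)
    moreover have "ln (f N) \<le> (\<theta> + \<eta>) * ln (real N)"
      using ln_mono[OF elim(2) f] elim(3) by (simp add: ln_powr)
    ultimately have "\<bar>ln (f N) - \<theta> * ln (real N)\<bar> \<le> \<eta> * ln (real N)" by (simp add: algebra_simps abs_le_iff)
    hence "\<bar>ln (f N) - \<theta> * ln (real N)\<bar> / (\<theta> * ln (real N)) \<le> \<eta> / \<theta>"
      using N \<theta> by (simp add: field_simps)
    moreover have "ln (f N) / (\<theta> * ln (real N)) - 1 = (ln (f N) - \<theta> * ln (real N)) / (\<theta> * ln (real N))"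
      using N \<theta> by (simp add: field_simps)
    ultimately have "\<bar>ln (f N) / (\<theta> * ln (real N)) - 1\<bar> \<le> \<eta> / \<theta>"
      using N \<theta> by (simp add: abs_mult)
    thus ?case using \<eta>(2) elim(3) by (simp add: dist_real_def ln_powr)
  qed
qed

context lattice begin

lemma expected_cluster_count:
  "(\<integral>\<omega>. real (cluster_count M N \<omega>) \<partial>percolation M q) =
    (\<Sum>z\<in>{z\<in>sites M. lnorm M z \<le> real N}. perc_prob q (\<lambda>\<omega>. connects_to_infinity M \<omega> z))"
proof -
  let ?B = "bern (elements M) (\<lambda>e. q (centroid e))"
  interpret prob_space ?B by (rule prob_space_bern)
  let ?S = "{z\<in>sites M. lnorm M z \<le> real N}"
  let ?A = "\<lambda>z. {\<omega>\<in>space ?B. connects_to_infinity M \<omega> z}"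
  have fin: "finite ?S" using finite_sites_lnorm[of 0 "real N"] by simp
  have A: "?A z \<in> sets ?B" if "z \<in> ?S" for z
    using event_infinite[of z] that by (simp add: event_def pred_def)
  have "(\<integral>\<omega>. real (cluster_count M N \<omega>) \<partial>?B) = (\<integral>\<omega>. (\<Sum>z\<in>?S. indicator (?A z) \<omega>) \<partial>?B)"
  proof (rule Bochner_Integration.integral_cong[OF refl])
    fix \<omega> assume \<omega>: "\<omega> \<in> space ?B"
    have "{z \<in> sites M \<inter> rhombus M (real N). connects_to_infinity M \<omega> z} = {z\<in>?S. \<omega> \<in> ?A z}"
      using \<omega> by (auto simp: rhombus_def)
    thus "real (cluster_count M N \<omega>) = (\<Sum>z\<in>?S. indicator (?A z) \<omega>)"
      using fin by (simp add: cluster_count_def indicator_def sum.If_cases Int_def)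
  qed
  also have "\<dots> = (\<Sum>z\<in>?S. \<integral>\<omega>. indicator (?A z) \<omega> \<partial>?B)"
    using A by (intro Bochner_Integration.integral_sum) (auto simp: emeasure_eq_measure)
  also have "\<dots> = (\<Sum>z\<in>?S. perc_prob q (\<lambda>\<omega>. connects_to_infinity M \<omega> z))"
  proof (rule sum.cong[OF refl])
    fix z assume "z \<in> ?S"
    have "?A z \<inter> space ?B = ?A z" by auto
    thus "(\<integral>\<omega>. indicator (?A z) \<omega> \<partial>?B) = perc_prob q (\<lambda>\<omega>. connects_to_infinity M \<omega> z)"
      by (simp add: perc_prob_def bern_prob_def)
  qed
  finally show ?thesis by (simp add: percolation_bern)
qed

text \<open>Translates of the origin are numerous enough for the lower bound, and for them
  homogeneous probabilities agree with those at the origin without any loss of constants.\<close>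

lemma card_trans: "real N ^ 2 \<le> real (card {t\<in>trans. lnorm M t \<le> real N})"
proof -
  let ?T = "{t\<in>trans. lnorm M t \<le> real N}"
  have fin: "finite ?T"
    by (rule finite_subset[OF _ finite_sites_lnorm[of 0 "real N"]]) (use trans_site in auto)
  have sub: "(\<lambda>(a, b). lat (int a) (int b)) ` ({1..N} \<times> {1..N}) \<subseteq> ?T"
    by (auto simp: lnorm_def)
  have inj: "inj_on (\<lambda>(a, b). lat (int a) (int b)) ({1..N} \<times> {1..N})"
  proof (rule inj_onI, clarify)
    fix a b c d :: nat assume "lat (int a) (int b) = lat (int c) (int d)"
    from arg_cong[OF this, of "coord1 M"] arg_cong[OF this, of "coord2 M"] show "a = c \<and> b = d" by simp
  qed
  have "card ({1..N} \<times> {1..N}) \<le> card ?T" using card_mono[OF fin sub] unfolding card_image[OF inj] .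
  hence "N * N \<le> card ?T" by (simp add: card_cartesian_product)
  hence "real (N * N) \<le> real (card ?T)" by (rule of_nat_mono)
  thus ?thesis by (simp add: power2_eq_square)
qed

end

section \<open>The density as a function of the correlation length\<close>

locale scaling = lattice +
  fixes pc \<nu> \<beta> :: real and \<xi> \<alpha> :: "real \<Rightarrow> real"
  assumes threshold: "is_threshold M pc"
    and correlation_length: "is_correlation_length M pc \<xi>"
    and xi_antimono: "antimono_on {pc<..1} \<xi>"
    and alpha: "\<And>r. 0 \<le> r \<Longrightarrow> \<alpha> r \<in> {0<..1 - pc} \<and> \<xi> (pc + \<alpha> r) = r"
    and exponents: "0 < \<nu>" "0 < \<beta>"
    and log_scaling: "log_scaling M pc \<xi> \<nu> \<beta>"
begin

lemma pc: "0 < pc" "pc < 1" using threshold by (auto simp: is_threshold_def)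

lemma alpha_bounds: "0 \<le> r \<Longrightarrow> 0 < \<alpha> r" "0 \<le> r \<Longrightarrow> pc + \<alpha> r \<le> 1" "0 \<le> r \<Longrightarrow> \<xi> (pc + \<alpha> r) = r"
  using alpha[of r] by auto

text \<open>\<open>\<xi>\<close> is decreasing and takes the value \<open>r\<close> at
  \<open>pc + \<alpha> r\<close>, so \<open>\<alpha> s > \<alpha> r\<close> would force
  \<open>s \<le> r\<close>.\<close>

lemma alpha_antimono:
  assumes "0 \<le> r" "r \<le> s"
  shows "\<alpha> s \<le> \<alpha> r"
proof (rule ccontr)
  assume "\<not> \<alpha> s \<le> \<alpha> r"
  hence "\<xi> (pc + \<alpha> s) \<le> \<xi> (pc + \<alpha> r)"
    using assms alpha_bounds[of r] alpha_bounds[of s] by (intro monotone_onD[OF xi_antimono]) auto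
  hence "s \<le> r" using assms alpha_bounds by simp
  with assms \<open>\<not> \<alpha> s \<le> \<alpha> r\<close> show False by simp
qed

lemma alpha_small:
  assumes "0 < \<eta>"
  shows "\<forall>\<^sub>F r in at_top. \<alpha> r < \<eta>"
proof -
  define p where "p = min 1 (pc + \<eta>)"
  have p: "pc < p" "p \<le> 1" "p \<le> pc + \<eta>" using assms pc by (auto simp: p_def)
  show ?thesis using eventually_gt_at_top[of "\<xi> p"] eventually_ge_at_top[of 0]
  proof eventually_elim
    case (elim r)
    show ?case
    proof (rule ccontr)
      assume "\<not> \<alpha> r < \<eta>"
      hence "\<xi> (pc + \<alpha> r) \<le> \<xi> p"
        using p alpha_bounds[OF elim(2)] by (intro monotone_onD[OF xi_antimono]) auto
      thus False using elim alpha_bounds(3) by simp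
    qed
  qed
qed

lemma alpha_lim: "filterlim (\<lambda>r. pc + \<alpha> r) (at_right pc) at_top"
proof -
  have "(\<alpha> \<longlongrightarrow> 0) at_top"
  proof (rule tendstoI)
    fix \<epsilon> :: real assume "0 < \<epsilon>"
    from alpha_small[OF this] eventually_ge_at_top[of 0]
    show "\<forall>\<^sub>F r in at_top. dist (\<alpha> r) 0 < \<epsilon>"
    proof eventually_elim
      case (elim r) thus ?case using alpha_bounds(1)[OF elim(2)] by simp
    qed
  qed
  hence "((\<lambda>r. pc + \<alpha> r) \<longlongrightarrow> pc + 0) at_top" by (intro tendsto_intros)
  moreover have "\<forall>\<^sub>F r in at_top. pc + \<alpha> r \<in> {pc<..} \<and> pc + \<alpha> r \<noteq> pc"
    using eventually_ge_at_top[of 0]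
  proof eventually_elim
    case (elim r) thus ?case using alpha_bounds(1)[of r] by simp
  qed
  ultimately show ?thesis by (simp add: filterlim_at)
qed

text \<open>The percolation probability as a function of the correlation length.\<close>

definition theta :: "real \<Rightarrow> real" where "theta r = P_infinity M (pc + \<alpha> r)"

lemma theta_pos: "0 \<le> r \<Longrightarrow> 0 < theta r"
  using threshold alpha_bounds[of r] pc by (auto simp: theta_def is_threshold_def)

text \<open>The quotient of the two scaling relations along \<open>p = pc + \<alpha> r\<close>, in
  which \<open>ln (\<alpha> r)\<close> cancels.\<close>

lemma theta_scaling: "((\<lambda>r. ln (theta r) / ln r) \<longlongrightarrow> - \<beta> / \<nu>) at_top"
proof -
  have 1: "((\<lambda>p. ln (\<xi> p) / ln (\<bar>p - pc\<bar> powr (- \<nu>))) \<longlongrightarrow> 1) (at_right pc)"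
    "((\<lambda>p. ln (P_infinity M p) / ln ((p - pc) powr \<beta>)) \<longlongrightarrow> 1) (at_right pc)"
    using log_scaling by (auto simp: log_scaling_def log_equiv_def)
  have "((\<lambda>r. (ln (theta r) / ln (\<alpha> r powr \<beta>)) / (ln (\<xi> (pc + \<alpha> r)) / ln (\<bar>\<alpha> r\<bar> powr (- \<nu>))) * (- \<beta> / \<nu>))
      \<longlongrightarrow> 1 / 1 * (- \<beta> / \<nu>)) at_top"
    using filterlim_compose[OF 1(1) alpha_lim] filterlim_compose[OF 1(2) alpha_lim]
    by (intro tendsto_intros) (auto simp: theta_def[abs_def])
  moreover have "\<forall>\<^sub>F r in at_top. (ln (theta r) / ln (\<alpha> r powr \<beta>)) /
      (ln (\<xi> (pc + \<alpha> r)) / ln (\<bar>\<alpha> r\<bar> powr (- \<nu>))) * (- \<beta> / \<nu>) = ln (theta r) / ln r"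
    using alpha_small[OF zero_less_one] eventually_ge_at_top[of 2]
  proof eventually_elim
    case (elim r)
    have a: "0 < \<alpha> r" "\<xi> (pc + \<alpha> r) = r" using alpha_bounds elim(2) by auto
    have "ln (\<alpha> r) \<noteq> 0" "ln r \<noteq> 0" using a elim by auto
    thus ?case using a exponents by (simp add: ln_powr field_simps)
  qed
  ultimately have "((\<lambda>r. ln (theta r) / ln r) \<longlongrightarrow> 1 / 1 * (- \<beta> / \<nu>)) at_top"
    by (rule Lim_transform_eventually)
  thus ?thesis by simp
qed

text \<open>On the logarithmic scale the factor \<open>\<kappa>\<close> is invisible. Densities may
  therefore be compared at distances that differ by constant factors.\<close>

lemma theta_powr_bounds:
  assumes "0 < w" "0 < \<kappa>" "0 < \<eta>"
  shows "\<forall>\<^sub>F N in sequentially. real N powr (- (w / \<nu> * \<beta>) - \<eta>) \<le> theta ((\<kappa> * real N) powr w) \<and>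
    theta ((\<kappa> * real N) powr w) \<le> real N powr (- (w / \<nu> * \<beta>) + \<eta>)"
proof -
  have "filterlim (\<lambda>N::nat. (\<kappa> * real N) powr w) at_top sequentially" using assms by real_asymp
  from filterlim_compose[OF theta_scaling this]
  have 1: "(\<lambda>N. ln (theta ((\<kappa> * real N) powr w)) / ln ((\<kappa> * real N) powr w)) \<longlonglongrightarrow> - \<beta> / \<nu>" .
  have 2: "(\<lambda>N. ln ((\<kappa> * real N) powr w) / ln (real N)) \<longlonglongrightarrow> w" using assms by real_asymp
  have ev: "\<forall>\<^sub>F N in sequentially. 0 < ln ((\<kappa> * real N) powr w)" using assms by real_asymp
  have "(\<lambda>N. ln (theta ((\<kappa> * real N) powr w)) / ln ((\<kappa> * real N) powr w) *
      (ln ((\<kappa> * real N) powr w) / ln (real N))) \<longlonglongrightarrow> - \<beta> / \<nu> * w"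
    by (rule tendsto_mult[OF 1 2])
  moreover have "\<forall>\<^sub>F N in sequentially. ln (theta ((\<kappa> * real N) powr w)) / ln ((\<kappa> * real N) powr w) *
      (ln ((\<kappa> * real N) powr w) / ln (real N)) = ln (theta ((\<kappa> * real N) powr w)) / ln (real N)"
    using ev
  proof eventually_elim
    case (elim N)
    have "x / y * (y / z) = x / z" if "y \<noteq> 0" for x y z :: real using that by simp
    thus ?case using elim by (metis order_less_irrefl)
  qed
  ultimately have "(\<lambda>N. ln (theta ((\<kappa> * real N) powr w)) / ln (real N)) \<longlonglongrightarrow> - \<beta> / \<nu> * w"
    by (rule Lim_transform_eventually)
  hence "(\<lambda>N. ln (theta ((\<kappa> * real N) powr w)) / ln (real N)) \<longlonglongrightarrow> - (w / \<nu> * \<beta>)"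
    by (simp add: field_simps)
  from tendstoD[OF this assms(3)] eventually_ge_at_top[of 2]
  show ?thesis
  proof eventually_elim
    case (elim N)
    let ?t = "theta ((\<kappa> * real N) powr w)"
    have N: "0 < ln (real N)" "0 < real N" using elim(2) by auto
    have t: "0 < ?t" by (simp add: theta_pos)
    have "- (w / \<nu> * \<beta>) - \<eta> \<le> ln ?t / ln (real N)" "ln ?t / ln (real N) \<le> - (w / \<nu> * \<beta>) + \<eta>"
      using elim(1) by (auto simp: dist_real_def)
    hence "(- (w / \<nu> * \<beta>) - \<eta>) * ln (real N) \<le> ln ?t" "ln ?t \<le> (- (w / \<nu> * \<beta>) + \<eta>) * ln (real N)"
      using N(1) by (simp_all only: pos_le_divide_eq pos_divide_le_eq)
    hence "exp ((- (w / \<nu> * \<beta>) - \<eta>) * ln (real N)) \<le> exp (ln ?t)" "exp (ln ?t) \<le> exp ((- (w / \<nu> * \<beta>) + \<eta>) * ln (real N))"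
      by (simp_all only: exp_le_cancel_iff)
    moreover have "real N powr x = exp (x * ln (real N))" for x using N(2) by (simp add: powr_def)
    ultimately show ?case by (simp only: exp_ln[OF t])
  qed
qed

lemma P_infinity_eq: "P_infinity M p = perc_prob (\<lambda>_. p) (\<lambda>\<omega>. connects_to_infinity M \<omega> 0)"
  by (simp add: P_infinity_def hom_prob_eq)

text \<open>Any density strictly between \<open>pc\<close> and 1 would do; staying below it keeps
  the constants of \<open>dual_prob_bound\<close> uniform.\<close>

definition p1 :: real where "p1 = (1 + pc) / 2"

lemma p1: "pc < p1" "p1 < 1" using pc by (auto simp: p1_def)

lemma alpha_le_p1:
  assumes "0 < w" "0 < \<kappa>"
  shows "\<forall>\<^sub>F N in sequentially. pc + \<alpha> ((\<kappa> * real N) powr w) \<le> p1"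
proof -
  have "filterlim (\<lambda>N::nat. (\<kappa> * real N) powr w) at_top sequentially" using assms by real_asymp
  from eventually_compose_filterlim[OF alpha_small this, of "p1 - pc"] p1
  have "\<forall>\<^sub>F N in sequentially. \<alpha> ((\<kappa> * real N) powr w) < p1 - pc" by simp
  thus ?thesis by eventually_elim simp
qed

text \<open>The correlation length \<open>(\<kappa> * n) powr w\<close> is at most
  \<open>(m + 1) powr w\<close> for every \<open>m \<ge> N\<close>, so one density serves all
  radii.\<close>

lemma homogeneous_decay:
  assumes "0 < w" "w < 1" "0 < \<kappa>"
  obtains C where "C > 0"
    "\<forall>N n. pc + \<alpha> ((\<kappa> * real n) powr w) \<le> p1 \<longrightarrow> \<kappa> * real n \<le> real N + 1 \<longrightarrow>
       perc_prob (\<lambda>_. pc + \<alpha> ((\<kappa> * real n) powr w)) (\<lambda>\<omega>. reach 0 (real N) \<omega> \<and> \<not> connects_to_infinity M \<omega> 0)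
         \<le> C / (real N + 1) ^ 3"
proof -
  obtain K C where KC: "K > 0" "C > 0"
    "\<forall>q z N. z \<in> sites M \<longrightarrow> (\<forall>x. 0 \<le> q x \<and> q x \<le> 1) \<longrightarrow>
       (\<forall>m\<ge>N. \<exists>p>pc. p \<le> p1 \<and> (\<forall>x. lnorm M (x - z) \<le> real m + K \<longrightarrow> p \<le> q x) \<and>
          \<xi> p \<le> (1 * (real m + 1)) powr w) \<longrightarrow>
       perc_prob q (\<lambda>\<omega>. reach z (real N) \<omega> \<and> \<not> connects_to_infinity M \<omega> z) \<le> C / (real N + 1) ^ 3"
    by (rule finite_cluster_decay[OF correlation_length xi_antimono less_imp_le[OF pc(1)] p1 assms(1,2) zero_less_one])
  show ?thesis
  proof (rule that[OF KC(2)], intro allI impI)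
    fix N n assume n: "pc + \<alpha> ((\<kappa> * real n) powr w) \<le> p1" "\<kappa> * real n \<le> real N + 1"
    let ?p = "pc + \<alpha> ((\<kappa> * real n) powr w)"
    have a: "0 < \<alpha> ((\<kappa> * real n) powr w)" "\<xi> ?p = (\<kappa> * real n) powr w" using alpha_bounds by auto
    show "perc_prob (\<lambda>_. ?p) (\<lambda>\<omega>. reach 0 (real N) \<omega> \<and> \<not> connects_to_infinity M \<omega> 0) \<le> C / (real N + 1) ^ 3"
    proof (rule KC(3)[rule_format, OF zero_site])
      show "0 \<le> ?p \<and> ?p \<le> 1" using a(1) pc p1 n by simp
      fix m assume m: "N \<le> m"
      have "(\<kappa> * real n) powr w \<le> (1 * (real m + 1)) powr w"
        using assms n(2) m by (intro powr_mono2) auto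
      thus "\<exists>p>pc. p \<le> p1 \<and> (\<forall>x. lnorm M (x - 0) \<le> real m + K \<longrightarrow> p \<le> ?p) \<and> \<xi> p \<le> (1 * (real m + 1)) powr w"
        using a n by (intro exI[of _ ?p]) simp
    qed
  qed
qed

text \<open>Since \<open>P\<^sub>\<infinity>\<close> at correlation length \<open>n\<^sup>w\<close> is at least of order \<open>n\<^sup>-\<^sup>2\<close> for every \<open>w < 1\<close>, the
  exponent of the expected number of sites is positive.\<close>

lemma exponent_less_2:
  assumes "rsw_bounds M pc" "0 < w" "w < 1"
  shows "w / \<nu> * \<beta> < 2"
proof -
  \<comment> \<open>Strictly above \<open>w\<close>: the comparison yields only
    \<open>w' / \<nu> * \<beta> \<le> 2\<close>, and going back to \<open>w\<close> makes the
    inequality strict.\<close>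
  define w' where "w' = (1 + w) / 2"
  have w': "w < w'" "0 < w'" "w' < 1" using assms by (auto simp: w'_def)
  have le: "w' / \<nu> * \<beta> \<le> 2"
  proof (rule ccontr)
    assume "\<not> w' / \<nu> * \<beta> \<le> 2"
    define \<eta> where "\<eta> = (w' / \<nu> * \<beta> - 2) / 2"
    have \<eta>: "0 < \<eta>" "- (w' / \<nu> * \<beta>) + \<eta> = - 2 - \<eta>" using \<open>\<not> w' / \<nu> * \<beta> \<le> 2\<close> by (auto simp: \<eta>_def field_simps)
    obtain c where c: "c > 0" "\<forall>\<^sub>F n in sequentially. c / (real n + 1)\<^sup>2 \<le> perc_prob (\<lambda>_. pc) (reach 0 (real n - 1))"
      by (rule one_arm_lower_bound[OF threshold assms(1)])
    obtain C where C: "C > 0" "\<forall>N n. pc + \<alpha> ((1 * real n) powr w') \<le> p1 \<longrightarrow> 1 * real n \<le> real N + 1 \<longrightarrow>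
       perc_prob (\<lambda>_. pc + \<alpha> ((1 * real n) powr w')) (\<lambda>\<omega>. reach 0 (real N) \<omega> \<and> \<not> connects_to_infinity M \<omega> 0)
         \<le> C / (real N + 1) ^ 3"
      by (rule homogeneous_decay[OF w'(2,3) zero_less_one])
    have "\<forall>\<^sub>F n in sequentially. c / (real n + 1)\<^sup>2 \<le> real n powr (- 2 - \<eta>) + C / real n ^ 3"
      using c(2) alpha_le_p1[OF w'(2) zero_less_one] theta_powr_bounds[OF w'(2) zero_less_one \<eta>(1)]
        eventually_ge_at_top[of 1]
    proof eventually_elim
      case (elim n)
      let ?p = "pc + \<alpha> ((1 * real n) powr w')"
      have p: "pc < ?p" "?p \<le> 1" using alpha_bounds by auto
      have n1: "real (n - 1) = real n - 1" using elim(4) by (simp add: of_nat_diff)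
      have "c / (real n + 1)\<^sup>2 \<le> perc_prob (\<lambda>_. pc) (reach 0 (real n - 1))" by (rule elim(1))
      also have "\<dots> \<le> perc_prob (\<lambda>_. ?p) (reach 0 (real n - 1))"
        using p pc elim(4) by (intro perc_prob_reach_mono) auto
      also have "\<dots> \<le> perc_prob (\<lambda>_. ?p) (\<lambda>\<omega>. connects_to_infinity M \<omega> 0) +
          perc_prob (\<lambda>_. ?p) (\<lambda>\<omega>. reach 0 (real n - 1) \<omega> \<and> \<not> connects_to_infinity M \<omega> 0)"
        by (rule reach_le_infinite[OF zero_site])
      also have "perc_prob (\<lambda>_. ?p) (\<lambda>\<omega>. connects_to_infinity M \<omega> 0) \<le> real n powr (- 2 - \<eta>)"
        using conjunct2[OF elim(3)] unfolding \<eta>(2) theta_def P_infinity_eq .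
      also have "perc_prob (\<lambda>_. ?p) (\<lambda>\<omega>. reach 0 (real n - 1) \<omega> \<and> \<not> connects_to_infinity M \<omega> 0) \<le> C / real n ^ 3"
        using C(2)[rule_format, of n "n - 1"] elim(2,4) by (simp add: n1)
      finally show ?case by simp
    qed
    \<comment> \<open>Both terms on the right are of smaller order than \<open>1 / n ^ 2\<close>, so
      each is eventually below half of the left-hand side.\<close>
    moreover have "\<forall>\<^sub>F n::nat in sequentially. real n powr (- 2 - \<eta>) < c / 2 / (real n + 1)\<^sup>2"
      using c(1) \<eta>(1) by real_asymp
    moreover have "\<forall>\<^sub>F n::nat in sequentially. C / real n ^ 3 < c / 2 / (real n + 1)\<^sup>2"
      using c(1) C(1) by real_asymp
    ultimately have "\<forall>\<^sub>F n::nat in sequentially. False"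
    proof eventually_elim
      case (elim n)
      have "c / 2 / (real n + 1)\<^sup>2 + c / 2 / (real n + 1)\<^sup>2 = c / (real n + 1)\<^sup>2"
        by (simp add: add_divide_distrib[symmetric])
      thus ?case using elim by linarith
    qed
    thus False by simp
  qed
  have "w / \<nu> * \<beta> < w' / \<nu> * \<beta>" using w'(1) exponents by (intro mult_strict_right_mono divide_strict_right_mono)
  thus ?thesis using le by simp
qed

section \<open>The inhomogeneous model\<close>

definition inhom :: "real \<Rightarrow> complex \<Rightarrow> real" where "inhom w z = pc + \<alpha> (lnorm M z powr w)"

lemma inhom_bounds: "0 \<le> inhom w z \<and> inhom w z \<le> 1"
  using alpha_bounds[of "lnorm M z powr w"] pc by (auto simp: inhom_def)

lemma inhom_ge: "0 < w \<Longrightarrow> lnorm M z \<le> r \<Longrightarrow> pc + \<alpha> (r powr w) \<le> inhom w z"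
  using alpha_antimono[of "lnorm M z powr w" "r powr w"] powr_mono2[of w "lnorm M z" r] by (simp add: inhom_def)

lemma inhom_le: "0 < w \<Longrightarrow> 0 \<le> r \<Longrightarrow> r \<le> lnorm M z \<Longrightarrow> inhom w z \<le> pc + \<alpha> (r powr w)"
  using alpha_antimono[of "r powr w" "lnorm M z powr w"] powr_mono2[of w r "lnorm M z"] by (simp add: inhom_def)

definition expected_count :: "real \<Rightarrow> nat \<Rightarrow> real" where
  "expected_count w N = (\<Sum>z\<in>{z\<in>sites M. lnorm M z \<le> real N}. perc_prob (inhom w) (\<lambda>\<omega>. connects_to_infinity M \<omega> z))"

lemma expected_count_eq:
  "(\<integral>\<omega>. real (cluster_count M N \<omega>) \<partial>inhom_percolation M pc \<alpha> w) = expected_count w N"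
  unfolding inhom_percolation_def expected_cluster_count expected_count_def inhom_def[abs_def] ..

text \<open>Whether a site within \<open>N\<close> of the origin reaches distance \<open>N\<close>
  depends only on elements at distance at most \<open>3 * N\<close> from the origin, where the
  density is at least the one with correlation length \<open>(3 * N) powr w\<close>. The subtracted
  term accounts for large finite clusters.\<close>

lemma expected_count_lower:
  assumes w: "0 < w" "w < 1"
  obtains C where "C > 0"
    "\<forall>\<^sub>F N in sequentially. real N ^ 2 * (theta ((3 * real N) powr w) - C / (real N + 1) ^ 3) \<le> expected_count w N"
proof -
  have ex: "\<exists>K C. K > 0 \<and> C > 0 \<and> (\<forall>q z N. z \<in> sites M \<longrightarrow> (\<forall>x. 0 \<le> q x \<and> q x \<le> 1) \<longrightarrow>
       (\<forall>m\<ge>N. \<exists>p>pc. p \<le> p1 \<and> (\<forall>x. lnorm M (x - z) \<le> real m + K \<longrightarrow> p \<le> q x) \<and>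
          \<xi> p \<le> (3 * (real m + 1)) powr w) \<longrightarrow>
       perc_prob q (\<lambda>\<omega>. reach z (real N) \<omega> \<and> \<not> connects_to_infinity M \<omega> z) \<le> C / (real N + 1) ^ 3)"
    by (rule finite_cluster_decay[OF correlation_length xi_antimono less_imp_le[OF pc(1)] p1 w, of 3]) auto
  then obtain K C where KC: "K > 0" "C > 0" "\<forall>q z N. z \<in> sites M \<longrightarrow> (\<forall>x. 0 \<le> q x \<and> q x \<le> 1) \<longrightarrow>
       (\<forall>m\<ge>N. \<exists>p>pc. p \<le> p1 \<and> (\<forall>x. lnorm M (x - z) \<le> real m + K \<longrightarrow> p \<le> q x) \<and>
          \<xi> p \<le> (3 * (real m + 1)) powr w) \<longrightarrow>
       perc_prob q (\<lambda>\<omega>. reach z (real N) \<omega> \<and> \<not> connects_to_infinity M \<omega> z) \<le> C / (real N + 1) ^ 3"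
    by (elim exE conjE)
  show ?thesis
  proof (rule that[OF KC(2)])
    show "\<forall>\<^sub>F N in sequentially. real N ^ 2 * (theta ((3 * real N) powr w) - C / (real N + 1) ^ 3) \<le> expected_count w N"
      using alpha_le_p1[OF w(1) zero_less_one] eventually_ge_at_top[of "nat \<lceil>K + bond_bound\<rceil>"]
        eventually_ge_at_top[of 1]
    proof eventually_elim
      case (elim N)
      \<comment> \<open>It makes \<open>N + N + bond_bound\<close> at most \<open>3 * N\<close>, and
        \<open>N + m + K\<close> at most \<open>3 * (m + 1)\<close> for
        \<open>m \<ge> N\<close>.\<close>
      have NK: "K + bond_bound \<le> real N" using elim(2) by linarith
      let ?p = "pc + \<alpha> ((3 * real N) powr w)"
      have p: "pc < ?p" "?p \<le> 1" using alpha_bounds by auto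
      let ?q = "theta ((3 * real N) powr w) - C / (real N + 1) ^ 3"
      have low: "?q \<le> perc_prob (inhom w) (\<lambda>\<omega>. connects_to_infinity M \<omega> z)"
        if z: "z \<in> trans" "lnorm M z \<le> real N" for z
      proof -
        have zs: "z \<in> sites M" using z(1) by (rule trans_site)
        have far: "lnorm M x \<le> real N + r" if "lnorm M (x - z) \<le> r" for x r
          using lnorm_triangle[of "x - z" z] that z(2) by simp
        have "theta ((3 * real N) powr w) \<le> perc_prob (\<lambda>_. ?p) (reach 0 (real N))"
          unfolding theta_def P_infinity_eq by (rule infinite_le_reach[OF zero_site])
        also have "\<dots> = perc_prob (\<lambda>_. ?p) (reach z (real N))"
          using reach_translate[OF z(1), of ?p 0 "real N"] by simp
        also have "\<dots> \<le> perc_prob (inhom w) (reach z (real N))"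
        proof (rule perc_prob_reach_mono)
          fix x assume "lnorm M (x - z) \<le> real N + bond_bound"
          from far[OF this] NK KC(1) show "?p \<le> inhom w x" by (intro inhom_ge w) simp
        qed (use p pc inhom_bounds in auto)
        also have "\<dots> \<le> perc_prob (inhom w) (\<lambda>\<omega>. connects_to_infinity M \<omega> z) +
            perc_prob (inhom w) (\<lambda>\<omega>. reach z (real N) \<omega> \<and> \<not> connects_to_infinity M \<omega> z)"
          by (rule reach_le_infinite[OF zs])
        also have "perc_prob (inhom w) (\<lambda>\<omega>. reach z (real N) \<omega> \<and> \<not> connects_to_infinity M \<omega> z) \<le> C / (real N + 1) ^ 3"
        proof (rule KC(3)[rule_format, OF zs inhom_bounds])
          fix m assume m: "N \<le> m"
          let ?r = "3 * (real m + 1)"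
          have a: "0 < \<alpha> (?r powr w)" "\<xi> (pc + \<alpha> (?r powr w)) = ?r powr w" using alpha_bounds by auto
          have "\<alpha> (?r powr w) \<le> \<alpha> ((1 * real N) powr w)"
            using m w by (intro alpha_antimono powr_mono2) auto
          moreover have "pc + \<alpha> (?r powr w) \<le> inhom w x" if "lnorm M (x - z) \<le> real m + K" for x
            using far[OF that] NK m bond_bound(1) by (intro inhom_ge w) simp
          ultimately show "\<exists>p>pc. p \<le> p1 \<and> (\<forall>x. lnorm M (x - z) \<le> real m + K \<longrightarrow> p \<le> inhom w x) \<and>
              \<xi> p \<le> (3 * (real m + 1)) powr w"
            using a elim(1) by (intro exI[of _ "pc + \<alpha> (?r powr w)"]) auto
        qed
        finally show ?thesis by simp
      qed
      let ?T = "{t\<in>trans. lnorm M t \<le> real N}" and ?S = "{z\<in>sites M. lnorm M z \<le> real N}"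
      have finS: "finite ?S" using finite_sites_lnorm[of 0 "real N"] by simp
      have TS: "?T \<subseteq> ?S" using trans_site by auto
      have nn: "0 \<le> expected_count w N" unfolding expected_count_def using perc_prob_bounds by (intro sum_nonneg) auto
      show ?case
      proof (cases "0 \<le> ?q")
        case True
        have "real N ^ 2 * ?q \<le> real (card ?T) * ?q" using card_trans True by (rule mult_right_mono)
        also have "\<dots> = (\<Sum>z\<in>?T. ?q)" by simp
        also have "\<dots> \<le> (\<Sum>z\<in>?T. perc_prob (inhom w) (\<lambda>\<omega>. connects_to_infinity M \<omega> z))"
          using low by (intro sum_mono) auto
        also have "\<dots> \<le> expected_count w N"
          unfolding expected_count_def using perc_prob_bounds by (intro sum_mono2 finS TS) auto
        finally show ?thesis .
      next
        case False
        hence "real N ^ 2 * ?q \<le> 0" by (intro mult_nonneg_nonpos) auto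
        thus ?thesis using nn by linarith
      qed
    qed
  qed
qed

text \<open>A path of extent about \<open>N / 4\<close> from a site between \<open>N div 2\<close>
  and \<open>N\<close> stays at distance at least \<open>N / 8\<close> from the origin, so its
  elements have at most the density with correlation length \<open>(N / 8) powr w\<close>. In the
  homogeneous model of that density, reaching so far almost means being infinite.\<close>

lemma expected_count_recursion:
  assumes w: "0 < w" "w < 1"
  obtains C where "C > 0"
    "\<forall>\<^sub>F N in sequentially. expected_count w N \<le> expected_count w (N div 2) +
       C * real N ^ 2 * (theta ((1 / 8 * real N) powr w) + 1 / real N ^ 3)"
proof -
  obtain c where c: "c > 0" "\<And>z p R. z \<in> sites M \<Longrightarrow> pc \<le> p \<Longrightarrow> p \<le> 1 \<Longrightarrow>
       c * perc_prob (\<lambda>_. p) (reach z (R + 1)) \<le> perc_prob (\<lambda>_. p) (reach 0 R)"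
    by (rule reach_from_site[OF pc(1)]) (rule that; blast)
  have "(0::real) < 1 / 8" by simp
  obtain C where C: "C > 0"
    "\<forall>N n. pc + \<alpha> ((1 / 8 * real n) powr w) \<le> p1 \<longrightarrow> 1 / 8 * real n \<le> real N + 1 \<longrightarrow>
       perc_prob (\<lambda>_. pc + \<alpha> ((1 / 8 * real n) powr w)) (\<lambda>\<omega>. reach 0 (real N) \<omega> \<and> \<not> connects_to_infinity M \<omega> 0)
         \<le> C / (real N + 1) ^ 3"
    by (rule homogeneous_decay[OF w \<open>0 < 1 / 8\<close>])
  obtain C2 where C2: "C2 > 0" "\<And>z R. 0 \<le> R \<Longrightarrow> real (card {v\<in>sites M. lnorm M (v - z) \<le> R}) \<le> C2 * (R + 1)\<^sup>2"
    using card_sites_lnorm by blast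
  \<comment> \<open>The 4 comes from \<open>N + 1 \<le> 2 * N\<close> in the number of sites, the
    512 from \<open>R \<ge> N / 8\<close> in the cubic error, and \<open>c\<close> from passing to
    the origin.\<close>
  define D where "D = 4 * C2 * (1 + 512 * C) / c"
  show ?thesis
  proof (rule that)
    show "D > 0" using C(1) C2(1) c(1) by (simp add: D_def)
    show "\<forall>\<^sub>F N in sequentially. expected_count w N \<le> expected_count w (N div 2) +
       D * real N ^ 2 * (theta ((1 / 8 * real N) powr w) + 1 / real N ^ 3)"
      using alpha_le_p1[OF w(1) \<open>0 < 1 / 8\<close>] eventually_ge_at_top[of "16 * nat \<lceil>bond_bound\<rceil>"]
        eventually_ge_at_top[of 16]
    proof eventually_elim
      case (elim N)
      define H where "H = N div 2"
      define R where "R = H div 2"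
      have HR: "real N \<le> 2 * real H + 1" "real H \<le> 2 * real R + 1" "2 * real R \<le> real H"
        unfolding R_def H_def by linarith+
      have L: "bond_bound \<le> real N / 16" using elim(2) by linarith
      have N16: "16 \<le> real N" using elim(3) by simp
      have R1: "1 \<le> R" "real (R - 1) = real R - 1" using HR N16 by (auto simp: of_nat_diff)
      let ?p = "pc + \<alpha> ((1 / 8 * real N) powr w)"
      have p: "pc < ?p" "?p \<le> 1" using alpha_bounds by auto
      let ?b = "theta ((1 / 8 * real N) powr w) + 1 / real N ^ 3"
      have th: "0 < theta ((1 / 8 * real N) powr w)" by (simp add: theta_pos)
      have up: "perc_prob (inhom w) (\<lambda>\<omega>. connects_to_infinity M \<omega> z) \<le> (1 + 512 * C) / c * ?b"
        if z: "z \<in> sites M" "real H < lnorm M z" for z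
      proof -
        have "perc_prob (inhom w) (\<lambda>\<omega>. connects_to_infinity M \<omega> z) \<le> perc_prob (inhom w) (reach z (real R))"
          by (rule infinite_le_reach[OF z(1)])
        also have "\<dots> \<le> perc_prob (\<lambda>_. ?p) (reach z (real R))"
        proof (rule perc_prob_reach_mono)
          fix x assume "lnorm M (x - z) \<le> real R + bond_bound"
          hence "real H - (real R + bond_bound) \<le> lnorm M x"
            using lnorm_triangle[of x "z - x"] z(2) lnorm_commute[of x z] by simp
          thus "inhom w x \<le> ?p" using HR L N16 by (intro inhom_le w) auto
        qed (use p pc inhom_bounds in auto)
        also have "\<dots> \<le> perc_prob (\<lambda>_. ?p) (reach 0 (real R - 1)) / c"
          using c(2)[OF z(1), of ?p "real R - 1"] p c(1) by (simp add: pos_le_divide_eq mult.commute)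
        also have "\<dots> \<le> (theta ((1 / 8 * real N) powr w) + C * 512 / real N ^ 3) / c"
        proof (rule divide_right_mono)
          have "perc_prob (\<lambda>_. ?p) (\<lambda>\<omega>. connects_to_infinity M \<omega> 0) = theta ((1 / 8 * real N) powr w)"
            by (simp add: theta_def P_infinity_eq)
          moreover have "perc_prob (\<lambda>_. ?p) (\<lambda>\<omega>. reach 0 (real R - 1) \<omega> \<and> \<not> connects_to_infinity M \<omega> 0) \<le> C / real R ^ 3"
            using C(2)[rule_format, of N "R - 1"] elim(1) R1 HR N16 by simp
          moreover have "C / real R ^ 3 \<le> C / (real N / 8) ^ 3"
            using C(1) HR N16 R1 by (intro divide_left_mono power_mono mult_pos_pos) auto
          moreover have "C / (real N / 8) ^ 3 = C * 512 / real N ^ 3" by (simp add: power_divide)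
          ultimately show "perc_prob (\<lambda>_. ?p) (reach 0 (real R - 1)) \<le> theta ((1 / 8 * real N) powr w) + C * 512 / real N ^ 3"
            using reach_le_infinite[OF zero_site, of "\<lambda>_. ?p" "real R - 1"] by linarith
        qed (use c(1) in simp)
        also have "\<dots> \<le> ((1 + 512 * C) * ?b) / c"
        proof (rule divide_right_mono)
          have "0 \<le> 512 * C * theta ((1 / 8 * real N) powr w)" "0 \<le> 1 / real N ^ 3" using C(1) th by auto
          thus "theta ((1 / 8 * real N) powr w) + C * 512 / real N ^ 3 \<le> (1 + 512 * C) * ?b"
            by (simp add: algebra_simps)
        qed (use c(1) in simp)
        finally show ?thesis by simp
      qed
      let ?S = "\<lambda>N. {z\<in>sites M. lnorm M z \<le> real N}"
      let ?P = "\<lambda>z. perc_prob (inhom w) (\<lambda>\<omega>. connects_to_infinity M \<omega> z)"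
      have fin: "finite (?S N)" for N using finite_sites_lnorm[of 0 "real N"] by simp
      have sub: "?S H \<subseteq> ?S N" by (auto simp: H_def intro: order_trans[OF _ of_nat_mono[of "N div 2" N]])
      have split: "expected_count w N = sum ?P (?S N - ?S H) + expected_count w H"
        unfolding expected_count_def by (rule sum.subset_diff[OF sub fin])
      have "sum ?P (?S N - ?S H) \<le> (\<Sum>z\<in>?S N - ?S H. (1 + 512 * C) / c * ?b)"
        by (intro sum_mono up) auto
      also have "\<dots> = real (card (?S N - ?S H)) * ((1 + 512 * C) / c * ?b)" by simp
      also have "\<dots> \<le> (4 * C2 * real N ^ 2) * ((1 + 512 * C) / c * ?b)"
      proof (rule mult_right_mono)
        have "card (?S N - ?S H) \<le> card (?S N)" by (intro card_mono fin) auto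
        hence "real (card (?S N - ?S H)) \<le> C2 * (real N + 1)\<^sup>2" using C2(2)[of "real N" 0] by simp
        also have "\<dots> \<le> C2 * (2 * real N)\<^sup>2" using C2(1) N16 by (intro mult_left_mono power_mono) auto
        finally show "real (card (?S N - ?S H)) \<le> 4 * C2 * real N ^ 2" by (simp add: power_mult_distrib)
      qed (use C(1) c(1) th in simp)
      also have "\<dots> = D * real N ^ 2 * ?b" by (simp add: D_def)
      finally show ?case using split unfolding H_def by linarith
    qed
  qed
qed

theorem expected_count_log_equiv:
  assumes "rsw_bounds M pc" "0 < w" "w < 1"
  shows "log_equiv sequentially (expected_count w) (\<lambda>N. real N powr (2 - w / \<nu> * \<beta>))"
proof -
  define \<sigma> where "\<sigma> = w / \<nu> * \<beta>"
  have lb: "0 < \<sigma>" "\<sigma> < 2" using exponent_less_2[OF assms] exponents assms by (auto simp: \<sigma>_def)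
  show ?thesis
    unfolding \<sigma>_def[symmetric]
  proof (rule log_equiv_powrI)
    show "0 < 2 - \<sigma>" using lb by simp
  next
    fix \<eta> :: real assume \<eta>: "0 < \<eta>"
    \<comment> \<open>Below \<open>\<eta>\<close>, to leave room for constants, and at most
      \<open>1 / 2\<close>, so that \<open>\<sigma> + \<eta>' < 3\<close> and the cubic error is
      negligible.\<close>
    define \<eta>' where "\<eta>' = min (\<eta> / 2) (1 / 2)"
    have \<eta>': "0 < \<eta>'" "\<eta>' < \<eta>" "\<eta>' \<le> 1 / 2" using \<eta> by (auto simp: \<eta>'_def)
    obtain C where C: "C > 0" "\<forall>\<^sub>F N in sequentially. real N ^ 2 * (theta ((3 * real N) powr w) - C / (real N + 1) ^ 3) \<le> expected_count w N"
      by (rule expected_count_lower[OF assms(2,3)])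
    have "(0::real) < 3" by simp
    have "\<forall>\<^sub>F N in sequentially. real N powr (2 - \<sigma> - \<eta>) \<le> real N ^ 2 * (real N powr (- \<sigma> - \<eta>') - C / (real N + 1) ^ 3)"
    proof -
      define a b where "a = \<sigma> + \<eta>'" and "b = \<eta> - \<eta>'"
      have ab: "0 < a" "a < 3" "0 < b" using lb \<eta>' by (auto simp: a_def b_def)
      have "\<forall>\<^sub>F N::nat in sequentially. real N powr (2 - a - b) \<le> real N ^ 2 * (real N powr (- a) - C / (real N + 1) ^ 3)"
        using ab C(1) by real_asymp
      moreover have "2 - a - b = 2 - \<sigma> - \<eta>" "- a = - \<sigma> - \<eta>'" by (simp_all add: a_def b_def)
      ultimately show ?thesis by (simp only:)
    qed
    thus "\<forall>\<^sub>F N in sequentially. real N powr (2 - \<sigma> - \<eta>) \<le> expected_count w N"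
      using C(2) theta_powr_bounds[OF assms(2) \<open>0 < 3\<close> \<eta>'(1)]
    proof eventually_elim
      case (elim N)
      have "real N ^ 2 * (real N powr (- \<sigma> - \<eta>') - C / (real N + 1) ^ 3) \<le>
          real N ^ 2 * (theta ((3 * real N) powr w) - C / (real N + 1) ^ 3)"
        using elim(3) by (intro mult_left_mono) (auto simp: \<sigma>_def)
      thus ?case using elim(1,2) by linarith
    qed
  next
    fix \<eta> :: real assume \<eta>: "0 < \<eta>"
    \<comment> \<open>One half of the margin goes into the bound on \<open>theta\<close>, the other
      absorbs the factor \<open>B\<close> at the end.\<close>
    define \<eta>' where "\<eta>' = \<eta> / 2"
    have \<eta>': "0 < \<eta>'" "\<eta>' < \<eta>" using \<eta> by (auto simp: \<eta>'_def)
    \<comment> \<open>Positive because \<open>\<sigma> < 2\<close>, so the largest scales dominate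
      and the recursion sums to a power with the same exponent \<open>b\<close>.\<close>
    define b where "b = 2 - \<sigma> + \<eta>'"
    have b: "0 < b" using lb \<eta>' by (simp add: b_def)
    obtain C where C: "C > 0" "\<forall>\<^sub>F N in sequentially. expected_count w N \<le> expected_count w (N div 2) +
       C * real N ^ 2 * (theta ((1 / 8 * real N) powr w) + 1 / real N ^ 3)"
      by (rule expected_count_recursion[OF assms(2,3)])
    have "(0::real) < 1 / 8" by simp
    have "\<forall>\<^sub>F N in sequentially. expected_count w N \<le> expected_count w (N div 2) + (2 * C) * real N powr b"
      using C(2) theta_powr_bounds[OF assms(2) \<open>0 < 1 / 8\<close> \<eta>'(1)] eventually_ge_at_top[of 1]
    proof eventually_elim
      case (elim N)
      have N: "1 \<le> real N" using elim(3) by simp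
      have "1 / real N ^ 3 = real N powr (- 3)" using N by (simp add: powr_minus_divide powr_numeral)
      also have "\<dots> \<le> real N powr (- \<sigma> + \<eta>')" using N lb \<eta>' by (intro powr_mono) auto
      finally have "theta ((1 / 8 * real N) powr w) + 1 / real N ^ 3 \<le> 2 * real N powr (- \<sigma> + \<eta>')"
        using elim(2) by (simp add: \<sigma>_def)
      hence "C * real N ^ 2 * (theta ((1 / 8 * real N) powr w) + 1 / real N ^ 3) \<le>
          C * real N ^ 2 * (2 * real N powr (- \<sigma> + \<eta>'))" using C(1) by (intro mult_left_mono) auto
      also have "\<dots> = 2 * C * (real N powr 2 * real N powr (- \<sigma> + \<eta>'))" using N by (simp add: powr_numeral)
      also have "real N powr 2 * real N powr (- \<sigma> + \<eta>') = real N powr b"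
        unfolding powr_add[symmetric] b_def by (simp add: algebra_simps)
      finally show ?case using elim(1) by simp
    qed
    then obtain N0 where N0: "\<And>N. N0 \<le> N \<Longrightarrow> expected_count w N \<le> expected_count w (N div 2) + (2 * C) * real N powr b"
      unfolding eventually_sequentially by blast
    obtain B where B: "B > 0" "\<forall>N\<ge>1. expected_count w N \<le> B * real N powr b"
      by (rule halving_recursion[OF b, of "2 * C" "max 2 N0" "expected_count w"]) (use C(1) N0 in auto)
    have "\<forall>\<^sub>F N::nat in sequentially. B * real N powr b \<le> real N powr (b + \<eta>')"
      using \<eta>'(1) B(1) by real_asymp
    thus "\<forall>\<^sub>F N in sequentially. expected_count w N \<le> real N powr (2 - \<sigma> + \<eta>)"
      using eventually_ge_at_top[of 1]
    proof eventually_elim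
      case (elim N)
      have "b + \<eta>' = 2 - \<sigma> + \<eta>" by (simp add: b_def \<eta>'_def)
      thus ?case using elim B(2) by (metis order_trans)
    qed
  qed
qed

end

theorem corollary2p2:
  fixes M :: percolation_model
    and pc c \<delta> w \<nu> \<beta> lam :: real
    and \<xi> \<alpha> :: "real \<Rightarrow> real"
  assumes "planar_lattice M"
    and "is_threshold M pc"
    and "rsw_bounds M pc"
    and "0 < c" and "0 < \<delta>" and "\<delta> < 1"
    and "near_critical_relation M pc (c * \<delta>)"
    and "is_correlation_length M pc \<xi>"
    and "continuous_on {pc<..1} \<xi>"
    and "antimono_on {pc<..1} \<xi>"
    and "filterlim \<xi> at_top (at_right pc)"
    and "\<And>r. 0 \<le> r \<Longrightarrow> \<alpha> r \<in> {0<..1 - pc} \<and> \<xi> (pc + \<alpha> r) = r"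
    and "0 < w" and "w < 1"
    and "0 < \<nu>" and "0 < \<beta>"
    and "log_scaling M pc \<xi> \<nu> \<beta>"
    and "lam = w / \<nu>"
  shows "log_equiv sequentially
           (\<lambda>N. \<integral>\<omega>. real (cluster_count M N \<omega>) \<partial>inhom_percolation M pc \<alpha> w)
           (\<lambda>N. real N powr (2 - lam * \<beta>))"
proof -
  interpret scaling M pc \<nu> \<beta> \<xi> \<alpha>
    by unfold_locales (fact assms)+
  show ?thesis
    using expected_count_log_equiv[OF assms(3,13,14)] by (simp only: expected_count_eq assms(18))
qed

end
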